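(* Let $\mathcal{P}$ be a quasi-orthogonal rational HG-family. Then there exist a (nonzero) $g(u,s)\in\mathbb{C}(s)[u]$, $f\in\mathbb{C}(u,s)$ and $R\in\mathbb{C}[s]$ such that $\mathcal{P}$ is given by the pair $$\left(R(s),\; f(u,s)\,\frac{g(u,s+1)}{g(u,s)}\right),$$ and one of the following holds. (a) $R$ has degree $\le 2$, and there exist polynomials $q,v\in\mathbb{C}[t]$ of degree $\le1$ such that $$f(u,s)=\frac{(s-u)\,q(s+u)}{s\,q(s)\,[R(s+1)-R(0)]+(s+1)\,v(s)}.$$ (b) $R$ is a constant, and $$f(u,s)=\frac{s-u}{s+1}\cdot\frac{(s-u-b)\,q(s+u)}{s+d}$$ for some quadratic polynomial $q\in\mathbb{C}[t]$ and scalars $b,d\in\mathbb{C}$.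
   Context: A family of polynomials is a sequence $\mathcal{P}=(P_0,P_1,\dots)$ where $P_n\in\mathbb{C}[z]$ is monic of degree $n$. For $R\in\mathbb{C}[s]$ the Newtonian basis given by $R$ is the sequence $\{\Phi_k\}$ with $\Phi_{-1}=0$, $\Phi_0=1$, $\Phi_{k+1}=z\Phi_k+R(k)\Phi_k$ for $k\ge 0$. Write $P_n=\sum_{k=0}^n c(n,k)\Phi_k$; thus $c(n,n)=1$ for $n\ge 0$, and set $c(n,k)=0$ unless $n\ge k\ge 0$. $\mathcal{P}$ is a rational HG-family if there exist relatively prime polynomials $N(u,s),D(u,s)\in\mathbb{C}[u,s]$ and a Newtonian basis $\{\Phi_k\}$ given by some $R\in\mathbb{C}[s]$ such that $D(n,k)c(n,k+1)=N(n,k)c(n,k)$ for all $n,k\in\mathbb{Z}$. It is then said to be given by the pair $(R,N/D)$. A family $\mathcal{P}$ is quasi-orthogonal if there is a linear functional $M:\mathbb{C}[z]\to\mathbb{C}$ with $M(P_iP_j)=0$ for $i\ne j$ and $M(P_i^2)\neq 0$ for all $i$. *)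

theory Defs
  imports
    "HOL-Computational_Algebra.Computational_Algebra"
    "HOL-Computational_Algebra.Field_as_Ring"
begin

definition poly_family :: "(nat \<Rightarrow> complex poly) \<Rightarrow> bool" where
  "poly_family P \<longleftrightarrow> (\<forall>n. degree (P n) = n \<and> lead_coeff (P n) = 1)"

primrec newton_basis :: "complex poly \<Rightarrow> nat \<Rightarrow> complex poly" where
  "newton_basis R 0 = 1"
| "newton_basis R (Suc k) = [:0, 1:] * newton_basis R k + smult (poly R (of_nat k)) (newton_basis R k)"

text \<open>Since \<open>newton_basis R k\<close> is monic of degree \<open>k\<close>, a family determines its array of
  coefficients \<open>c\<close> uniquely; see \<open>newton_coeffs_unique\<close> below.\<close>

definition newton_coeffs ::
    "complex poly \<Rightarrow> (nat \<Rightarrow> complex poly) \<Rightarrow> (int \<Rightarrow> int \<Rightarrow> complex) \<Rightarrow> bool" where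
  "newton_coeffs R P c \<longleftrightarrow>
     (\<forall>n. P n = (\<Sum>k\<le>n. smult (c (int n) (int k)) (newton_basis R k))) \<and>
     (\<forall>n k. \<not> (0 \<le> k \<and> k \<le> n) \<longrightarrow> c n k = 0)"

text \<open>The ring \<open>\<complex>[u,s]\<close> is \<open>complex poly poly\<close>, with \<open>u\<close> the outer and \<open>s\<close> the inner variable;
  its fraction field is \<open>\<complex>(u,s)\<close>.  Likewise \<open>\<complex>(s)[u]\<close> is \<open>complex poly fract poly\<close>.\<close>

type_synonym bipoly = "complex poly poly"
type_synonym bifract = "complex poly poly fract"

definition eval2 :: "bipoly \<Rightarrow> complex \<Rightarrow> complex \<Rightarrow> complex" where
  "eval2 F a b = poly (poly F [:a:]) b"

definition const_rat :: "complex \<Rightarrow> bifract" where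
  "const_rat a = to_fract [:[:a:]:]"

definition var_u :: bifract where
  "var_u = to_fract [:0, 1:]"

definition var_s :: bifract where
  "var_s = to_fract [:[:0, 1:]:]"

definition poly_at :: "complex poly \<Rightarrow> bifract \<Rightarrow> bifract" where
  "poly_at p x = poly (map_poly const_rat p) x"

text \<open>Evaluation of an element of \<open>\<complex>(s)\<close> by means of its reduced representation.  It is meaningful
  for \<open>x\<close> transcendental over \<open>\<complex>\<close>, and is only used for \<open>x = var_s\<close> and \<open>x = var_s + 1\<close>.\<close>

definition rat_at :: "complex poly fract \<Rightarrow> bifract \<Rightarrow> bifract" where
  "rat_at r x = poly_at (fst (quot_of_fract r)) x / poly_at (snd (quot_of_fract r)) x"

text \<open>For \<open>g \<in> \<complex>(s)[u]\<close>, the element \<open>g(u,x)\<close> of \<open>\<complex>(u,s)\<close>.\<close>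

definition g_at :: "complex poly fract poly \<Rightarrow> bifract \<Rightarrow> bifract" where
  "g_at g x = poly (map_poly (\<lambda>r. rat_at r x) g) var_u"

text \<open>The condition \<open>D \<noteq> 0\<close> is no restriction: a coprime pair with \<open>D = 0\<close> has \<open>N\<close> a nonzero
  constant, which is impossible as \<open>c n n = 1\<close>.\<close>

definition given_by :: "(nat \<Rightarrow> complex poly) \<Rightarrow> complex poly \<Rightarrow> bifract \<Rightarrow> bool" where
  "given_by P R r \<longleftrightarrow>
     (\<exists>N D c. coprime N D \<and> D \<noteq> 0 \<and> r = Fract N D \<and> newton_coeffs R P c \<and>
        (\<forall>n k :: int. eval2 D (of_int n) (of_int k) * c n (k + 1) =
                      eval2 N (of_int n) (of_int k) * c n k))"

definition rational_HG_family :: "(nat \<Rightarrow> complex poly) \<Rightarrow> bool" where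
  "rational_HG_family P \<longleftrightarrow> poly_family P \<and> (\<exists>R r. given_by P R r)"

definition quasi_orthogonal :: "(nat \<Rightarrow> complex poly) \<Rightarrow> bool" where
  "quasi_orthogonal P \<longleftrightarrow>
     (\<exists>M :: complex poly \<Rightarrow> complex. Vector_Spaces.linear smult (*) M \<and>
        (\<forall>i j. i \<noteq> j \<longrightarrow> M (P i * P j) = 0) \<and> (\<forall>i. M (P i ^ 2) \<noteq> 0))"

lemma newton_basis_monic: "degree (newton_basis R k) = k \<and> lead_coeff (newton_basis R k) = 1"
proof (induction k)
  case (Suc k)
  have *: "newton_basis R (Suc k) = [:poly R (of_nat k), 1:] * newton_basis R k"
    by (simp add: algebra_simps)
  have nz: "newton_basis R k \<noteq> 0" using Suc by auto
  have "degree (newton_basis R (Suc k)) = Suc k"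
    unfolding * using Suc nz by (subst degree_mult_eq) auto
  moreover have "lead_coeff (newton_basis R (Suc k)) = 1"
    unfolding * lead_coeff_mult using Suc by (metis lead_coeff_pCons(1) mult_1 one_neq_zero lead_coeff_1 one_pCons pCons_eq_0_iff)
  ultimately show ?case by blast
qed simp

lemma newton_coeffs_unique:
  assumes "newton_coeffs R P c" and "newton_coeffs R P c'"
  shows "c = c'"
proof -
  have indep: "\<forall>k\<le>n. a k = 0" if "(\<Sum>k\<le>n. smult (a k) (newton_basis R k)) = 0" for a n
    using that
  proof (induction n)
    case 0 then show ?case by simp
  next
    case (Suc n)
    have "coeff (\<Sum>k\<le>n. smult (a k) (newton_basis R k)) (Suc n) = 0"
      by (auto simp: coeff_sum newton_basis_monic coeff_eq_0 intro!: sum.neutral)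
    moreover have "coeff (newton_basis R (Suc n)) (Suc n) = 1"
      using newton_basis_monic[of R "Suc n"] by metis
    moreover have "coeff (\<Sum>k\<le>Suc n. smult (a k) (newton_basis R k)) (Suc n) = 0"
      unfolding Suc.prems by simp
    ultimately have z: "a (Suc n) = 0"
      by (simp del: newton_basis.simps)
    then have "(\<Sum>k\<le>n. smult (a k) (newton_basis R k)) = 0"
      using Suc.prems by (simp del: newton_basis.simps)
    then show ?case using Suc.IH z le_Suc_eq by auto
  qed
  have "c n k = c' n k" for n k
  proof (cases "0 \<le> k \<and> k \<le> n")
    case True
    then obtain m j where mj: "n = int m" "k = int j" "j \<le> m"
      by (metis nonneg_int_cases of_nat_le_iff order_trans)
    have "(\<Sum>k\<le>m. smult (c (int m) (int k) - c' (int m) (int k)) (newton_basis R k)) = P m - P m"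
      using assms by (simp add: newton_coeffs_def smult_diff_left sum_subtractf)
    then show ?thesis using indep[of "\<lambda>k. c (int m) (int k) - c' (int m) (int k)" m] mj by auto
  next
    case False
    then show ?thesis using assms by (simp add: newton_coeffs_def)
  qed
  then show ?thesis by blast
qed

lemma const_rat_simps [simp]:
  "const_rat 0 = 0" "const_rat 1 = 1"
  "const_rat (a + b) = const_rat a + const_rat b" "const_rat (a * b) = const_rat a * const_rat b"
  by (simp_all add: const_rat_def flip: to_fract_add to_fract_mult one_pCons)

lemma poly_at_0 [simp]: "poly_at 0 x = 0"
  and poly_at_pCons [simp]: "poly_at (pCons a p) x = const_rat a + x * poly_at p x"
  by (simp_all add: poly_at_def map_poly_pCons)

lemma poly_at_add [simp]: "poly_at (p + q) x = poly_at p x + poly_at q x"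
  by (induction p q rule: poly_induct2) (simp_all add: algebra_simps)

lemma poly_at_smult [simp]: "poly_at (smult a p) x = const_rat a * poly_at p x"
  by (induction p) (simp_all add: algebra_simps)

lemma poly_at_mult [simp]: "poly_at (p * q) x = poly_at p x * poly_at q x"
  by (induction p) (simp_all add: algebra_simps)

lemma poly_at_to_fract: "poly_at p (to_fract [:r:]) = to_fract [:pcompose p r:]"
proof (induction p)
  case (pCons a p)
  then show ?case
    by (simp add: pcompose_pCons const_rat_def mult.commute flip: to_fract_add to_fract_mult)
qed simp

lemma poly_at_var_s: "poly_at p var_s = to_fract [:p:]"
  using poly_at_to_fract[of p "[:0, 1:]"] by (simp add: var_s_def pcompose_idR)

lemma poly_at_var_s_plus_1: "poly_at p (var_s + 1) = to_fract [:pcompose p [:1, 1:]:]"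
proof -
  have "var_s + 1 = to_fract [:[:1, 1:]:]"
    by (simp add: var_s_def one_pCons flip: to_fract_add to_fract_1)
  then show ?thesis by (simp add: poly_at_to_fract)
qed

lemma rat_at_Fract:
  assumes "b \<noteq> 0" and "x = var_s \<or> x = var_s + 1"
  shows "rat_at (Fract a b) x = poly_at a x / poly_at b x"
proof -
  have nz: "poly_at p x \<noteq> 0" if "p \<noteq> 0" for p
    using that assms(2) by (auto simp: poly_at_var_s poly_at_var_s_plus_1 pcompose_eq_0_iff)
  define a' b' where "a' = fst (quot_of_fract (Fract a b))" and "b' = snd (quot_of_fract (Fract a b))"
  have "b' \<noteq> 0" by (simp add: b'_def)
  moreover have "Fract a' b' = Fract a b" by (simp add: a'_def b'_def)
  ultimately have "a' * b = a * b'" using assms(1) by (simp add: eq_fract)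
  then have "poly_at a' x * poly_at b x = poly_at a x * poly_at b' x"
    by (metis poly_at_mult)
  then show ?thesis
    using nz[OF assms(1)] nz[OF \<open>b' \<noteq> 0\<close>]
    by (simp add: rat_at_def frac_eq_eq flip: a'_def b'_def)
qed

end

theory Submission
  imports Defs
begin

text \<open>Orthogonality yields a three-term recurrence
  \<open>c(n,k-1) - (R(k) + \<alpha>\<^sub>n) c(n,k) = c(n+1,k) + \<beta>\<^sub>n c(n-1,k)\<close> with \<open>\<beta>\<^sub>n \<noteq> 0\<close>.  As \<open>c(n,k+1) / c(n,k)\<close> is
  the rational function \<open>f\<close>, elimination shows that \<open>c(n+1,k) / c(n,k)\<close> is also a rational function, and
  that \<open>\<alpha>\<^sub>n\<close> and \<open>\<beta>\<^sub>n\<close> are rational in \<open>n\<close>.  For an irreducible polynomial depending on both \<open>u\<close> and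
  \<open>s\<close>, the orders along its integer translates have a potential on the lattice, and the recurrence limits
  where that potential can have strict minima.  This leaves
  \<open>f = g(u,s+1) / g(u,s) * P(s-u) Q(s+u) / \<Delta>(s)\<close>.  The recurrence is now a polynomial identity; its leading
  homogeneous forms leave only a few possibilities for the degrees of \<open>P\<close>, \<open>Q\<close>, \<open>R\<close>, \<open>\<Delta>\<close>, while
  \<open>c(n,n) = 1\<close>, \<open>c(n,n+1) = 0\<close> and \<open>c(n,-1) = 0\<close> give the factors \<open>s - u\<close> and \<open>s + 1\<close>.  When \<open>deg R = 2\<close>,
  the second coefficient in \<open>s\<close> shows that \<open>\<Delta>\<close> takes the required shape after one of its roots is moved by
  an integer, and this move is absorbed into \<open>g\<close> as a factor \<open>1 / h(s)\<close>.\<close>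

section \<open>Bivariate polynomials and rational functions\<close>

text \<open>The data \<open>c n k\<close> live on integer points, where numerators and denominators
  may vanish (\<open>c n k = 0\<close> for all \<open>k > n\<close>, to begin with), while orders of
  vanishing need identities between rational functions; the notion \<open>generic\<close> carries
  each identity from one side to the other. The forms \<open>s - u\<close> and \<open>s + u\<close>
  come from the shape of the recurrence. A potential with period \<open>(m, n)\<close> is seen
  through the form \<open>m * j - n * i\<close>. Unless \<open>m = |n|\<close>, some outer point of
  the four-point stencil is strictly extremal for that form, and a minimum can be pushed there,
  against the recurrence. Only the two diagonal directions escape. A factor
  \<open>g(u, s + 1) / g(u, s)\<close> can be split off in many ways, so \<open>g\<close> is chosen
  minimal; minimality keeps \<open>s - r\<close> and the linear factors of \<open>P(s - u)\<close>
  out of \<open>g\<close>. The integer by which a root of the denominator moves is the degree of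
  \<open>g\<close> in \<open>s\<close>: it is the factor that the difference
  \<open>g(u, s - 1) - g(u, s)\<close> brings into the coefficient next to the top one.\<close>

lemma poly_eqI_all:
  fixes p q :: "complex poly"
  assumes "\<And>x. poly p x = poly q x"
  shows "p = q"
  using assms poly_eq_poly_eq_iff by blast

lemma eval2_simps [simp]:
  "eval2 0 a b = 0" "eval2 1 a b = 1"
  "eval2 (F + G) a b = eval2 F a b + eval2 G a b"
  "eval2 (F - G) a b = eval2 F a b - eval2 G a b"
  "eval2 (- F) a b = - eval2 F a b"
  "eval2 (F * G) a b = eval2 F a b * eval2 G a b"
  "eval2 (F ^ n) a b = eval2 F a b ^ n"
  by (simp_all add: eval2_def poly_power)

lemma eval2_pCons [simp]: "eval2 (pCons c F) a b = poly c b + a * eval2 F a b"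
  by (simp add: eval2_def)

lemma eval2_smult [simp]: "eval2 (smult c F) a b = poly c b * eval2 F a b"
  by (simp add: eval2_def)

lemma eval2_conv_map_poly: "eval2 F a b = poly (map_poly (\<lambda>c. poly c b) F) a"
  by (induction F) (simp_all add: map_poly_pCons)

lemma bipoly_eqI:
  assumes "\<And>a b. eval2 F a b = eval2 G a b"
  shows "F = G"
proof (rule poly_eqI)
  fix i
  show "coeff F i = coeff G i"
  proof (rule poly_eqI_all)
    fix b
    have "map_poly (\<lambda>c. poly c b) F = map_poly (\<lambda>c. poly c b) G"
      by (rule poly_eqI_all) (use assms in \<open>simp add: eval2_conv_map_poly\<close>)
    then have "coeff (map_poly (\<lambda>c. poly c b) F) i = coeff (map_poly (\<lambda>c. poly c b) G) i"
      by simp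
    then show "poly (coeff F i) b = poly (coeff G i) b"
      by (simp add: coeff_map_poly)
  qed
qed

section \<open>Translations of polynomials in two variables\<close>

definition shift2 :: "complex \<Rightarrow> complex \<Rightarrow> bipoly \<Rightarrow> bipoly" where
  "shift2 a b F = pcompose (map_poly (\<lambda>c. pcompose c [:b, 1:]) F) [:[:a:], 1:]"

lemma eval2_shift2 [simp]: "eval2 (shift2 a b F) x y = eval2 F (x + a) (y + b)"
  unfolding shift2_def
  by (induction F) (simp_all add: map_poly_pCons pcompose_pCons poly_pcompose algebra_simps)

lemma shift2_simps [simp]:
  "shift2 a b 0 = 0" "shift2 a b 1 = 1"
  "shift2 a b (F + G) = shift2 a b F + shift2 a b G"
  "shift2 a b (F - G) = shift2 a b F - shift2 a b G"
  "shift2 a b (F * G) = shift2 a b F * shift2 a b G"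
  "shift2 a b (F ^ n) = shift2 a b F ^ n"
  "shift2 0 0 F = F"
  by (rule bipoly_eqI; simp)+

lemma shift2_shift2 [simp]: "shift2 a b (shift2 c d F) = shift2 (a + c) (b + d) F"
  by (rule bipoly_eqI) (simp add: algebra_simps)

lemma shift2_inject [simp]: "shift2 a b F = shift2 a b G \<longleftrightarrow> F = G"
proof
  assume "shift2 a b F = shift2 a b G"
  then have "shift2 (-a) (-b) (shift2 a b F) = shift2 (-a) (-b) (shift2 a b G)" by simp
  then show "F = G" by simp
qed simp

lemma shift2_eq_0_iff [simp]: "shift2 a b F = 0 \<longleftrightarrow> F = 0"
  using shift2_inject[of a b F 0] by simp

lemma shift2_dvd_iff [simp]: "shift2 a b F dvd shift2 a b G \<longleftrightarrow> F dvd G"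
proof
  have *: "shift2 c d X dvd shift2 c d Y" if "X dvd Y" for c d X Y
    using that by (auto simp: dvd_def)
  show "shift2 a b F dvd shift2 a b G" if "F dvd G" using *[OF that] .
  show "F dvd G" if "shift2 a b F dvd shift2 a b G"
    using *[OF that, of "-a" "-b"] by simp
qed

lemma shift2_dvd_left: "shift2 a b F dvd G \<longleftrightarrow> F dvd shift2 (-a) (-b) G"
  using shift2_dvd_iff[of "-a" "-b" "shift2 a b F" G] by simp

lemma shift2_unit_iff [simp]: "shift2 a b F dvd 1 \<longleftrightarrow> F dvd 1"
  using shift2_dvd_iff[of a b F 1] by simp

lemma prime_elem_shift2 [simp]: "prime_elem (shift2 a b p) \<longleftrightarrow> prime_elem p"
proof -
  have *: "prime_elem (shift2 c d q)" if "prime_elem q" for c d q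
  proof (rule prime_elemI)
    show "shift2 c d q \<noteq> 0" "\<not> shift2 c d q dvd 1" using that by (auto simp: prime_elem_def)
    fix X Y assume "shift2 c d q dvd X * Y"
    then have "q dvd shift2 (-c) (-d) X * shift2 (-c) (-d) Y"
      by (simp add: shift2_dvd_left)
    then show "shift2 c d q dvd X \<or> shift2 c d q dvd Y"
      using that by (simp add: shift2_dvd_left prime_elem_dvd_mult_iff)
  qed
  show ?thesis
    using *[of p a b] *[of "shift2 a b p" "-a" "-b"] by auto
qed

lemma degree_shift2 [simp]: "degree (shift2 a b F) = degree F"
proof -
  have *: "degree (shift2 c d G) \<le> degree G" for c d G
    unfolding shift2_def using map_poly_degree_leq[of "\<lambda>x. pcompose x [:d,1:]" G]
    by (simp add: degree_pcompose)
  show ?thesis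
    using *[of a b F] *[of "-a" "-b" "shift2 a b F"] by simp
qed

text \<open>A translation preserves the degree in \<open>u\<close>, the degree in \<open>s\<close>
  of the leading coefficient, and the leading coefficient of that; so the quotient is a constant,
  and the constant is 1. Divisibility between translates of a prime thus becomes equality.\<close>

lemma shift2_dvd_self_eq:
  assumes "F dvd shift2 a b F" "F \<noteq> 0"
  shows "shift2 a b F = F"
proof -
  obtain K where K: "shift2 a b F = F * K" using assms by (auto simp: dvd_def)
  then have Knz: "K \<noteq> 0" using assms by auto
  have "degree (F * K) = degree F" using K degree_shift2[of a b F] by simp
  then have "degree K = 0" using assms Knz by (simp add: degree_mult_eq)
  then obtain k where k: "K = [:k:]" by (metis degree_eq_zeroE)
  have *: "shift2 a b F = pcompose (map_poly (\<lambda>c. pcompose c [:b, 1:]) F) [:[:a:], 1:]"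
    by (simp add: shift2_def)
  have deg: "degree (map_poly (\<lambda>c. pcompose c [:b, 1:]) F) = degree F"
    using assms by (intro map_poly_degree_eq) (auto simp: pcompose_eq_0_iff)
  have "lead_coeff (shift2 a b F) = pcompose (lead_coeff F) [:b, 1:]"
    unfolding * by (subst lead_coeff_comp) (auto simp: deg coeff_map_poly)
  moreover have "lead_coeff (shift2 a b F) = lead_coeff F * k"
    using K k by (simp add: lead_coeff_mult)
  ultimately have e: "pcompose (lead_coeff F) [:b, 1:] = lead_coeff F * k" by simp
  have knz: "k \<noteq> 0" using Knz k by auto
  have "degree (lead_coeff F * k) = degree (lead_coeff F)"
    using arg_cong[OF e, of degree] by (simp add: degree_pcompose)
  then have "degree k = 0" using assms knz by (simp add: degree_mult_eq)
  then obtain c where c: "k = [:c:]" by (metis degree_eq_zeroE)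
  have "lead_coeff (pcompose (lead_coeff F) [:b, 1:]) = lead_coeff (lead_coeff F)"
    by (subst lead_coeff_comp) auto
  moreover have "lead_coeff (lead_coeff F * [:c:]) = lead_coeff (lead_coeff F) * c"
    by (subst lead_coeff_mult) simp
  ultimately have "lead_coeff (lead_coeff F) * c = lead_coeff (lead_coeff F)"
    using e c by simp
  moreover have "lead_coeff (lead_coeff F) \<noteq> 0" using assms by simp
  ultimately have "c = 1" by (metis mult_cancel_left2)
  then show ?thesis using K k c by (simp flip: one_pCons)
qed

text \<open>In \<open>P n k\<close> the index \<open>n\<close> must be large in terms of \<open>k\<close>.  The diagonals \<open>n - k = r\<close>, on which
  \<open>c n k\<close> may degenerate, are then left out, and a nonzero bivariate polynomial is generically nonzero.\<close>

definition generic :: "(nat \<Rightarrow> nat \<Rightarrow> bool) \<Rightarrow> bool" where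
  "generic P \<longleftrightarrow> (\<forall>\<^sub>F k in sequentially. \<forall>\<^sub>F n in sequentially. P n k)"

lemma generic_conj: "generic P \<Longrightarrow> generic Q \<Longrightarrow> generic (\<lambda>n k. P n k \<and> Q n k)"
  unfolding generic_def by (simp add: eventually_conj_iff)

lemma generic_mono: "generic P \<Longrightarrow> (\<And>n k. P n k \<Longrightarrow> Q n k) \<Longrightarrow> generic Q"
  unfolding generic_def by (elim eventually_mono) auto

lemma generic_False [simp]: "\<not> generic (\<lambda>n k. False)"
  by (simp add: generic_def)

lemma generic_Suc_n: "generic P \<Longrightarrow> generic (\<lambda>n k. P (Suc n) k)"
  unfolding generic_def
proof (erule eventually_mono)
  fix k assume "\<forall>\<^sub>F n in sequentially. P n k"
  then show "\<forall>\<^sub>F n in sequentially. P (Suc n) k"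
    by (rule eventually_sequentially_Suc[THEN iffD2])
qed

lemma generic_Suc_k: "generic P \<Longrightarrow> generic (\<lambda>n k. P n (Suc k))"
  unfolding generic_def by (rule eventually_sequentially_Suc[THEN iffD2])

lemma eventually_poly_nonzero:
  fixes p :: "complex poly"
  assumes "p \<noteq> 0"
  shows "\<forall>\<^sub>F n in sequentially. poly p (of_nat n) \<noteq> 0"
proof -
  have "finite {x. poly p x = 0}" using assms by (rule poly_roots_finite)
  then have "finite (of_nat -` {x. poly p x = 0} :: nat set)"
    by (rule finite_vimageI) (simp add: inj_on_def)
  then have "finite {n::nat. \<not> poly p (of_nat n) \<noteq> 0}"
    by (simp add: vimage_def)
  then show ?thesis
    by (simp only: eventually_cofinite flip: cofinite_eq_sequentially)
qed

lemma eventually_eval2_nonzero: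
  assumes "map_poly (\<lambda>c. poly c b) F \<noteq> 0"
  shows "\<forall>\<^sub>F n in sequentially. eval2 F (of_nat n) b \<noteq> 0"
  using eventually_poly_nonzero[OF assms] by (simp add: eval2_conv_map_poly)

text \<open>Away from the finitely many roots \<open>k\<close> of the leading coefficient in
  \<open>u\<close>, fixing \<open>s = k\<close> leaves a nonzero polynomial in \<open>n\<close>,
  with finitely many roots.\<close>

lemma generic_eval2_nonzero:
  assumes "F \<noteq> 0"
  shows "generic (\<lambda>n k. eval2 F (of_nat n) (of_nat k) \<noteq> 0)"
proof -
  have "\<forall>\<^sub>F k in sequentially. poly (lead_coeff F) (of_nat k) \<noteq> 0"
    using assms by (intro eventually_poly_nonzero) auto
  then show ?thesis unfolding generic_def
  proof (rule eventually_mono)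
    fix k :: nat assume "poly (lead_coeff F) (of_nat k) \<noteq> 0"
    then have "coeff (map_poly (\<lambda>c. poly c (of_nat k)) F) (degree F) \<noteq> 0"
      by (simp add: coeff_map_poly)
    then have "map_poly (\<lambda>c. poly c (of_nat k :: complex)) F \<noteq> 0" by auto
    then show "\<forall>\<^sub>F n in sequentially. eval2 F (of_nat n) (of_nat k) \<noteq> 0"
      by (rule eventually_eval2_nonzero)
  qed
qed

section \<open>Substitution of bivariate polynomials into univariate ones\<close>

definition lift2 :: "complex poly \<Rightarrow> bipoly \<Rightarrow> bipoly" where
  "lift2 p L = poly (map_poly (\<lambda>a. [:[:a:]:]) p) L"

lemma lift2_pCons [simp]: "lift2 (pCons a p) L = [:[:a:]:] + L * lift2 p L"
  and lift2_0 [simp]: "lift2 0 L = 0"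
  by (simp_all add: lift2_def map_poly_pCons)

lemma eval2_lift2 [simp]: "eval2 (lift2 p L) a b = poly p (eval2 L a b)"
  by (induction p) simp_all

lemma lift2_mult [simp]: "lift2 (p * q) L = lift2 p L * lift2 q L"
  and lift2_1 [simp]: "lift2 1 L = 1"
  by (rule bipoly_eqI; simp)+

lemma to_fract_lift2: "to_fract (lift2 p L) = poly_at p (to_fract L)"
  by (induction p) (simp_all add: const_rat_def)

abbreviation Us :: bipoly where "Us \<equiv> [:0, 1:]"
abbreviation Ss :: bipoly where "Ss \<equiv> [:[:0, 1:]:]"

lemma lift2_Us_eq_0_iff [simp]: "lift2 p Us = 0 \<longleftrightarrow> p = 0"
proof
  assume "lift2 p Us = 0"
  then have "poly p x = 0" for x using eval2_lift2[of p Us x 0] by simp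
  then show "p = 0" by (metis poly_all_0_iff_0)
qed simp

lemma lift2_Ss: "lift2 p Ss = [:p:]"
  by (rule bipoly_eqI) simp

section \<open>Evaluation and translation of rational functions\<close>

definition ev :: "bifract \<Rightarrow> complex \<Rightarrow> complex \<Rightarrow> complex" where
  "ev x a b = eval2 (fst (quot_of_fract x)) a b / eval2 (snd (quot_of_fract x)) a b"

text \<open>The reduced fraction only provides a definite representative: by
  \<open>fshift_div\<close> every representation gives the same result, so that
  \<open>fshift a b\<close> is a field automorphism.\<close>

definition fshift :: "complex \<Rightarrow> complex \<Rightarrow> bifract \<Rightarrow> bifract" where
  "fshift a b x = to_fract (shift2 a b (fst (quot_of_fract x))) / to_fract (shift2 a b (snd (quot_of_fract x)))"

lemma bifract_cases:
  obtains F G where "G \<noteq> 0" "(x :: bifract) = to_fract F / to_fract G"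
  using that[of "snd (quot_of_fract x)" "fst (quot_of_fract x)"] by (simp flip: Fract_conv_to_fract)

lemma fshift_div:
  assumes "G \<noteq> 0"
  shows "fshift a b (to_fract F / to_fract G) = to_fract (shift2 a b F) / to_fract (shift2 a b G)"
proof -
  define x where "x = to_fract F / to_fract G"
  define F' G' where "F' = fst (quot_of_fract x)" and "G' = snd (quot_of_fract x)"
  have G': "G' \<noteq> 0" by (simp add: G'_def)
  have "x = to_fract F' / to_fract G'"
    by (simp add: F'_def G'_def flip: Fract_conv_to_fract)
  then have "to_fract (F' * G) = to_fract (F * G')"
    using assms G' by (simp add: x_def field_simps)
  then have "F' * G = F * G'" by (simp only: to_fract_eq_iff)
  then have "shift2 a b F' * shift2 a b G = shift2 a b F * shift2 a b G'"
    by (simp only: flip: shift2_simps(5))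
  then have "to_fract (shift2 a b F') * to_fract (shift2 a b G) = to_fract (shift2 a b F) * to_fract (shift2 a b G')"
    by (simp flip: to_fract_mult)
  then show ?thesis
    using assms G' unfolding fshift_def x_def[symmetric] F'_def[symmetric] G'_def[symmetric]
    by (simp add: frac_eq_eq)
qed

lemma fshift_to_fract [simp]: "fshift a b (to_fract F) = to_fract (shift2 a b F)"
  using fshift_div[of 1 a b F] by simp

lemma fshift_add [simp]: "fshift a b (x + y) = fshift a b x + fshift a b y"
proof -
  obtain F G where x: "G \<noteq> 0" "x = to_fract F / to_fract G" by (rule bifract_cases)
  obtain H K where y: "K \<noteq> 0" "y = to_fract H / to_fract K" by (rule bifract_cases)
  have "x + y = to_fract (F * K + H * G) / to_fract (G * K)"
    using x y by (simp add: add_frac_eq)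
  then have "fshift a b (x + y) = to_fract (shift2 a b (F * K + H * G)) / to_fract (shift2 a b (G * K))"
    using x y by (simp only: fshift_div mult_eq_0_iff simp_thms)
  also have "\<dots> = fshift a b x + fshift a b y"
    using x y by (simp add: fshift_div add_frac_eq)
  finally show ?thesis .
qed

lemma fshift_mult [simp]: "fshift a b (x * y) = fshift a b x * fshift a b y"
proof -
  obtain F G where x: "G \<noteq> 0" "x = to_fract F / to_fract G" by (rule bifract_cases)
  obtain H K where y: "K \<noteq> 0" "y = to_fract H / to_fract K" by (rule bifract_cases)
  have "x * y = to_fract (F * H) / to_fract (G * K)"
    using x y by simp
  then have "fshift a b (x * y) = to_fract (shift2 a b (F * H)) / to_fract (shift2 a b (G * K))"
    using x y by (simp only: fshift_div mult_eq_0_iff simp_thms)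
  also have "\<dots> = fshift a b x * fshift a b y"
    using x y by (simp add: fshift_div)
  finally show ?thesis .
qed

lemma fshift_0 [simp]: "fshift a b 0 = 0" and fshift_1 [simp]: "fshift a b 1 = 1"
  using fshift_to_fract[of a b 0] fshift_to_fract[of a b 1] by simp_all

lemma fshift_uminus [simp]: "fshift a b (- x) = - fshift a b x"
  using fshift_add[of a b x "-x"] by (metis add.right_inverse add_eq_0_iff fshift_0)

lemma fshift_diff [simp]: "fshift a b (x - y) = fshift a b x - fshift a b y"
  using fshift_add[of a b x "-y"] by simp

lemma fshift_00 [simp]: "fshift 0 0 x = x"
  by (cases x rule: bifract_cases) (simp add: fshift_div)

lemma fshift_fshift [simp]: "fshift a b (fshift c d x) = fshift (a + c) (b + d) x"
  by (cases x rule: bifract_cases) (simp add: fshift_div)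

lemma fshift_eq_iff [simp]: "fshift a b x = fshift a b y \<longleftrightarrow> x = y"
proof
  assume "fshift a b x = fshift a b y"
  then have "fshift (-a) (-b) (fshift a b x) = fshift (-a) (-b) (fshift a b y)" by simp
  then show "x = y" by simp
qed simp

lemma fshift_eq_0_iff [simp]: "fshift a b x = 0 \<longleftrightarrow> x = 0"
  using fshift_eq_iff[of a b x 0] by simp

lemma fshift_divide [simp]: "fshift a b (x / y) = fshift a b x / fshift a b y"
proof (cases "y = 0")
  case False
  then have "fshift a b (x / y) * fshift a b y = fshift a b x"
    by (simp flip: fshift_mult)
  then show ?thesis using False by (simp add: field_simps)
qed simp

lemma fshift_const [simp]: "fshift a b (const_rat c) = const_rat c"
proof -
  have "shift2 a b [:[:c:]:] = [:[:c:]:]" by (rule bipoly_eqI) simp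
  then show ?thesis by (simp add: const_rat_def)
qed

lemma fshift_poly_at [simp]: "fshift a b (poly_at p x) = poly_at p (fshift a b x)"
  by (induction p) simp_all

lemma fshift_var_u [simp]: "fshift a b var_u = var_u + const_rat a"
proof -
  have "shift2 a b Us = Us + [:[:a:]:]" by (rule bipoly_eqI) (simp add: algebra_simps)
  then show ?thesis by (simp add: const_rat_def var_u_def flip: to_fract_add)
qed

lemma fshift_var_s [simp]: "fshift a b var_s = var_s + const_rat b"
proof -
  have "shift2 a b Ss = Ss + [:[:b:]:]" by (rule bipoly_eqI) (simp add: algebra_simps)
  then show ?thesis by (simp add: const_rat_def var_s_def flip: to_fract_add)
qed

text \<open>At a pole the value is 0 by convention, so \<open>gev\<close> respects the field
  operations only where denominators do not vanish. This is why all its rules are generic.\<close>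

definition gev :: "bifract \<Rightarrow> nat \<Rightarrow> nat \<Rightarrow> complex" where
  "gev x n k = ev x (of_nat n) (of_nat k)"

lemma generic_gev_div:
  assumes "G \<noteq> 0"
  shows "generic (\<lambda>n k. gev (to_fract F / to_fract G) n k =
            eval2 F (of_nat n) (of_nat k) / eval2 G (of_nat n) (of_nat k) \<and> eval2 G (of_nat n) (of_nat k) \<noteq> 0)"
proof -
  define x where "x = to_fract F / to_fract G"
  define F' G' where "F' = fst (quot_of_fract x)" and "G' = snd (quot_of_fract x)"
  have G': "G' \<noteq> 0" by (simp add: G'_def)
  have "x = to_fract F' / to_fract G'"
    by (simp add: F'_def G'_def flip: Fract_conv_to_fract)
  then have "to_fract (F' * G) = to_fract (F * G')"
    using assms G' by (simp add: x_def field_simps)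
  then have *: "F' * G = F * G'" by (simp only: to_fract_eq_iff)
  have **: "eval2 F' a b * eval2 G a b = eval2 F a b * eval2 G' a b" for a b
    using arg_cong[OF *, of "\<lambda>H. eval2 H a b"] by simp
  show ?thesis
    using generic_conj[OF generic_eval2_nonzero[OF G'] generic_eval2_nonzero[OF assms]]
    by (rule generic_mono) (use ** in \<open>auto simp: gev_def ev_def frac_eq_eq x_def[symmetric] F'_def[symmetric] G'_def[symmetric]\<close>)
qed

lemma bifract_gev_cases:
  obtains F G where "G \<noteq> 0" "x = to_fract F / to_fract G"
    "generic (\<lambda>n k. gev x n k = eval2 F (of_nat n) (of_nat k) / eval2 G (of_nat n) (of_nat k) \<and>
       eval2 G (of_nat n) (of_nat k) \<noteq> 0)"
proof (cases x rule: bifract_cases)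
  case (1 F G)
  show ?thesis
    using that[OF 1] generic_gev_div[OF 1(1), of F] unfolding 1(2) by blast
qed

lemma generic_gev_mult: "generic (\<lambda>n k. gev (x * y) n k = gev x n k * gev y n k)"
  and generic_gev_diff: "generic (\<lambda>n k. gev (x - y) n k = gev x n k - gev y n k)"
proof -
  obtain F G where x: "G \<noteq> 0" "x = to_fract F / to_fract G" and gx:
    "generic (\<lambda>n k. gev x n k = eval2 F (of_nat n) (of_nat k) / eval2 G (of_nat n) (of_nat k) \<and>
       eval2 G (of_nat n) (of_nat k) \<noteq> 0)" by (rule bifract_gev_cases)
  obtain H K where y: "K \<noteq> 0" "y = to_fract H / to_fract K" and gy:
    "generic (\<lambda>n k. gev y n k = eval2 H (of_nat n) (of_nat k) / eval2 K (of_nat n) (of_nat k) \<and>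
       eval2 K (of_nat n) (of_nat k) \<noteq> 0)" by (rule bifract_gev_cases)
  have 1: "x * y = to_fract (F * H) / to_fract (G * K)"
    "x - y = to_fract (F * K - H * G) / to_fract (G * K)"
    using x(1) y(1) unfolding x(2) y(2) by (simp_all add: field_simps)
  have GK: "G * K \<noteq> 0" using x(1) y(1) by simp
  note xy = generic_conj[OF gx gy]
  show "generic (\<lambda>n k. gev (x * y) n k = gev x n k * gev y n k)"
    unfolding 1(1)
    by (rule generic_mono[OF generic_conj[OF xy generic_gev_div[OF GK, of "F * H"]]])
      (elim conjE, simp add: times_divide_times_eq del: to_fract_add to_fract_mult to_fract_diff)
  show "generic (\<lambda>n k. gev (x - y) n k = gev x n k - gev y n k)"
    unfolding 1(2)
    by (rule generic_mono[OF generic_conj[OF xy generic_gev_div[OF GK, of "F * K - H * G"]]])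
      (elim conjE, simp add: diff_frac_eq del: to_fract_add to_fract_mult to_fract_diff)
qed

lemma generic_gev_nonzero:
  assumes "x \<noteq> 0"
  shows "generic (\<lambda>n k. gev x n k \<noteq> 0)"
proof (cases x rule: bifract_gev_cases)
  case (1 F G)
  then have F: "F \<noteq> 0" using assms by auto
  show ?thesis
    by (rule generic_mono[OF generic_conj[OF generic_eval2_nonzero[OF F] 1(3)]]) auto
qed

lemma generic_gev_divide:
  assumes "y \<noteq> 0"
  shows "generic (\<lambda>n k. gev (x / y) n k = gev x n k / gev y n k)"
  using generic_conj[OF generic_gev_nonzero[OF assms] generic_gev_mult[of "x / y" y]]
  by (rule generic_mono) (use assms in \<open>auto simp: field_simps\<close>)

text \<open>The way back from values to rational functions: a nonzero difference would be
  generically nonzero.\<close>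

lemma generic_gev_eqD:
  assumes "generic (\<lambda>n k. gev x n k = gev y n k)"
  shows "x = y"
proof (rule ccontr)
  assume "x \<noteq> y"
  then have "generic (\<lambda>n k. gev (x - y) n k \<noteq> 0)"
    by (intro generic_gev_nonzero) auto
  from generic_conj[OF generic_conj[OF assms this] generic_gev_diff[of x y]]
  have "generic (\<lambda>n k. False)"
    by (rule generic_mono) auto
  then show False by simp
qed

lemma generic_gev_shift_u: "generic (\<lambda>n k. gev (fshift 1 0 x) n k = gev x (Suc n) k)"
  and generic_gev_shift_s: "generic (\<lambda>n k. gev (fshift 0 1 x) n k = gev x n (Suc k))"
proof -
  obtain F G where x: "G \<noteq> 0" "x = to_fract F / to_fract G" and gx:
    "generic (\<lambda>n k. gev x n k = eval2 F (of_nat n) (of_nat k) / eval2 G (of_nat n) (of_nat k) \<and>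
       eval2 G (of_nat n) (of_nat k) \<noteq> 0)" by (rule bifract_gev_cases)
  have e: "fshift a b x = to_fract (shift2 a b F) / to_fract (shift2 a b G)" for a b
    using x by (simp add: fshift_div)
  have nz: "shift2 a b G \<noteq> 0" for a b using x by simp
  show "generic (\<lambda>n k. gev (fshift 1 0 x) n k = gev x (Suc n) k)"
    unfolding e
    by (rule generic_mono[OF generic_conj[OF generic_gev_div[OF nz[of 1 0], of "shift2 1 0 F"] generic_Suc_n[OF gx]]])
      (auto simp: add.commute)
  show "generic (\<lambda>n k. gev (fshift 0 1 x) n k = gev x n (Suc k))"
    unfolding e
    by (rule generic_mono[OF generic_conj[OF generic_gev_div[OF nz[of 0 1], of "shift2 0 1 F"] generic_Suc_k[OF gx]]])
      (auto simp: add.commute)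
qed

section \<open>Potentials on the lattice\<close>

text \<open>The summation is restricted to the support because a sum over the infinite set of all
  \<open>k < j\<close> would be 0 by convention.\<close>

definition psum :: "(int \<Rightarrow> int) \<Rightarrow> int \<Rightarrow> int" where
  "psum h j = (\<Sum>k | k < j \<and> h k \<noteq> 0. h k)"

lemma psum_Suc:
  assumes "finite {k. h k \<noteq> 0}"
  shows "psum h (j + 1) = psum h j + h j"
proof (cases "h j = 0")
  case True
  then have "{k. k < j + 1 \<and> h k \<noteq> 0} = {k. k < j \<and> h k \<noteq> 0}"
    by (metis zless_add1_eq)
  then show ?thesis using True by (simp add: psum_def)
next
  case False
  then have "{k. k < j + 1 \<and> h k \<noteq> 0} = insert j {k. k < j \<and> h k \<noteq> 0}"
    by (auto simp: zless_add1_eq)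
  moreover have "finite {k. k < j \<and> h k \<noteq> 0}"
    by (rule finite_subset[OF _ assms]) auto
  ultimately show ?thesis by (simp add: psum_def)
qed

lemma psum_eq_0: "(\<And>k. k < j \<Longrightarrow> h k = 0) \<Longrightarrow> psum h j = 0"
  unfolding psum_def by (rule sum.neutral) auto

lemma psum_low:
  assumes "finite {k. h k \<noteq> 0}"
  obtains L where "\<And>j. j \<le> L \<Longrightarrow> h j = 0 \<and> psum h j = 0"
proof -
  obtain L where L: "\<And>k. h k \<noteq> 0 \<Longrightarrow> L < k"
  proof (cases "{k. h k \<noteq> 0} = {}")
    case False
    show ?thesis
      by (rule that[of "Min {k. h k \<noteq> 0} - 1"]) (use Min_le[OF assms] in force)
  qed auto
  show thesis
    by (rule that[of L]) (use L in \<open>force intro!: psum_eq_0\<close>)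
qed

lemma psum_high:
  assumes "finite {k. h k \<noteq> 0}"
  obtains J where "\<And>j. j \<ge> J \<Longrightarrow> h j = 0 \<and> psum h j = sum h {k. h k \<noteq> 0}"
proof -
  obtain J where J: "\<And>k. h k \<noteq> 0 \<Longrightarrow> k < J"
  proof (cases "{k. h k \<noteq> 0} = {}")
    case False
    show ?thesis
      by (rule that[of "Max {k. h k \<noteq> 0} + 1"]) (use Max_ge[OF assms] in force)
  qed auto
  have "h j = 0 \<and> psum h j = sum h {k. h k \<noteq> 0}" if "j \<ge> J" for j
  proof -
    have "{k. k < j \<and> h k \<noteq> 0} = {k. h k \<noteq> 0}" using J that by force
    moreover have "h j = 0" using J that by force
    ultimately show ?thesis by (simp add: psum_def)
  qed
  then show thesis using that by blast
qed

lemma psum_ge: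
  assumes "finite {k. h k \<noteq> 0}"
  shows "psum h j \<ge> - (\<Sum>k | h k \<noteq> 0. \<bar>h k\<bar>)"
proof -
  have "\<bar>psum h j\<bar> \<le> (\<Sum>k | k < j \<and> h k \<noteq> 0. \<bar>h k\<bar>)"
    unfolding psum_def by (rule sum_abs)
  also have "\<dots> \<le> (\<Sum>k | h k \<noteq> 0. \<bar>h k\<bar>)"
    by (rule sum_mono2) (use assms in auto)
  finally show ?thesis by linarith
qed

lemma int_induct_step:
  fixes i i0 :: int
  assumes "\<And>i. P i \<longleftrightarrow> P (i + 1)" "P i0"
  shows "P i"
proof (induction i rule: int_induct[of _ i0])
  case base show ?case by fact
next
  case (step1 i) then show ?case using assms(1)[of i] by simp
next
  case (step2 i) then show ?case using assms(1)[of "i - 1"] by simp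
qed

text \<open>The potential \<open>G\<close> with increments \<open>a\<close> and \<open>f\<close> models the order of vanishing of \<open>c n k\<close> along
  the integer translates of an irreducible polynomial.  The three-term recurrence relates the values at
  \<open>(i, j - 1)\<close>, \<open>(i, j)\<close>, \<open>(i + 1, j)\<close>, \<open>(i - 1, j)\<close>, whence none of the first and the last two can be
  the strict minimum.\<close>

locale lattice_order =
  fixes f a :: "int \<Rightarrow> int \<Rightarrow> int"
  assumes closed: "a i (j + 1) - a i j = f (i + 1) j - f i j"
    and fin_f: "finite {j. f i j \<noteq> 0}" and fin_a: "finite {j. a i j \<noteq> 0}"
    and min_right: "\<not> (a i j < 0 \<and> a i j < - f i (j - 1) \<and> a i j < - a (i - 1) j)"
    and min_left: "\<not> (- a (i - 1) j < 0 \<and> - a (i - 1) j < - f i (j - 1) \<and> - a (i - 1) j < a i j)"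
    and min_below: "\<not> (- f i (j - 1) < 0 \<and> - f i (j - 1) < a i j \<and> - f i (j - 1) < - a (i - 1) j)"
begin

definition G :: "int \<Rightarrow> int \<Rightarrow> int" where "G i j = psum (f i) j"

definition tot :: "int \<Rightarrow> int" where "tot i = (\<Sum>k | f i k \<noteq> 0. f i k)"

lemma G_up: "G i (j + 1) = G i j + f i j"
  unfolding G_def by (rule psum_Suc[OF fin_f])

lemma G_down: "G i (j - 1) = G i j - f i (j - 1)"
  using G_up[of i "j - 1"] by simp

text \<open>By \<open>closed\<close> the two sides differ by an amount independent of
  \<open>j\<close>, and far below everything vanishes. So the columns fit together without an
  additive constant.\<close>

lemma G_right: "G (i + 1) j = G i j + a i j"
proof -
  obtain L0 where L0: "\<And>j. j \<le> L0 \<Longrightarrow> G i j = 0"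
    unfolding G_def by (rule psum_low[OF fin_f[of i]]) blast
  obtain L1 where L1: "\<And>j. j \<le> L1 \<Longrightarrow> G (i + 1) j = 0"
    unfolding G_def by (rule psum_low[OF fin_f[of "i + 1"]]) blast
  obtain L2 where L2: "\<And>j. j \<le> L2 \<Longrightarrow> a i j = 0"
    by (rule psum_low[OF fin_a[of i]]) blast
  let ?L = "min L0 (min L1 L2)"
  show ?thesis
  proof (rule int_induct_step[of "\<lambda>j. G (i + 1) j = G i j + a i j" ?L])
    show "G (i + 1) j = G i j + a i j \<longleftrightarrow> G (i + 1) (j + 1) = G i (j + 1) + a i (j + 1)" for j
      using G_up[of i j] G_up[of "i + 1" j] closed[of i j] by linarith
    show "G (i + 1) ?L = G i ?L + a i ?L" using L0 L1 L2 by simp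
  qed
qed

lemma G_left: "G (i - 1) j = G i j - a (i - 1) j"
  using G_right[of "i - 1" j] by simp

lemma G_min_right: "\<not> (G (i + 1) j < G i j \<and> G (i + 1) j < G i (j - 1) \<and> G (i + 1) j < G (i - 1) j)"
  using min_right[of i j] by (simp add: G_right G_left G_down)

lemma G_min_left: "\<not> (G (i - 1) j < G i j \<and> G (i - 1) j < G i (j - 1) \<and> G (i - 1) j < G (i + 1) j)"
  using min_left[of i j] by (simp add: G_right G_left G_down)

lemma G_min_below: "\<not> (G i (j - 1) < G i j \<and> G i (j - 1) < G (i + 1) j \<and> G i (j - 1) < G (i - 1) j)"
  using min_below[of i j] by (simp add: G_right G_left G_down)

text \<open>\<open>tot i\<close> is the value of \<open>G i\<close> far above, where the horizontal
  increment vanishes as well.\<close>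

lemma tot_const: "tot i = tot 0"
proof (rule int_induct_step[of "\<lambda>i. tot i = tot 0" 0])
  fix i
  obtain J0 where J0: "\<And>j. j \<ge> J0 \<Longrightarrow> G i j = tot i"
    unfolding G_def tot_def by (rule psum_high[OF fin_f[of i]]) blast
  obtain J1 where J1: "\<And>j. j \<ge> J1 \<Longrightarrow> G (i + 1) j = tot (i + 1)"
    unfolding G_def tot_def by (rule psum_high[OF fin_f[of "i + 1"]]) blast
  obtain J2 where J2: "\<And>j. j \<ge> J2 \<Longrightarrow> a i j = 0"
    by (rule psum_high[OF fin_a[of i]]) blast
  let ?J = "max J0 (max J1 J2)"
  have "tot (i + 1) = tot i"
    using J0[of ?J] J1[of ?J] J2[of ?J] G_right[of i ?J] by simp
  then show "tot i = tot 0 \<longleftrightarrow> tot (i + 1) = tot 0" by simp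
qed simp

text \<open>If \<open>G\<close> were negative somewhere, take, among the points where it attains its
  minimum, one with the smallest value of \<open>M * j + N * i\<close>; \<open>bdd\<close> and
  \<open>low\<close> make both choices possible. Points with a smaller value of the form then carry
  strictly larger \<open>G\<close>, and the stencil is placed so that its other three points are of
  this kind.\<close>

lemma G_nonneg_if:
  assumes N: "N \<noteq> 0" and M: "M \<ge> 0" and bdd: "\<And>i j. G i j \<ge> c"
    and low: "\<And>i j. G i j < 0 \<Longrightarrow> M * j + N * i \<ge> d"
  shows "G i j \<ge> 0"
proof (rule ccontr)
  assume neg: "\<not> G i j \<ge> 0"
  define T where "T x = M * snd x + N * fst x" for x :: "int \<times> int"
  define H where "H x = G (fst x) (snd x)" for x :: "int \<times> int"
  obtain x0 where x0: "\<And>x. nat (H x0 - c) \<le> nat (H x - c)"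
    using ex_has_least_nat[of "\<lambda>x. True" undefined "\<lambda>x. nat (H x - c)"] by auto
  have min0: "H x0 \<le> H x" for x
    using x0[of x] bdd unfolding H_def by (metis diff_right_mono eq_diff_eq diff_ge_0_iff_ge nat_le_eq_zle le_diff_eq)
  have Hneg: "H x0 < 0" using min0[of "(i, j)"] neg by (simp add: H_def)
  obtain x where x: "H x = H x0" "\<And>y. H y = H x0 \<Longrightarrow> nat (T x - d) \<le> nat (T y - d)"
    using ex_has_least_nat[of "\<lambda>x. H x = H x0" x0 "\<lambda>x. nat (T x - d)"] by auto
  have minT: "T x \<le> T y" if "H y = H x0" for y
  proof -
    have "T x \<ge> d" "T y \<ge> d" using low Hneg x(1) that unfolding H_def T_def by auto
    then show ?thesis using x(2)[OF that] by simp
  qed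
  have gt: "H y > H x" if "T y < T x" for y
    using min0[of y] minT[of y] that x(1) by fastforce
  obtain p q where pq: "x = (p, q)" by (cases x)
  show False
  \<comment> \<open>The minimiser is the right end of the stencil for positive \<open>N\<close> and
    its left end for negative \<open>N\<close>.\<close>
  proof (cases "N > 0")
    case True
    have "H (p - 1, q) > H x" "H (p - 1, q - 1) > H x" "H (p - 2, q) > H x"
      by (rule gt; use True M in \<open>simp add: T_def pq algebra_simps\<close>)+
    then show False using G_min_right[of "p - 1" q] by (simp add: H_def pq diff_diff_eq)
  next
    case False
    have "H (p + 1, q) > H x" "H (p + 1, q - 1) > H x" "H (p + 2, q) > H x"
      by (rule gt; use False N M in \<open>simp add: T_def pq algebra_simps\<close>)+
    then show False using G_min_left[of "p + 1" q] by (simp add: H_def pq add.assoc)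
  qed
qed

text \<open>The case of a prime without integer periods. Outside a box \<open>G\<close> vanishes: in
  the outer columns and far below because no vertical increments have been met, far above because
  the horizontal increments are 0 there.\<close>

lemma finite_support_imp:
  assumes "finite {(i, j). f i j \<noteq> 0}" "finite {(i, j). a i j \<noteq> 0}"
  shows "G i j \<ge> 0" "tot i = 0"
proof -
  let ?X = "{(i, j). f i j \<noteq> 0} \<union> {(i, j). a i j \<noteq> 0}"
  have "finite ((\<lambda>x. max \<bar>fst x\<bar> \<bar>snd x\<bar>) ` ?X)" using assms by simp
  then obtain B where B: "\<And>x. x \<in> ?X \<Longrightarrow> max \<bar>fst x\<bar> \<bar>snd x\<bar> \<le> B"
    by (metis (no_types, lifting) bdd_above_finite bdd_above.E imageI)
  have f0: "f i j = 0" "a i j = 0" if "\<bar>i\<bar> > B \<or> \<bar>j\<bar> > B" for i j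
    using B[of "(i, j)"] that by fastforce+
  have col: "G i j = 0" if "\<bar>i\<bar> > B" for i j
    unfolding G_def by (rule psum_eq_0) (use f0 that in auto)
  have bot: "G i j = 0" if "j \<le> - B" for i j
    unfolding G_def by (rule psum_eq_0, rule f0(1)) (use that in linarith)
  have top: "G i j = 0" if "j > B" for i j
  proof (rule int_induct_step[of "\<lambda>i. G i j = 0" "\<bar>B\<bar> + 1"])
    have "a i j = 0" for i by (rule f0(2)) (use that in linarith)
    then show "G i j = 0 \<longleftrightarrow> G (i + 1) j = 0" for i using G_right[of i j] by simp
    show "G (\<bar>B\<bar> + 1) j = 0" by (rule col) simp
  qed
  have supp: "{(i, j). G i j \<noteq> 0} \<subseteq> {-\<bar>B\<bar>..\<bar>B\<bar>} \<times> {-\<bar>B\<bar>..\<bar>B\<bar>}" (is "?S \<subseteq> ?Box")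
  proof clarify
    fix i j assume nz: "G i j \<noteq> 0"
    have "\<not> \<bar>i\<bar> > B" "\<not> j \<le> - B" "\<not> j > B" using nz col bot top by blast+
    then show "i \<in> {-\<bar>B\<bar>..\<bar>B\<bar>} \<and> j \<in> {-\<bar>B\<bar>..\<bar>B\<bar>}" by auto
  qed
  have "finite ?Box" by simp
  then have "finite ((\<lambda>(i, j). G i j) ` ?Box)" by simp
  then obtain c where c: "\<And>x. x \<in> ?Box \<Longrightarrow> c \<le> G (fst x) (snd x)"
    by (metis (no_types, lifting) bdd_below_finite bdd_below.E imageI case_prod_unfold)
  have bdd: "G i j \<ge> min c 0" for i j
  proof (cases "(i, j) \<in> ?Box")
    case True then show ?thesis using c[OF True] by simp
  next
    case False then have "G i j = 0" using supp by auto
    then show ?thesis by simp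
  qed
  show "G i j \<ge> 0"
  proof (rule G_nonneg_if[of 1 0 "min c 0" "- \<bar>B\<bar>"])
    show "0 * j + 1 * i \<ge> - \<bar>B\<bar>" if "G i j < 0" for i j
    proof -
      have "(i, j) \<in> ?Box" using that by (intro subsetD[OF supp]) simp
      then show ?thesis by simp
    qed
  qed (use bdd in auto)
  have "f (\<bar>B\<bar> + 1) k = 0" for k by (rule f0(1)) linarith
  then have "tot (\<bar>B\<bar> + 1) = 0" unfolding tot_def by (intro sum.neutral) auto
  then show "tot i = 0" using tot_const by metis
qed

text \<open>The form \<open>T i j = m * j - n * i\<close> is constant along the period, so the
  finitely many columns \<open>0 \<le> i < m\<close> give bounds valid in the whole plane. If the
  total is positive, the zeros of \<open>G\<close> are bounded above in \<open>T\<close>, and a zero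
  with maximal \<open>T\<close> becomes a strict minimum at an outer stencil point.\<close>

lemma periodic_imp:
  assumes per: "\<And>i j. f (i + m) (j + n) = f i j" and m: "m > 0" and n: "n \<noteq> 0"
  shows "G i j \<ge> 0" "m \<noteq> \<bar>n\<bar> \<Longrightarrow> tot i \<le> 0"
proof -
  have Gper1: "G (i + m) (j + n) = G i j" for i j
  proof -
    have "{k. k < j + n \<and> f (i + m) k \<noteq> 0} = (\<lambda>k. k + n) ` {k. k < j \<and> f i k \<noteq> 0}" (is "?L = ?R")
    proof
      show "?R \<subseteq> ?L" using per by auto
      show "?L \<subseteq> ?R"
      proof
        fix k assume "k \<in> ?L"
        then have "k - n \<in> {k. k < j \<and> f i k \<noteq> 0}" using per[of i "k - n"] by auto
        then show "k \<in> ?R" by (rule image_eqI[rotated]) simp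
      qed
    qed
    then show ?thesis unfolding G_def psum_def by (simp add: sum.reindex per)
  qed
  have Gper: "G (i + t * m) (j + t * n) = G i j" for i j t
  proof (rule int_induct_step[of "\<lambda>t. G (i + t * m) (j + t * n) = G i j" 0])
    fix t
    have "i + (t + 1) * m = i + t * m + m" "j + (t + 1) * n = j + t * n + n"
      by (simp_all add: algebra_simps)
    then show "G (i + t * m) (j + t * n) = G i j \<longleftrightarrow> G (i + (t + 1) * m) (j + (t + 1) * n) = G i j"
      by (simp only: Gper1)
  qed simp
  define T where "T i j = m * j + (- n) * i" for i j
  \<comment> \<open>Each point can be moved along the period into the strip
    \<open>0 \<le> i < m\<close> without changing \<open>G\<close> or \<open>T\<close>.\<close>
  have red: "\<exists>i' j'. 0 \<le> i' \<and> i' < m \<and> G i' j' = G i j \<and> T i' j' = T i j" for i j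
  proof (intro exI conjI)
    let ?t = "i div m"
    show "0 \<le> i - ?t * m" "i - ?t * m < m"
      using m by (simp_all add: minus_div_mult_eq_mod)
    show "G (i - ?t * m) (j - ?t * n) = G i j"
      using Gper[of i "- ?t" j] by simp
    show "T (i - ?t * m) (j - ?t * n) = T i j" by (simp add: T_def algebra_simps)
  qed
  have fin: "finite {0..<m}" by simp
  obtain L where L: "\<And>i j. 0 \<le> i \<Longrightarrow> i < m \<Longrightarrow> j \<le> L \<Longrightarrow> G i j = 0"
  proof -
    have "\<forall>i. \<exists>L. \<forall>j\<le>L. G i j = 0"
      unfolding G_def using psum_low[OF fin_f] by metis
    then obtain l where l: "\<And>i j. j \<le> l i \<Longrightarrow> G i j = 0" by metis
    have "finite (l ` {0..<m})" "l ` {0..<m} \<noteq> {}" using m by auto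
    then show thesis
      by (intro that[of "Min (l ` {0..<m})"] l) (auto intro!: Min_le order_trans[OF _ Min_le])
  qed
  obtain U where U: "\<And>i j. 0 \<le> i \<Longrightarrow> i < m \<Longrightarrow> j \<ge> U \<Longrightarrow> G i j = tot 0"
  proof -
    have "\<exists>u. \<forall>j\<ge>u. G i j = tot 0" for i
    proof -
      obtain J where "\<And>j. j \<ge> J \<Longrightarrow> G i j = tot i"
        unfolding G_def tot_def by (rule psum_high[OF fin_f[of i]]) blast
      then show ?thesis using tot_const by metis
    qed
    then obtain u where u: "\<And>i j. j \<ge> u i \<Longrightarrow> G i j = tot 0" by metis
    have "finite (u ` {0..<m})" "u ` {0..<m} \<noteq> {}" using m by auto
    then show thesis
      by (intro that[of "Max (u ` {0..<m})"] u) (auto intro!: Max_ge order_trans[OF Max_ge])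
  qed
  obtain c where c: "\<And>i j. 0 \<le> i \<Longrightarrow> i < m \<Longrightarrow> G i j \<ge> c"
  proof -
    define s where "s i = - (\<Sum>k | f i k \<noteq> 0. \<bar>f i k\<bar>)" for i
    have s: "G i j \<ge> s i" for i j unfolding G_def s_def by (rule psum_ge[OF fin_f])
    have "finite (s ` {0..<m})" "s ` {0..<m} \<noteq> {}" using m by auto
    then show thesis
      by (intro that[of "Min (s ` {0..<m})"] order_trans[OF _ s]) (auto intro!: Min_le)
  qed
  have ni: "n * i \<le> \<bar>n\<bar> * m" "n * i \<ge> - (\<bar>n\<bar> * m)" if "0 \<le> i" "i < m" for i
  proof -
    have "\<bar>n * i\<bar> \<le> \<bar>n\<bar> * m" using that by (simp add: abs_mult mult_left_mono)
    then show "n * i \<le> \<bar>n\<bar> * m" "n * i \<ge> - (\<bar>n\<bar> * m)" by linarith+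
  qed
  show nonneg: "G i j \<ge> 0" for i j
  proof (rule G_nonneg_if[of "- n" m c "m * L - \<bar>n\<bar> * m"])
    show "G i j \<ge> c" for i j using red[of i j] c by metis
    fix i j assume "G i j < 0"
    then obtain i' j' where 1: "0 \<le> i'" "i' < m" "G i' j' < 0" "T i' j' = T i j" using red[of i j] by metis
    then have "j' > L" using L[of i' j'] by force
    then have "m * L \<le> m * j'" using m by simp
    moreover have "m * j' - n * i' = m * j - n * i" using 1(4) by (simp add: T_def)
    ultimately have "m * j - n * i \<ge> m * L - \<bar>n\<bar> * m" using ni[OF 1(1,2)] by linarith
    then show "m * j + - n * i \<ge> m * L - \<bar>n\<bar> * m" by simp
  qed (use m n in auto)
  show "tot i \<le> 0" if mn: "m \<noteq> \<bar>n\<bar>"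
  proof (rule ccontr)
    assume "\<not> tot i \<le> 0"
    then have t: "tot 0 > 0" using tot_const[of i] by simp
    let ?b = "m * U + \<bar>n\<bar> * m"
    have up: "T i j \<le> ?b" if z: "G i j = 0" for i j
    proof -
      obtain i' j' where 1: "0 \<le> i'" "i' < m" "G i' j' = 0" "T i' j' = T i j" using red[of i j] z by metis
      then have "j' < U" using U[of i' j'] t by force
      then have "m * j' \<le> m * U" using m by simp
      moreover have "T i' j' = m * j' - n * i'" by (simp add: T_def)
      ultimately show ?thesis using 1(4) ni[OF 1(1,2)] by linarith
    qed
    have "G 0 L = 0" using L m by simp
    then obtain x where x: "G (fst x) (snd x) = 0"
      "\<And>y. G (fst y) (snd y) = 0 \<Longrightarrow> nat (?b - T (fst x) (snd x)) \<le> nat (?b - T (fst y) (snd y))"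
      using ex_has_least_nat[of "\<lambda>x. G (fst x) (snd x) = 0" "(0, L)" "\<lambda>x. nat (?b - T (fst x) (snd x))"]
      by auto
    obtain p q where pq: "x = (p, q)" by (cases x)
    have gt: "G i' j' > G p q" if "T i' j' > T p q" for i' j'
    proof (rule ccontr)
      assume "\<not> G i' j' > G p q"
      then have "G i' j' = 0" using nonneg[of i' j'] x(1) pq by simp
      then show False using x(2)[of "(i', j')"] up[of i' j'] that pq by simp
    qed
    \<comment> \<open>The other three points of the stencil have to increase \<open>T\<close>. With
      the zero at the lower point this needs \<open>m > |n|\<close>, at the right end
      \<open>n > m\<close>, at the left end \<open>- n > m\<close>. For \<open>m = |n|\<close> no
      placement achieves it.\<close>
    consider "m > \<bar>n\<bar>" | "m < \<bar>n\<bar>" "n > 0" | "m < \<bar>n\<bar>" "n < 0" using mn n by linarith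
    then show False
    proof cases
      case 1
      have "G p (q + 1) > G p q" "G (p + 1) (q + 1) > G p q" "G (p - 1) (q + 1) > G p q"
        by (rule gt; use 1 m in \<open>simp add: T_def algebra_simps\<close>)+
      then show False using G_min_below[of p "q + 1"] by simp
    next
      case 2
      have "G (p - 1) q > G p q" "G (p - 1) (q - 1) > G p q" "G (p - 2) q > G p q"
        by (rule gt; use 2 m in \<open>simp add: T_def algebra_simps\<close>)+
      then show False using G_min_right[of "p - 1" q] by (simp add: diff_diff_eq)
    next
      case 3
      have "G (p + 1) q > G p q" "G (p + 1) (q - 1) > G p q" "G (p + 2) q > G p q"
        by (rule gt; use 3 m in \<open>simp add: T_def algebra_simps\<close>)+
      then show False using G_min_left[of "p + 1" q] by (simp add: add.assoc)
    qed
  qed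
qed

end

section \<open>Orders along translates of an irreducible polynomial\<close>

lemma multiplicity_shift2 [simp]: "multiplicity (shift2 a b p) (shift2 a b F) = multiplicity p F"
proof (cases "F = 0 \<or> p dvd 1")
  case True
  then show ?thesis by (auto simp: multiplicity_unit_left)
next
  case False
  then show ?thesis
    by (subst (1 2) multiplicity_eq_Max) (auto simp flip: shift2_simps(6))
qed

definition fval :: "bipoly \<Rightarrow> bifract \<Rightarrow> int" where
  "fval p x = int (multiplicity p (fst (quot_of_fract x))) - int (multiplicity p (snd (quot_of_fract x)))"

lemma fval_div:
  assumes "prime_elem p" "F \<noteq> 0" "G \<noteq> 0"
  shows "fval p (to_fract F / to_fract G) = int (multiplicity p F) - int (multiplicity p G)"
proof -
  define x where "x = to_fract F / to_fract G"
  define F' G' where "F' = fst (quot_of_fract x)" and "G' = snd (quot_of_fract x)"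
  have G': "G' \<noteq> 0" by (simp add: G'_def)
  have x': "x = to_fract F' / to_fract G'"
    by (simp add: F'_def G'_def flip: Fract_conv_to_fract)
  then have F': "F' \<noteq> 0" using assms by (auto simp: x_def)
  have "to_fract (F' * G) = to_fract (F * G')"
    using assms G' x' by (simp add: x_def field_simps)
  then have "F' * G = F * G'" by (simp only: to_fract_eq_iff)
  then have "multiplicity p (F' * G) = multiplicity p (F * G')" by simp
  then have "multiplicity p F' + multiplicity p G = multiplicity p F + multiplicity p G'"
    using assms G' F' by (simp add: prime_elem_multiplicity_mult_distrib)
  then show ?thesis
    unfolding fval_def x_def[symmetric] F'_def[symmetric] G'_def[symmetric] by linarith
qed

lemma bifract_nonzero_cases:
  assumes "(x :: bifract) \<noteq> 0"
  obtains F G where "F \<noteq> 0" "G \<noteq> 0" "x = to_fract F / to_fract G"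
  using bifract_cases[of x] assms by (metis div_0 to_fract_0)

lemma fval_to_fract:
  assumes "prime_elem p" "F \<noteq> 0"
  shows "fval p (to_fract F) = int (multiplicity p F)"
  using fval_div[OF assms, of 1] by simp

lemma fval_mult:
  assumes p: "prime_elem p" and "x \<noteq> 0" "y \<noteq> 0"
  shows "fval p (x * y) = fval p x + fval p y"
proof -
  obtain F G where x: "F \<noteq> 0" "G \<noteq> 0" "x = to_fract F / to_fract G"
    using assms by (auto elim: bifract_nonzero_cases)
  obtain H K where y: "H \<noteq> 0" "K \<noteq> 0" "y = to_fract H / to_fract K"
    using assms by (auto elim: bifract_nonzero_cases)
  have "x * y = to_fract (F * H) / to_fract (G * K)" using x y by simp
  then have "fval p (x * y) = int (multiplicity p (F * H)) - int (multiplicity p (G * K))"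
    using x y p by (simp only: fval_div mult_eq_0_iff simp_thms)
  also have "\<dots> = fval p x + fval p y"
    using x(1,2) y(1,2) p unfolding x(3) y(3)
    by (simp add: fval_div prime_elem_multiplicity_mult_distrib)
  finally show ?thesis .
qed

lemma fval_divide:
  assumes p: "prime_elem p" and "x \<noteq> 0" "y \<noteq> 0"
  shows "fval p (x / y) = fval p x - fval p y"
  using fval_mult[of p "x / y" y] assms by simp

lemma fval_fshift:
  assumes "prime_elem p" "x \<noteq> 0"
  shows "fval (shift2 a b p) (fshift a b x) = fval p x"
proof -
  obtain F G where x: "F \<noteq> 0" "G \<noteq> 0" "x = to_fract F / to_fract G"
    using assms by (auto elim: bifract_nonzero_cases)
  show ?thesis using x(1,2) assms(1) unfolding x(3) by (simp add: fshift_div fval_div)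
qed

lemma fval_uminus: 
  assumes "prime_elem p" "x \<noteq> 0"
  shows "fval p (- x) = fval p x"
proof -
  have "fval p (-1) = 0"
    using fval_to_fract[OF assms(1), of "-1"] by (simp add: multiplicity_unit_right)
  then show ?thesis using fval_mult[of p "-1" x] assms by simp
qed

text \<open>The disjunct \<open>x = 0\<close> gives the zero function infinite order, which
  \<open>fval\<close> cannot express.\<close>

definition vge :: "bipoly \<Rightarrow> int \<Rightarrow> bifract \<Rightarrow> bool" where
  "vge p m x \<longleftrightarrow> x = 0 \<or> m \<le> fval p x"

lemma vge_add:
  assumes p: "prime_elem p" and "vge p m x" "vge p m y"
  shows "vge p m (x + y)"
proof (cases "x = 0 \<or> y = 0 \<or> x + y = 0")
  case True
  then show ?thesis using assms by (auto simp: vge_def)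
next
  case False
  obtain F G where x: "F \<noteq> 0" "G \<noteq> 0" "x = to_fract F / to_fract G"
    using False by (auto elim: bifract_nonzero_cases)
  obtain H K where y: "H \<noteq> 0" "K \<noteq> 0" "y = to_fract H / to_fract K"
    using False by (auto elim: bifract_nonzero_cases)
  have e: "x + y = to_fract (F * K + H * G) / to_fract (G * K)"
    using x(2) y(2) unfolding x(3) y(3) by (simp add: add_frac_eq)
  then have nz: "F * K + H * G \<noteq> 0" using False by (metis div_0 to_fract_0)
  have nz': "G * K \<noteq> 0" using x y by simp
  have v: "m \<le> fval p x" "m \<le> fval p y" using assms False by (auto simp: vge_def)
  let ?l = "min (multiplicity p (F * K)) (multiplicity p (H * G))"
  have "p ^ ?l dvd F * K + H * G"
    by (intro dvd_add multiplicity_dvd') simp_all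
  then have "?l \<le> multiplicity p (F * K + H * G)"
    using p nz by (intro multiplicity_geI) (auto simp: prime_elem_def)
  moreover have "m + int (multiplicity p (G * K)) \<le> int (multiplicity p (F * K))"
    "m + int (multiplicity p (G * K)) \<le> int (multiplicity p (H * G))"
    using v x(1,2) y(1,2) p unfolding x(3) y(3)
    by (simp_all add: fval_div prime_elem_multiplicity_mult_distrib)
  moreover have "fval p (x + y) = int (multiplicity p (F * K + H * G)) - int (multiplicity p (G * K))"
    unfolding e by (rule fval_div[OF p nz nz'])
  ultimately show ?thesis unfolding vge_def by linarith
qed

lemma vge_uminus: "prime_elem p \<Longrightarrow> vge p m x \<Longrightarrow> vge p m (- x)"
  by (cases "x = 0") (auto simp: vge_def fval_uminus)

lemma vge_diff: "prime_elem p \<Longrightarrow> vge p m x \<Longrightarrow> vge p m y \<Longrightarrow> vge p m (x - y)"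
  using vge_add[of p m x "- y"] vge_uminus[of p m y] by simp

section \<open>Polynomials and rational functions fixed by a translation\<close>

lemma periodic_poly_const:
  fixes q :: "complex poly"
  assumes "m \<noteq> 0" and per: "\<And>x. poly q (x + m) = poly q x"
  shows "poly q x = poly q 0"
proof -
  have 1: "poly q (of_nat k * m) = poly q 0" for k
  proof (induction k)
    case (Suc k)
    have "of_nat (Suc k) * m = of_nat k * m + m" by (simp add: algebra_simps)
    then show ?case using per Suc by simp
  qed simp
  have "q = [:poly q 0:]"
  proof (rule ccontr)
    assume "q \<noteq> [:poly q 0:]"
    then have "finite {x. poly (q - [:poly q 0:]) x = 0}" by (intro poly_roots_finite) auto
    moreover have "range (\<lambda>k::nat. of_nat k * m) \<subseteq> {x. poly (q - [:poly q 0:]) x = 0}"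
      using 1 by auto
    moreover have "infinite (range (\<lambda>k::nat. of_nat k * m))"
      using \<open>m \<noteq> 0\<close> by (intro range_inj_infinite) (auto simp: inj_on_def)
    ultimately show False using finite_subset by blast
  qed
  then show ?thesis by (metis poly_const_conv)
qed

lemma shift_s_invariant:
  assumes "m \<noteq> 0" "shift2 0 m F = F"
  obtains P where "F = lift2 P Us"
proof
  have "eval2 F a (b + m) = eval2 F a b" for a b
    using arg_cong[OF assms(2), of "\<lambda>G. eval2 G a b"] by simp
  then have "eval2 F a b = eval2 F a 0" for a b
    using periodic_poly_const[OF assms(1), of "poly F [:a:]" b] by (simp add: eval2_def)
  then show "F = lift2 (map_poly (\<lambda>c. poly c 0) F) Us"
    by (intro bipoly_eqI) (simp add: eval2_conv_map_poly flip: eval2_conv_map_poly)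
qed

lemma shift_u_invariant:
  assumes "m \<noteq> 0" "shift2 m 0 F = F"
  obtains P where "F = [:P:]"
proof
  have "eval2 F (a + m) b = eval2 F a b" for a b
    using arg_cong[OF assms(2), of "\<lambda>G. eval2 G a b"] by simp
  then have "eval2 F a b = eval2 F 0 b" for a b
    using periodic_poly_const[OF assms(1), of "map_poly (\<lambda>c. poly c b) F" a]
    by (simp add: eval2_conv_map_poly)
  then show "F = [:poly F 0:]"
    by (intro bipoly_eqI) (simp add: eval2_def)
qed

text \<open>On each line in direction \<open>(1, e)\<close> the polynomial is periodic, hence
  constant, so its values on \<open>u = 0\<close> determine it.\<close>

lemma shift_diag_invariant:
  assumes "m \<noteq> 0" "shift2 m (e * m) F = F"
  obtains P where "F = lift2 P (Ss - [:[:e:]:] * Us)"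
proof
  have *: "eval2 F (a + m) (b + e * m) = eval2 F a b" for a b
    using arg_cong[OF assms(2), of "\<lambda>G. eval2 G a b"] by simp
  have "eval2 F a b = eval2 F 0 (b - e * a)" for a b
  proof -
    define Q where "Q = poly (map_poly (\<lambda>c. pcompose c [:b - e * a, e:]) F) [:0, 1:]"
    have Q: "poly Q x = eval2 F x (b - e * a + e * x)" for x
      unfolding Q_def by (induction F) (simp_all add: map_poly_pCons poly_pcompose algebra_simps)
    have "poly Q (x + m) = poly Q x" for x
      using *[of x "b - e * a + e * x"] by (simp add: Q algebra_simps)
    then have "poly Q a = poly Q 0" by (rule periodic_poly_const[OF assms(1)])
    then show ?thesis by (simp add: Q)
  qed
  moreover have "eval2 F 0 t = poly (poly F 0) t" for t by (simp add: eval2_def)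
  ultimately show "F = lift2 (poly F 0) (Ss - [:[:e:]:] * Us)"
    by (intro bipoly_eqI) (simp add: mult.commute)
qed

text \<open>In a reduced fraction equal to its own translate, numerator and denominator each divide
  their translates, hence are invariant by \<open>shift2_dvd_self_eq\<close>.\<close>

lemma fshift_s_invariant:
  assumes "fshift 0 1 x = x"
  obtains P Q where "Q \<noteq> 0" "x = poly_at P var_u / poly_at Q var_u"
proof -
  define F G where "F = fst (quot_of_fract x)" and "G = snd (quot_of_fract x)"
  have G: "G \<noteq> 0" by (simp add: G_def)
  have x: "x = to_fract F / to_fract G"
    by (simp add: F_def G_def flip: Fract_conv_to_fract)
  have cop: "coprime F G" unfolding F_def G_def by (rule coprime_quot_of_fract)
  have "to_fract (shift2 0 1 F) / to_fract (shift2 0 1 G) = to_fract F / to_fract G"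
    using assms G unfolding x by (simp add: fshift_div)
  then have "to_fract (shift2 0 1 F * G) = to_fract (F * shift2 0 1 G)"
    using G by (simp add: field_simps)
  then have e: "shift2 0 1 F * G = F * shift2 0 1 G" by (simp only: to_fract_eq_iff)
  have "F dvd shift2 0 1 F * G" using e by simp
  then have "F dvd shift2 0 1 F" using cop by (simp add: coprime_dvd_mult_left_iff)
  then have "shift2 0 1 F = F" by (cases "F = 0") (auto intro: shift2_dvd_self_eq)
  then obtain P where P: "F = lift2 P Us" using shift_s_invariant[of 1 F] by auto
  have "G dvd F * shift2 0 1 G" using e by (metis dvd_triv_right)
  then have "G dvd shift2 0 1 G" using cop by (simp add: coprime_commute coprime_dvd_mult_right_iff)
  then have "shift2 0 1 G = G" using G by (rule shift2_dvd_self_eq)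
  then obtain Q where Q: "G = lift2 Q Us" using shift_s_invariant[of 1 G] by auto
  have "Q \<noteq> 0" using Q G by auto
  moreover have "x = poly_at P var_u / poly_at Q var_u"
    by (simp add: x P Q to_fract_lift2 var_u_def)
  ultimately show thesis by (rule that)
qed

text \<open>Distinct translates of a prime are not associated, by \<open>shift2_dvd_self_eq\<close>,
  and \<open>F\<close> has only finitely many prime factors up to units.\<close>

lemma finite_shift_dvd:
  assumes "prime_elem p" "F \<noteq> 0"
    and "\<And>x y. x \<in> K \<Longrightarrow> y \<in> K \<Longrightarrow> shift2 (a x) (b x) p = shift2 (a y) (b y) p \<Longrightarrow> x = y"
  shows "finite {x \<in> K. shift2 (a x) (b x) p dvd F}"
proof (rule finite_imageD)
  let ?h = "\<lambda>x. normalize (shift2 (a x) (b x) p)"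
  have "?h ` {x \<in> K. shift2 (a x) (b x) p dvd F} \<subseteq> prime_factors F"
    using assms(1,2) by (auto simp: prime_factors_dvd)
  then show "finite (?h ` {x \<in> K. shift2 (a x) (b x) p dvd F})"
    by (rule finite_subset) simp
  show "inj_on ?h {x \<in> K. shift2 (a x) (b x) p dvd F}"
  proof (rule inj_onI)
    fix x y assume xy: "x \<in> {x \<in> K. shift2 (a x) (b x) p dvd F}" "y \<in> {x \<in> K. shift2 (a x) (b x) p dvd F}"
      and "?h x = ?h y"
    then have "shift2 (a x) (b x) p dvd shift2 (a y) (b y) p"
      by (metis associated_iff_dvd)
    then have "p dvd shift2 (a y - a x) (b y - b x) p"
      by (simp add: shift2_dvd_left)
    then have "shift2 (a y - a x) (b y - b x) p = p"
      using assms(1) by (intro shift2_dvd_self_eq) auto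
    then have "shift2 (a x) (b x) (shift2 (a y - a x) (b y - b x) p) = shift2 (a x) (b x) p" by simp
    then have "shift2 (a x) (b x) p = shift2 (a y) (b y) p" by simp
    then show "x = y" using assms(3) xy by auto
  qed
qed

text \<open>Invariance under a nonzero integer translation in one variable amounts to independence
  of that variable. This form is chosen because its failure says that the integer translates of
  \<open>p\<close> along a column (for \<open>pure_u\<close>) or a row (for \<open>pure_s\<close>)
  are pairwise distinct.\<close>

definition pure_u :: "bipoly \<Rightarrow> bool" where "pure_u p \<longleftrightarrow> (\<exists>m::int. m \<noteq> 0 \<and> shift2 0 (of_int m) p = p)"
definition pure_s :: "bipoly \<Rightarrow> bool" where "pure_s p \<longleftrightarrow> (\<exists>m::int. m \<noteq> 0 \<and> shift2 (of_int m) 0 p = p)"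

lemma shift2_cancel: "shift2 a b p = shift2 c d p \<longleftrightarrow> shift2 (a - c) (b - d) p = p"
proof -
  have "shift2 a b p = shift2 c d (shift2 (a - c) (b - d) p)" by simp
  then show ?thesis by (metis shift2_inject)
qed

lemma pure_shift [simp]:
  "pure_u (shift2 a b p) = pure_u p" "pure_s (shift2 a b p) = pure_s p"
  by (simp_all add: pure_u_def pure_s_def shift2_cancel)

lemma pure_s_iff: "pure_s p \<longleftrightarrow> degree p = 0"
proof
  assume "pure_s p"
  then obtain m :: int where "m \<noteq> 0" "shift2 (of_int m) 0 p = p" by (auto simp: pure_s_def)
  then obtain P where "p = [:P:]" by (metis of_int_eq_0_iff shift_u_invariant)
  then show "degree p = 0" by simp
next
  assume "degree p = 0"
  then obtain P where "p = [:P:]" by (metis degree_eq_zeroE)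
  then have "shift2 1 0 p = p" by (intro bipoly_eqI) simp
  then show "pure_s p" unfolding pure_s_def by (intro exI[of _ 1]) simp
qed

lemma pure_u_shift_s: "pure_u p \<Longrightarrow> shift2 0 b p = p"
proof -
  assume "pure_u p"
  then obtain m :: int where "m \<noteq> 0" "shift2 0 (of_int m) p = p" by (auto simp: pure_u_def)
  then obtain P where "p = lift2 P Us" by (metis of_int_eq_0_iff shift_s_invariant)
  then show ?thesis by (intro bipoly_eqI) simp
qed

lemma pure_both_not_prime: "pure_u p \<Longrightarrow> pure_s p \<Longrightarrow> \<not> prime_elem p"
proof
  assume u: "pure_u p" and s: "pure_s p" and p: "prime_elem p"
  obtain P where P: "p = [:P:]" using s by (metis pure_s_iff degree_eq_zeroE)
  have "poly P x = poly P 0" for x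
    using arg_cong[OF pure_u_shift_s[OF u, of x], of "\<lambda>F. eval2 F 0 0"] by (simp add: P)
  then have "P = [:poly P 0:]" by (intro poly_eqI_all) simp
  then obtain c where "P = [:c:]" by blast
  then have "p = 0 \<or> p dvd 1" using P by (auto simp: is_unit_const_poly_iff dvd_field_iff)
  then show False using p by (auto simp: prime_elem_def)
qed

text \<open>An order can be nonzero only where a translate of \<open>p\<close> divides the numerator
  or the denominator of \<open>h\<close>.\<close>

lemma finite_fval:
  assumes p: "prime_elem p" and "h \<noteq> 0"
    and inj: "\<And>x y. shift2 (- a x) (- b x) p = shift2 (- a y) (- b y) p \<Longrightarrow> x = y"
  shows "finite {x. fval p (fshift (a x) (b x) h) \<noteq> 0}"
proof -
  obtain F G where h: "F \<noteq> 0" "G \<noteq> 0" "h = to_fract F / to_fract G"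
    using assms(2) by (rule bifract_nonzero_cases)
  have "finite {x \<in> UNIV. shift2 (- a x) (- b x) p dvd F}" "finite {x \<in> UNIV. shift2 (- a x) (- b x) p dvd G}"
    by (rule finite_shift_dvd[OF p]; use h inj in blast)+
  then have "finite ({x. shift2 (- a x) (- b x) p dvd F} \<union> {x. shift2 (- a x) (- b x) p dvd G})" by simp
  moreover have "{x. fval p (fshift (a x) (b x) h) \<noteq> 0} \<subseteq>
      {x. shift2 (- a x) (- b x) p dvd F} \<union> {x. shift2 (- a x) (- b x) p dvd G}"
  proof (rule subsetI, rule ccontr)
    fix x assume x: "x \<in> {x. fval p (fshift (a x) (b x) h) \<noteq> 0}"
      "x \<notin> {x. shift2 (- a x) (- b x) p dvd F} \<union> {x. shift2 (- a x) (- b x) p dvd G}"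
    then have "multiplicity p (shift2 (a x) (b x) F) = 0" "multiplicity p (shift2 (a x) (b x) G) = 0"
      by (auto simp: shift2_dvd_left intro: not_dvd_imp_multiplicity_0)
    then show False using x h(1,2) p unfolding h(3) by (simp add: fshift_div fval_div)
  qed
  ultimately show ?thesis by (rule finite_subset[rotated])
qed

lemma finite_fval_col:
  assumes "prime_elem p" "h \<noteq> 0" "\<not> pure_u p"
  shows "finite {j::int. fval p (fshift c (of_int j) h) \<noteq> 0}"
proof (rule finite_fval[OF assms(1,2)])
  fix x y :: int
  assume "shift2 (- c) (- of_int x) p = shift2 (- c) (- of_int y) p"
  then have "shift2 0 (of_int (y - x)) p = p" by (simp add: shift2_cancel)
  then show "x = y" using assms(3) unfolding pure_u_def by (metis eq_iff_diff_eq_0)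
qed

lemma finite_fval_row:
  assumes "prime_elem p" "h \<noteq> 0" "\<not> pure_s p"
  shows "finite {i::int. fval p (fshift (of_int i) c h) \<noteq> 0}"
proof (rule finite_fval[OF assms(1,2)])
  fix x y :: int
  assume "shift2 (- of_int x) (- c) p = shift2 (- of_int y) (- c) p"
  then have "shift2 (of_int (y - x)) 0 p = p" by (simp add: shift2_cancel)
  then show "x = y" using assms(3) unfolding pure_s_def by (metis eq_iff_diff_eq_0)
qed

text \<open>A polynomial in \<open>u\<close> is fixed by every translation in \<open>s\<close>, so a
  prime divisor involving \<open>s\<close> would bring along infinitely many distinct translates of
  itself.\<close>

lemma not_dvd_lift2_Us:
  assumes "prime_elem p" "\<not> pure_u p" "P \<noteq> 0"
  shows "\<not> p dvd lift2 P Us"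
proof
  assume d: "p dvd lift2 P Us"
  have "shift2 0 (- of_int j) p dvd lift2 P Us" for j :: int
  proof -
    have "shift2 0 (of_int j) (lift2 P Us) = lift2 P Us" by (rule bipoly_eqI) simp
    then show ?thesis using d by (simp add: shift2_dvd_left)
  qed
  moreover have "finite {j::int. fval p (fshift 0 (of_int j) (to_fract (lift2 P Us))) \<noteq> 0}"
    by (rule finite_fval_col) (use assms in auto)
  ultimately have "finite (UNIV :: int set)"
    using assms by (simp add: fval_to_fract prime_elem_multiplicity_eq_zero_iff shift2_dvd_left)
  then show False by simp
qed

lemma fval_pure_u_fract:
  assumes p: "prime_elem p" "\<not> pure_u p" and "P \<noteq> 0" "Q \<noteq> 0"
  shows "fval p (poly_at P var_u / poly_at Q var_u) = 0"
  using assms not_dvd_lift2_Us[OF p] 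
  by (simp add: var_u_def fval_div not_dvd_imp_multiplicity_0 flip: to_fract_lift2)

lemma vge_0_to_fract: "prime_elem p \<Longrightarrow> vge p 0 (to_fract F)"
  by (cases "F = 0") (auto simp: vge_def fval_to_fract)

text \<open>With \<open>u = n\<close> and \<open>s = k\<close>, \<open>f\<close> stands for
  \<open>c n (k + 1) / c n k\<close> and \<open>A\<close> for \<open>c (n + 1) k / c n k\<close>.
  The assumption \<open>shift_compatible\<close> says that the two ways from \<open>(n, k)\<close>
  to \<open>(n + 1, k + 1)\<close> agree, and \<open>rec\<close> is the three-term recurrence
  divided by \<open>c n k\<close>, with \<open>al\<close> and \<open>be\<close> for its
  coefficients.\<close>

locale ratio_pair =
  fixes f A al be :: bifract and R a1 a2 b1 b2 :: "complex poly"
  assumes f_nz: "f \<noteq> 0" and A_nz: "A \<noteq> 0"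
    and shift_compatible: "fshift 0 1 A * f = A * fshift 1 0 f"
    and rec: "1 / fshift 0 (-1) f - poly_at R var_s - al = A + be / fshift (-1) 0 A"
    and al: "al = poly_at a1 var_u / poly_at a2 var_u" "a2 \<noteq> 0"
    and be: "be = poly_at b1 var_u / poly_at b2 var_u" "b1 \<noteq> 0" "b2 \<noteq> 0"
begin

context
  fixes p :: bipoly
  assumes p: "prime_elem p" and npu: "\<not> pure_u p" and nps: "\<not> pure_s p"
begin

definition vf :: "int \<Rightarrow> int \<Rightarrow> int" where "vf i j = fval p (fshift (of_int i) (of_int j) f)"
definition va :: "int \<Rightarrow> int \<Rightarrow> int" where "va i j = fval p (fshift (of_int i) (of_int j) A)"

lemma va_vf_lattice: "lattice_order vf va"
proof
  fix i j :: int
  have be_nz: "be \<noteq> 0" using be by (simp add: var_u_def flip: to_fract_lift2)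
  have "fshift (of_int i) (of_int j) (fshift 0 1 A * f) = fshift (of_int i) (of_int j) (A * fshift 1 0 f)"
    by (simp only: shift_compatible)
  then have "fval p (fshift (of_int i) (of_int (j + 1)) A * fshift (of_int i) (of_int j) f)
      = fval p (fshift (of_int i) (of_int j) A * fshift (of_int (i + 1)) (of_int j) f)"
    by (simp add: add.commute)
  then have "va i (j + 1) + vf i j = va i j + vf (i + 1) j"
    unfolding va_def vf_def using p f_nz A_nz by (simp add: fval_mult)
  then show "va i (j + 1) - va i j = vf (i + 1) j - vf i j" by linarith
  show "finite {j. vf i j \<noteq> 0}" "finite {j. va i j \<noteq> 0}"
    unfolding va_def vf_def using finite_fval_col[OF p f_nz npu] finite_fval_col[OF p A_nz npu] .
  \<comment> \<open>Relative to the entry at \<open>(i, j)\<close>, \<open>X\<close> is the entry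
    below, \<open>Y\<close> the one to the right and \<open>Z\<close> the one to the left multiplied
    by the recurrence coefficient \<open>be\<close>. \<open>W\<close> is the coefficient of the
    centre and has order at least 0, but nothing more is known about it.\<close>
  define X where "X = 1 / fshift (of_int i) (of_int (j - 1)) f"
  define Y where "Y = fshift (of_int i) (of_int j) A"
  define Z where "Z = fshift (of_int i) (of_int j) be / fshift (of_int (i - 1)) (of_int j) A"
  define W where "W = poly_at R (var_s + const_rat (of_int j)) + fshift (of_int i) (of_int j) al"
  have nz: "X \<noteq> 0" "Y \<noteq> 0" "Z \<noteq> 0" using f_nz A_nz be_nz by (simp_all add: X_def Y_def Z_def)
  have "fshift (of_int i) (of_int j) (1 / fshift 0 (-1) f - poly_at R var_s - al)
      = fshift (of_int i) (of_int j) (A + be / fshift (-1) 0 A)"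
    by (simp only: rec)
  then have e: "X - W = Y + Z"
    by (simp add: X_def Y_def Z_def W_def algebra_simps)
  have vX: "fval p X = - vf i (j - 1)"
  proof -
    have "fval p 1 = 0" using fval_to_fract[OF p, of 1] by simp
    then show ?thesis unfolding X_def vf_def using p f_nz by (simp add: fval_divide)
  qed
  have pure0: "fval p (fshift a b (poly_at P var_u / poly_at Q var_u)) = 0" if "P \<noteq> 0" "Q \<noteq> 0" for P Q a b
  proof -
    have nz: "poly_at P var_u / poly_at Q var_u \<noteq> 0" using that by (simp add: var_u_def flip: to_fract_lift2)
    have "fval (shift2 a b (shift2 (-a) (-b) p)) (fshift a b (poly_at P var_u / poly_at Q var_u)) =
      fval (shift2 (-a) (-b) p) (poly_at P var_u / poly_at Q var_u)"
      by (rule fval_fshift) (use p nz in simp_all)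
    then show ?thesis using fval_pure_u_fract[of "shift2 (-a) (-b) p" P Q] p npu that by simp
  qed
  have vY: "fval p Y = va i j" by (simp add: Y_def va_def)
  have vZ: "fval p Z = - va (i - 1) j"
    unfolding Z_def va_def using p be_nz A_nz pure0[OF be(2,3), folded be(1)]
    by (simp add: fval_divide)
  have vW: "vge p 0 W"
  proof -
    have "vge p 0 (fshift (of_int i) (of_int j) al)"
    proof (cases "a1 = 0")
      case True then show ?thesis by (simp add: al vge_def)
    next
      case False
      then show ?thesis using pure0[OF False al(2)] by (simp only: vge_def al(1) order_refl simp_thms)
    qed
    moreover have "poly_at R (var_s + const_rat (of_int j)) = to_fract (lift2 R (Ss + [:[:of_int j:]:]))"
      unfolding to_fract_lift2 to_fract_add var_s_def const_rat_def ..
    ultimately show ?thesis unfolding W_def using p by (metis vge_add vge_0_to_fract)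
  qed
  have lift: "vge p m x" if "k \<le> fval p x" "m \<le> k" for m k x using that by (simp add: vge_def)
  have WI: "vge p m W" if "m \<le> 0" for m using vW that by (auto simp: vge_def)
  \<comment> \<open>In \<open>X - W = Y + Z\<close> a term of negative order, strictly below the
    orders of the other two, cannot be cancelled, since \<open>W\<close> has order at least
    0.\<close>
  show "\<not> (va i j < 0 \<and> va i j < - vf i (j - 1) \<and> va i j < - va (i - 1) j)"
  proof
    assume a: "va i j < 0 \<and> va i j < - vf i (j - 1) \<and> va i j < - va (i - 1) j"
    have "vge p (va i j + 1) (X - W - Z)"
      by (intro vge_diff p WI) (use a vX vZ in \<open>auto simp: vge_def\<close>)
    moreover have "X - W - Z = Y" using e by simp
    ultimately show False using nz vY by (simp add: vge_def)
  qed
  show "\<not> (- va (i - 1) j < 0 \<and> - va (i - 1) j < - vf i (j - 1) \<and> - va (i - 1) j < va i j)"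
  proof
    assume a: "- va (i - 1) j < 0 \<and> - va (i - 1) j < - vf i (j - 1) \<and> - va (i - 1) j < va i j"
    have "vge p (- va (i - 1) j + 1) (X - W - Y)"
      by (intro vge_diff p WI) (use a vX vY in \<open>auto simp: vge_def\<close>)
    moreover have "X - W - Y = Z" using e by simp
    ultimately show False using nz vZ by (simp add: vge_def)
  qed
  show "\<not> (- vf i (j - 1) < 0 \<and> - vf i (j - 1) < va i j \<and> - vf i (j - 1) < - va (i - 1) j)"
  proof
    assume a: "- vf i (j - 1) < 0 \<and> - vf i (j - 1) < va i j \<and> - vf i (j - 1) < - va (i - 1) j"
    have "vge p (- vf i (j - 1) + 1) (Y + Z + W)"
      by (intro vge_add p WI) (use a vZ vY in \<open>auto simp: vge_def\<close>)
    moreover have "Y + Z + W = X" using e by (simp add: algebra_simps)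
    ultimately show False using nz vX by (simp add: vge_def)
  qed
qed

text \<open>If the integer translates of \<open>p\<close> are all distinct, only finitely many
  orders in the plane are nonzero. Otherwise \<open>p\<close> has an integer period, and both its
  entries are nonzero because \<open>p\<close> is not pure. A positive total is possible only if
  these entries agree up to sign.\<close>

lemma order_along_column:
  "psum (\<lambda>k. fval p (fshift 0 (of_int k) f)) j \<ge> 0"
  "(\<Sum>k | fval p (fshift 0 (of_int k) f) \<noteq> 0. fval p (fshift 0 (of_int k) f)) > 0 \<Longrightarrow>
     \<exists>m e. m \<noteq> 0 \<and> (e = 1 \<or> e = -1) \<and> shift2 m (e * m) p = p"
proof -
  interpret lattice_order vf va by (rule va_vf_lattice)
  have vf0: "vf 0 = (\<lambda>k. fval p (fshift 0 (of_int k) f))" by (rule ext) (simp add: vf_def)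
  have Gt: "G 0 = psum (\<lambda>k. fval p (fshift 0 (of_int k) f))"
    "tot 0 = (\<Sum>k | fval p (fshift 0 (of_int k) f) \<noteq> 0. fval p (fshift 0 (of_int k) f))"
    by (simp_all add: G_def[abs_def] vf0 tot_def vf_def)
  have "psum (\<lambda>k. fval p (fshift 0 (of_int k) f)) j \<ge> 0 \<and>
    ((\<Sum>k | fval p (fshift 0 (of_int k) f) \<noteq> 0. fval p (fshift 0 (of_int k) f)) > 0 \<longrightarrow>
     (\<exists>m e. m \<noteq> 0 \<and> (e = 1 \<or> e = -1) \<and> shift2 m (e * m) p = p))"
  proof (cases "\<exists>m n :: int. (m, n) \<noteq> (0, 0) \<and> shift2 (of_int m) (of_int n) p = p")
    case False
    have inj: "x = y" if "shift2 (- of_int (fst x)) (- of_int (snd x)) p = shift2 (- of_int (fst y)) (- of_int (snd y)) p"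
      for x y :: "int \<times> int"
    proof -
      have "shift2 (of_int (fst y - fst x)) (of_int (snd y - snd x)) p = p"
        using that by (simp add: shift2_cancel)
      then have "(fst y - fst x, snd y - snd x) = (0, 0)" using False by blast
      then have "fst y - fst x = 0" "snd y - snd x = 0" by auto
      then show ?thesis by (simp add: prod_eq_iff)
    qed
    have "finite {x. fval p (fshift (of_int (fst x)) (of_int (snd x)) f) \<noteq> 0}"
      "finite {x. fval p (fshift (of_int (fst x)) (of_int (snd x)) A) \<noteq> 0}"
      by (rule finite_fval[OF p f_nz], rule inj, assumption, rule finite_fval[OF p A_nz], rule inj, assumption)
    then have "finite {(i, j). vf i j \<noteq> 0}" "finite {(i, j). va i j \<noteq> 0}"
      by (simp_all add: vf_def va_def case_prod_unfold)
    from finite_support_imp[OF this] show ?thesis by (simp flip: Gt)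
  next
    case True
    then obtain m n :: int where mn: "(m, n) \<noteq> (0, 0)" "shift2 (of_int m) (of_int n) p = p" by blast
    have "m \<noteq> 0" using mn npu unfolding pure_u_def by (metis of_int_0)
    have "n \<noteq> 0" using mn nps unfolding pure_s_def by (metis of_int_0)
    obtain m' n' :: int where mn': "m' > 0" "n' \<noteq> 0" "shift2 (of_int m') (of_int n') p = p"
    proof (cases "m > 0")
      case True then show ?thesis using that mn \<open>n \<noteq> 0\<close> by blast
    next
      case False
      have "shift2 (of_int (-m)) (of_int (-n)) p = p"
        using arg_cong[OF mn(2), of "shift2 (of_int (-m)) (of_int (-n))"] by simp
      then show ?thesis using that[of "-m" "-n"] False \<open>m \<noteq> 0\<close> \<open>n \<noteq> 0\<close> by simp
    qed
    have per: "vf (i + m') (j + n') = vf i j" for i j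
    proof -
      have "fval (shift2 (of_int m') (of_int n') p) (fshift (of_int m') (of_int n') (fshift (of_int i) (of_int j) f))
        = fval p (fshift (of_int i) (of_int j) f)"
        by (rule fval_fshift) (use p f_nz in simp_all)
      then show ?thesis using mn'(3) by (simp add: vf_def add.commute)
    qed
    note * = periodic_imp[of m' n', OF per mn'(1,2)]
    have "\<exists>m e. m \<noteq> 0 \<and> (e = 1 \<or> e = -1) \<and> shift2 m (e * m) p = p" if "tot 0 > 0"
    proof -
      have "m' = \<bar>n'\<bar>" using *(2)[of 0] that by linarith
      then have "n' = m' \<or> n' = - m'" by linarith
      then have "shift2 (of_int m') (1 * of_int m') p = p \<or> shift2 (of_int m') ((-1) * of_int m') p = p"
        using mn'(3) by auto
      moreover have "of_int m' \<noteq> (0::complex)" using mn' by simp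
      ultimately show ?thesis by blast
    qed
    then show ?thesis using *(1)[of 0 j] by (simp flip: Gt)
  qed
  then show "psum (\<lambda>k. fval p (fshift 0 (of_int k) f)) j \<ge> 0"
    "(\<Sum>k | fval p (fshift 0 (of_int k) f) \<noteq> 0. fval p (fshift 0 (of_int k) f)) > 0 \<Longrightarrow>
     \<exists>m e. m \<noteq> 0 \<and> (e = 1 \<or> e = -1) \<and> shift2 m (e * m) p = p" by blast+
qed

end

text \<open>A prime in \<open>u\<close> alone is unaffected by the translation of \<open>A\<close>
  in \<open>s\<close>. So \<open>shift_compatible\<close> makes the orders of \<open>f\<close> agree
  at all integer translates of \<open>p\<close> in \<open>u\<close>, of which only finitely many can
  be nonzero.\<close>

lemma fval_pure_u:
  assumes p: "prime_elem p" and pu: "pure_u p"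
  shows "fval p f = 0"
proof -
  have nps: "\<not> pure_s p" using pure_both_not_prime pu p by blast
  have step: "fval q (fshift 1 0 f) = fval q f" if "prime_elem q" "pure_u q" for q
  proof -
    have "fval (shift2 0 1 q) (fshift 0 1 A) = fval q A"
      by (rule fval_fshift) (use that A_nz in auto)
    then have "fval q (fshift 0 1 A) = fval q A" using pure_u_shift_s[OF that(2)] by simp
    moreover have "fval q (fshift 0 1 A * f) = fval q (A * fshift 1 0 f)" by (simp only: shift_compatible)
    ultimately show ?thesis using that A_nz f_nz by (simp add: fval_mult)
  qed
  have shift: "fval p (fshift (of_int i) 0 f) = fval (shift2 (- of_int i) 0 p) f" for i :: int
    using fval_fshift[of "shift2 (- of_int i) 0 p" f "of_int i" 0] p f_nz by simp
  have const: "fval p (fshift (of_int i) 0 f) = fval p f" for i :: int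
  proof (rule int_induct_step[of "\<lambda>i. fval p (fshift (of_int i) 0 f) = fval p f" 0])
    fix i :: int
    have "fval (shift2 (- of_int i) 0 p) (fshift 1 0 f) = fval (shift2 (- of_int i) 0 p) f"
      by (rule step) (use p pu in auto)
    moreover have "fval (shift2 (of_int i) 0 (shift2 (- of_int i) 0 p)) (fshift (of_int i) 0 (fshift 1 0 f))
        = fval (shift2 (- of_int i) 0 p) (fshift 1 0 f)"
      by (rule fval_fshift) (use p f_nz in auto)
    ultimately have "fval p (fshift (of_int (i + 1)) 0 f) = fval p (fshift (of_int i) 0 f)"
      by (simp add: shift)
    then show "fval p (fshift (of_int i) 0 f) = fval p f \<longleftrightarrow> fval p (fshift (of_int (i + 1)) 0 f) = fval p f"
      by simp
  qed simp
  have "finite {i::int. fval p (fshift (of_int i) 0 f) \<noteq> 0}"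
    by (rule finite_fval_row[OF p f_nz nps])
  then show ?thesis using const by (cases "fval p f = 0") auto
qed

end

section \<open>Factors along the diagonals\<close>

lemma prime_divisor_degree_pos:
  assumes "degree (F :: bipoly) > 0"
  obtains p where "prime_elem p" "p dvd F" "degree p > 0"
  using assms
proof (induction F arbitrary: thesis rule: prime_divisors_induct)
  case zero then show ?case by simp
next
  case (unit x)
  then show ?case by (auto simp: is_unit_poly_iff)
next
  case (factor p x)
  then have nz: "x \<noteq> 0" "p \<noteq> 0" by auto
  show ?case
  proof (cases "degree p > 0")
    case True
    then show ?thesis using factor by (intro factor.prems(1)[of p]) (auto intro: prime_imp_prime_elem)
  next
    case False
    then have "degree x > 0" using factor.prems(2) nz by (simp add: degree_mult_eq)
    then obtain q where "prime_elem q" "q dvd x" "degree q > 0" using factor.IH by blast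
    then show ?thesis by (intro factor.prems(1)[of q]) auto
  qed
qed

abbreviation diag_minus :: "complex \<Rightarrow> bipoly" where "diag_minus r \<equiv> [:[:- r, 1:], -1:]"
abbreviation diag_plus :: "complex \<Rightarrow> bipoly" where "diag_plus r \<equiv> [:[:- r, 1:], 1:]"

lemma prime_elem_diag: "prime_elem (diag_minus r)" "prime_elem (diag_plus r)"
proof -
  have "coprime [:-r, 1:] (-1)" "coprime [:-r, 1:] 1" by simp_all
  then show "prime_elem (diag_minus r)" "prime_elem (diag_plus r)"
    by (intro prime_elem_linear_poly; simp)+
qed

text \<open>An invariant polynomial is a univariate polynomial in \<open>s - u\<close> or in
  \<open>s + u\<close>, and a nonconstant one has a root over the complex numbers.\<close>

lemma diag_invariant_dvd:
  assumes "prime_elem p" "m \<noteq> 0" "e = 1 \<or> e = -1" "shift2 m (e * m) p = p"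
  obtains r where "diag_minus r dvd p \<or> diag_plus r dvd p"
proof -
  obtain P where P: "p = lift2 P (Ss - [:[:e:]:] * Us)" using assms by (auto elim: shift_diag_invariant)
  have "degree P \<noteq> 0"
  proof
    assume "degree P = 0"
    then obtain c where "P = [:c:]" by (metis degree_eq_zeroE)
    then have "p = [:[:c:]:]" using P by simp
    then show False using assms(1) by (auto simp: prime_elem_def is_unit_const_poly_iff dvd_field_iff)
  qed
  then obtain r where "poly P r = 0"
    by (metis fundamental_theorem_of_algebra constant_degree)
  then obtain Q where "P = [:- r, 1:] * Q" by (auto simp: poly_eq_0_iff_dvd)
  then have pe: "p = lift2 [:- r, 1:] (Ss - [:[:e:]:] * Us) * lift2 Q (Ss - [:[:e:]:] * Us)"
    unfolding P by (simp only: lift2_mult)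
  have "lift2 [:- r, 1:] (Ss - [:[:e:]:] * Us) dvd p" unfolding pe by (rule dvd_triv_left)
  moreover have "lift2 [:- r, 1:] (Ss - [:[:e:]:] * Us) = (if e = 1 then diag_minus r else diag_plus r)"
    using assms(3) by (intro bipoly_eqI) auto
  ultimately have "(if e = 1 then diag_minus r else diag_plus r) dvd p"
    by simp
  then have "diag_minus r dvd p \<or> diag_plus r dvd p" by (cases "e = 1") (simp_all only: if_True if_False simp_thms)
  then show thesis by (rule that)
qed

text \<open>Induction on the degree in \<open>u\<close>: a prime factor involving \<open>u\<close>
  supplies a linear factor \<open>s - u - r\<close> or \<open>s + u - r\<close>, which is split off.
  What finally has degree 0 in \<open>u\<close> is \<open>C\<close>.\<close>

lemma diag_decomposition:
  assumes "X \<noteq> 0" "\<And>p. prime_elem p \<Longrightarrow> p dvd X \<Longrightarrow> degree p > 0 \<Longrightarrow> \<exists>r. diag_minus r dvd p \<or> diag_plus r dvd p"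
  obtains P Q C where "lead_coeff P = 1" "lead_coeff Q = 1" "C \<noteq> 0"
    "X = [:C:] * lift2 P (Ss - Us) * lift2 Q (Ss + Us)"
  using assms
proof (induction "degree X" arbitrary: X thesis)
  case 0
  then obtain C where "X = [:C:]" by (metis degree_eq_zeroE)
  then show ?case using 0 by (intro "0.prems"(1)[of 1 1 C]) auto
next
  case (Suc d)
  then obtain p where "prime_elem p" "p dvd X" "degree p > 0"
    by (metis prime_divisor_degree_pos zero_less_Suc)
  then obtain r where r: "diag_minus r dvd X \<or> diag_plus r dvd X"
    using Suc.prems(3) by (meson dvd_trans)
  then show ?case
  proof
    assume "diag_minus r dvd X"
    then obtain Y where Y: "X = diag_minus r * Y" by (auto simp: dvd_def)
    then have nz: "Y \<noteq> 0" using Suc.prems by auto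
    have "degree X = 1 + degree Y" unfolding Y using nz by (subst degree_mult_eq) auto
    then have "d = degree Y" using Suc by simp
    moreover have "\<exists>r. diag_minus r dvd p \<or> diag_plus r dvd p" if "prime_elem p" "p dvd Y" "degree p > 0" for p
      by (rule Suc.prems(3)) (use that Y in \<open>simp_all only: dvd_mult\<close>)
    ultimately obtain P Q C where *: "lead_coeff P = 1" "lead_coeff Q = 1" "C \<noteq> 0"
      "Y = [:C:] * lift2 P (Ss - Us) * lift2 Q (Ss + Us)"
      using Suc.hyps(1)[of Y] nz by metis
    show ?case
    proof (rule Suc.prems(1)[of "[:- r, 1:] * P" Q C])
      show "lead_coeff ([:- r, 1:] * P) = 1" using * by (subst lead_coeff_mult) simp
      have "lift2 [:- r, 1:] (Ss - Us) = diag_minus r" by (intro bipoly_eqI) simp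
      then show "X = [:C:] * lift2 ([:- r, 1:] * P) (Ss - Us) * lift2 Q (Ss + Us)"
        unfolding Y * lift2_mult by (simp only: mult_ac)
    qed (use * in auto)
  next
    assume "diag_plus r dvd X"
    then obtain Y where Y: "X = diag_plus r * Y" by (auto simp: dvd_def)
    then have nz: "Y \<noteq> 0" using Suc.prems by auto
    have "degree X = 1 + degree Y" unfolding Y using nz by (subst degree_mult_eq) auto
    then have "d = degree Y" using Suc by simp
    moreover have "\<exists>r. diag_minus r dvd p \<or> diag_plus r dvd p" if "prime_elem p" "p dvd Y" "degree p > 0" for p
      by (rule Suc.prems(3)) (use that Y in \<open>simp_all only: dvd_mult\<close>)
    ultimately obtain P Q C where *: "lead_coeff P = 1" "lead_coeff Q = 1" "C \<noteq> 0"
      "Y = [:C:] * lift2 P (Ss - Us) * lift2 Q (Ss + Us)"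
      using Suc.hyps(1)[of Y] nz by metis
    show ?case
    proof (rule Suc.prems(1)[of P "[:- r, 1:] * Q" C])
      show "lead_coeff ([:- r, 1:] * Q) = 1" using * by (subst lead_coeff_mult) simp
      have "lift2 [:- r, 1:] (Ss + Us) = diag_plus r" by (intro bipoly_eqI) simp
      then show "X = [:C:] * lift2 P (Ss - Us) * lift2 ([:- r, 1:] * Q) (Ss + Us)"
        unfolding Y * lift2_mult by (simp only: mult_ac)
    qed (use * in auto)
  qed
qed

section \<open>Minimal representations of a ratio\<close>

lemma psum_unique:
  assumes "finite {k. h k \<noteq> 0}" "\<And>j. H (j + 1) = H j + h j" "\<And>j. j \<le> L \<Longrightarrow> H j = 0"
  shows "psum h j = H j"
proof -
  obtain L' where L': "\<And>j. j \<le> L' \<Longrightarrow> psum h j = 0" using psum_low[OF assms(1)] by metis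
  show ?thesis
  proof (rule int_induct_step[of "\<lambda>j. psum h j = H j" "min L L'"])
    show "psum h j = H j \<longleftrightarrow> psum h (j + 1) = H (j + 1)" for j
      using psum_Suc[OF assms(1), of j] assms(2)[of j] by linarith
  qed (use L' assms(3) in simp)
qed

text \<open>The equation \<open>f = g(u, s + 1) / g(u, s) * X / Y\<close>, written without division
  by \<open>g\<close> and \<open>Y\<close>.\<close>

definition shift_rep :: "bifract \<Rightarrow> bipoly \<Rightarrow> bipoly \<Rightarrow> bipoly \<Rightarrow> bool" where
  "shift_rep f g X Y \<longleftrightarrow> g \<noteq> 0 \<and> X \<noteq> 0 \<and> Y \<noteq> 0 \<and>
     f * to_fract (g * Y) = to_fract (shift2 0 1 g * X)"

text \<open>Taking a factor \<open>c\<close> out of \<open>g\<close> multiplies \<open>X / Y\<close>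
  by \<open>c(u, s + 1) / c(u, s)\<close>; \<open>shift_rep_extend\<close> is the opposite
  move.\<close>

lemma shift_rep_cancel:
  assumes "shift_rep f (c * g) X Y" "X * shift2 0 1 c * Y' = X' * Y * c" "X' \<noteq> 0" "Y' \<noteq> 0"
  shows "shift_rep f g X' Y'"
proof -
  have nz: "c \<noteq> 0" "g \<noteq> 0" "X \<noteq> 0" "Y \<noteq> 0" using assms(1) by (auto simp: shift_rep_def)
  have "f * to_fract (c * g * Y) = to_fract (shift2 0 1 (c * g) * X)"
    using assms(1) by (simp add: shift_rep_def)
  then have "f * to_fract (c * g * Y) * to_fract Y' = to_fract (shift2 0 1 g * (X * shift2 0 1 c * Y'))"
    by (simp add: mult_ac)
  also have "\<dots> = to_fract (shift2 0 1 g * X') * to_fract (Y * c)"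
    unfolding assms(2) by (simp add: mult_ac)
  finally have "(f * to_fract (g * Y')) * to_fract (Y * c) = to_fract (shift2 0 1 g * X') * to_fract (Y * c)"
    by (simp add: mult_ac)
  then have "f * to_fract (g * Y') = to_fract (shift2 0 1 g * X')"
    using nz by (metis mult_right_cancel mult_eq_0_iff to_fract_eq_0_iff)
  then show ?thesis using nz assms by (simp add: shift_rep_def)
qed

lemma shift_rep_extend:
  assumes "shift_rep f g X Y" "shift2 0 1 c * X' * Y = c * X * Y'" "c \<noteq> 0" "X' \<noteq> 0" "Y' \<noteq> 0"
  shows "shift_rep f (c * g) X' Y'"
proof -
  have nz: "g \<noteq> 0" "X \<noteq> 0" "Y \<noteq> 0" using assms(1) by (auto simp: shift_rep_def)
  have "f * to_fract (g * Y) = to_fract (shift2 0 1 g * X)"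
    using assms(1) by (simp add: shift_rep_def)
  then have "f * to_fract (g * Y) * to_fract (c * Y') = to_fract (shift2 0 1 g * (c * X * Y'))"
    by (simp add: mult_ac)
  also have "\<dots> = to_fract (shift2 0 1 (c * g) * X') * to_fract Y"
    unfolding assms(2)[symmetric] by (simp add: mult_ac)
  finally have "(f * to_fract (c * g * Y')) * to_fract Y = to_fract (shift2 0 1 (c * g) * X') * to_fract Y"
    by (simp add: mult_ac)
  then have "f * to_fract (c * g * Y') = to_fract (shift2 0 1 (c * g) * X')"
    using nz by (metis mult_right_cancel to_fract_eq_0_iff)
  then show ?thesis using nz assms by (simp add: shift_rep_def)
qed

text \<open>Minimality is lexicographic. The degree counts \<open>u\<close> only, so factors in
  \<open>s\<close> alone are free in \<open>X\<close> and \<open>Y\<close>, and the second criterion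
  can drive them out of \<open>g\<close>.\<close>

lemma minimal_shift_rep:
  assumes "f \<noteq> 0"
  obtains g X Y where "shift_rep f g X Y"
    "\<And>g' X' Y'. shift_rep f g' X' Y' \<Longrightarrow> degree X + degree Y \<le> degree X' + degree Y'"
    "\<And>g' X' Y'. shift_rep f g' X' Y' \<Longrightarrow> degree X' + degree Y' = degree X + degree Y \<Longrightarrow>
       size (prime_factorization g) \<le> size (prime_factorization g')"
proof -
  obtain N D where "N \<noteq> 0" "D \<noteq> 0" "f = to_fract N / to_fract D" using assms by (rule bifract_nonzero_cases)
  then have ex: "shift_rep f 1 N D" by (simp add: shift_rep_def)
  define d where "d = (\<lambda>(g :: bipoly, X :: bipoly, Y :: bipoly). degree X + degree Y)"
  define w where "w = (\<lambda>(g :: bipoly, X :: bipoly, Y :: bipoly). size (prime_factorization g))"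
  define S where "S = (\<lambda>(g, X, Y). shift_rep f g X Y)"
  have "S (1, N, D)" using ex by (simp add: S_def)
  then obtain x where x: "S x" "\<And>y. S y \<Longrightarrow> d x \<le> d y"
    using ex_has_least_nat[of S _ d] by metis
  then obtain z where z: "S z \<and> d z = d x" "\<And>y. S y \<and> d y = d x \<Longrightarrow> w z \<le> w y"
    using ex_has_least_nat[of "\<lambda>y. S y \<and> d y = d x" x w] by metis
  obtain g X Y where "z = (g, X, Y)" by (cases z)
  then show thesis
    using z x(2) by (intro that[of g X Y]) (auto simp: S_def d_def w_def)
qed

lemma size_prime_factorization_mult:
  assumes "prime_elem (p :: bipoly)" "g \<noteq> 0"
  shows "size (prime_factorization (p * g)) = Suc (size (prime_factorization g))"
proof -
  have p: "p \<noteq> 0" using assms by auto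
  have "prime (normalize p)" using assms by simp
  then have "prime_factorization (normalize p) = {#normalize p#}"
    by (rule prime_factorization_prime)
  then have "prime_factorization p = {#normalize p#}"
    by (metis prime_factorization_normalize)
  then show ?thesis using p assms by (simp add: prime_factorization_mult)
qed

locale minimal_rep =
  fixes f :: bifract and g X Y :: bipoly
  assumes rep: "shift_rep f g X Y"
    and min_deg: "shift_rep f g' X' Y' \<Longrightarrow> degree X + degree Y \<le> degree X' + degree Y'"
    and min_g: "shift_rep f g' X' Y' \<Longrightarrow> degree X' + degree Y' = degree X + degree Y \<Longrightarrow>
       size (prime_factorization g) \<le> size (prime_factorization g')"
begin

lemma nz: "g \<noteq> 0" "X \<noteq> 0" "Y \<noteq> 0" using rep by (auto simp: shift_rep_def)

text \<open>The product \<open>c\<close> of \<open>q(u, s - h)\<close>, ...,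
  \<open>q(u, s - 1)\<close> telescopes:
  \<open>c(u, s + 1) / c(u, s) = q(u, s) / q(u, s - h)\<close>. Hence the two factors of
  \<open>X\<close> and \<open>Y\<close> could be absorbed into \<open>g\<close>, which lowers the
  degree.\<close>

lemma not_dvd_X_Y:
  assumes "prime_elem q" "degree q > 0" "q dvd X" "shift2 0 (- of_nat h) q dvd Y"
  shows False
proof -
  obtain X1 where X1: "X = q * X1" using assms by (auto simp: dvd_def)
  obtain Y1 where Y1: "Y = shift2 0 (- of_nat h) q * Y1" using assms by (auto simp: dvd_def)
  define c where "c = (\<Prod>l<h. shift2 0 (of_nat l - of_nat h) q)"
  have q: "q \<noteq> 0" using assms by auto
  have c: "c \<noteq> 0" using q by (simp add: c_def)
  have sh_prod: "shift2 0 1 (\<Prod>l<n. k l) = (\<Prod>l<n. shift2 0 1 (k l))" for n and k :: "nat \<Rightarrow> bipoly"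
    by (induction n) simp_all
  have "shift2 0 1 c = (\<Prod>l<h. shift2 0 (of_nat (Suc l) - of_nat h) q)"
    unfolding c_def sh_prod by (intro prod.cong refl) (simp add: algebra_simps)
  then have "shift2 0 (- of_nat h) q * shift2 0 1 c = (\<Prod>l<Suc h. shift2 0 (of_nat l - of_nat h) q)"
    by (simp add: prod.lessThan_Suc_shift del: prod.lessThan_Suc)
  also have "\<dots> = c * q" by (simp add: c_def)
  finally have e: "shift2 0 (- of_nat h) q * shift2 0 1 c = c * q" .
  have "shift_rep f (c * g) X1 Y1"
  proof (rule shift_rep_extend[OF rep])
    show "shift2 0 1 c * X1 * Y = c * X * Y1"
      unfolding X1 Y1 using e by (metis (no_types, lifting) mult.assoc mult.commute)
  qed (use nz c X1 Y1 in auto)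
  from min_deg[OF this] have "degree X + degree Y \<le> degree X1 + degree Y1" .
  moreover have "degree X = degree q + degree X1" "degree Y = degree q + degree Y1"
    using nz q unfolding X1 Y1 by (auto simp: degree_mult_eq)
  ultimately show False using assms by simp
qed

text \<open>Moving \<open>q\<close> out of \<open>g\<close> would merely replace the factor
  \<open>q\<close> of \<open>X\<close> by its translate \<open>q(u, s + 1)\<close>: the degree stays
  and \<open>g\<close> loses a prime. In \<open>not_dvd_Y_g\<close> the same happens in the
  denominator, with \<open>q(u, s + 1)\<close> replaced by \<open>q\<close>.\<close>

lemma not_dvd_X_g:
  assumes "prime_elem q" "q dvd X" "q dvd g"
  shows False
proof -
  obtain X1 where X1: "X = q * X1" using assms by (auto simp: dvd_def)
  obtain g1 where g1: "g = q * g1" using assms by (auto simp: dvd_def)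
  have q: "q \<noteq> 0" using assms by auto
  have "shift_rep f g1 (shift2 0 1 q * X1) Y"
    by (rule shift_rep_cancel[of f q g1 X Y]) (use rep g1 X1 nz q in \<open>auto simp: mult_ac\<close>)
  moreover have "degree (shift2 0 1 q * X1) + degree Y = degree X + degree Y"
    using nz q unfolding X1 by (auto simp: degree_mult_eq)
  ultimately have "size (prime_factorization g) \<le> size (prime_factorization g1)" by (rule min_g)
  then show False using size_prime_factorization_mult[of q g1] assms g1 nz by auto
qed

lemma not_dvd_Y_g:
  assumes "prime_elem q" "shift2 0 1 q dvd Y" "q dvd g"
  shows False
proof -
  obtain Y1 where Y1: "Y = shift2 0 1 q * Y1" using assms by (auto simp: dvd_def)
  obtain g1 where g1: "g = q * g1" using assms by (auto simp: dvd_def)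
  have q: "q \<noteq> 0" using assms by auto
  have "shift_rep f g1 X (q * Y1)"
    by (rule shift_rep_cancel[of f q g1 X Y]) (use rep g1 Y1 nz q in \<open>auto simp: mult_ac\<close>)
  moreover have "degree X + degree (q * Y1) = degree X + degree Y"
    using nz q unfolding Y1 by (auto simp: degree_mult_eq)
  ultimately have "size (prime_factorization g) \<le> size (prime_factorization g1)" by (rule min_g)
  then show False using size_prime_factorization_mult[of q g1] assms g1 nz by auto
qed

text \<open>A prime in \<open>s\<close> alone can be moved from \<open>g\<close> into
  \<open>X\<close> and \<open>Y\<close> at no cost in the degree in \<open>u\<close>.\<close>

lemma not_pure_s_dvd_g:
  assumes "prime_elem q" "degree q = 0" "q dvd g"
  shows False
proof -
  obtain g1 where g1: "g = q * g1" using assms by (auto simp: dvd_def)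
  have q: "q \<noteq> 0" using assms by auto
  have "shift_rep f g1 (shift2 0 1 q * X) (q * Y)"
    by (rule shift_rep_cancel[of f q g1 X Y]) (use rep g1 nz q in \<open>auto simp: mult_ac\<close>)
  moreover have "degree (shift2 0 1 q * X) + degree (q * Y) = degree X + degree Y"
    using nz q assms by (auto simp: degree_mult_eq)
  ultimately have "size (prime_factorization g) \<le> size (prime_factorization g1)" by (rule min_g)
  then show False using size_prime_factorization_mult[of q g1] assms g1 nz by auto
qed

lemma f_nz: "f \<noteq> 0"
  using rep by (auto simp: shift_rep_def)

lemma fval_f:
  assumes "prime_elem p"
  shows "fval p (fshift 0 b f) = int (multiplicity p (shift2 0 (b + 1) g)) - int (multiplicity p (shift2 0 b g))
    + int (multiplicity p (shift2 0 b X)) - int (multiplicity p (shift2 0 b Y))"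
proof -
  have "f = to_fract (shift2 0 1 g * X) / to_fract (g * Y)"
    using rep by (simp add: shift_rep_def field_simps)
  then have "fshift 0 b f = to_fract (shift2 0 (b + 1) g * shift2 0 b X) / to_fract (shift2 0 b g * shift2 0 b Y)"
    by (simp add: fshift_div nz)
  then have "fval p (fshift 0 b f) = int (multiplicity p (shift2 0 (b + 1) g * shift2 0 b X))
     - int (multiplicity p (shift2 0 b g * shift2 0 b Y))"
    using assms nz by (simp only: fval_div mult_eq_0_iff shift2_eq_0_iff simp_thms)
  then show ?thesis using assms nz by (simp add: prime_elem_multiplicity_mult_distrib)
qed

lemma finite_mult_col:
  assumes "prime_elem p" "\<not> pure_u p" "F \<noteq> 0"
  shows "finite {j::int. int (multiplicity p (shift2 0 (of_int j) F)) \<noteq> 0}"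
  using finite_fval_col[OF assms(1) _ assms(2), of "to_fract F" 0] assms
  by (simp add: fval_to_fract)

text \<open>The orders of \<open>g(u, s + 1) / g(u, s)\<close> telescope, and only the order of
  \<open>g\<close> at the upper end remains.\<close>

lemma psum_f:
  assumes p: "prime_elem p" "\<not> pure_u p"
  shows "psum (\<lambda>k. fval p (fshift 0 (of_int k) f)) j = int (multiplicity p (shift2 0 (of_int j) g))
    + psum (\<lambda>k. int (multiplicity p (shift2 0 (of_int k) X))) j
    - psum (\<lambda>k. int (multiplicity p (shift2 0 (of_int k) Y))) j"
proof -
  note fin = finite_mult_col[OF p nz(1)] finite_mult_col[OF p nz(2)] finite_mult_col[OF p nz(3)]
  obtain L1 where L1: "\<And>j. j \<le> L1 \<Longrightarrow> int (multiplicity p (shift2 0 (of_int j) g)) = 0"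
    using psum_low[OF fin(1)] by metis
  obtain L2 where L2: "\<And>j. j \<le> L2 \<Longrightarrow> psum (\<lambda>k. int (multiplicity p (shift2 0 (of_int k) X))) j = 0"
    using psum_low[OF fin(2)] by metis
  obtain L3 where L3: "\<And>j. j \<le> L3 \<Longrightarrow> psum (\<lambda>k. int (multiplicity p (shift2 0 (of_int k) Y))) j = 0"
    using psum_low[OF fin(3)] by metis
  show ?thesis
  proof (rule psum_unique[where L = "min L1 (min L2 L3)"])
    show "finite {k::int. fval p (fshift 0 (of_int k) f) \<noteq> 0}" by (rule finite_fval_col[OF p(1) f_nz p(2)])
  qed (use L1 L2 L3 in \<open>simp_all add: psum_Suc[OF fin(2)] psum_Suc[OF fin(3)] fval_f[OF p(1)]\<close>)
qed

end

locale ratio_pair_rep = ratio_pair f A al be R a1 a2 b1 b2 + minimal_rep f g X Y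
  for f A al be :: bifract and R a1 a2 b1 b2 :: "complex poly" and g X Y :: bipoly
begin

text \<open>The quotient \<open>g(u, s + 1) / g(u, s)\<close> has order 0 at such a prime, and so
  has \<open>f\<close>. Hence its orders in \<open>X\<close> and \<open>Y\<close> agree, and by
  minimality they are not both positive.\<close>

lemma pure_u_not_dvd:
  assumes p: "prime_elem p" "pure_u p"
  shows "\<not> p dvd X" "\<not> p dvd Y"
proof -
  have dp: "degree p > 0" using pure_both_not_prime[OF p(2)] p(1) pure_s_iff by blast
  have "multiplicity p (shift2 0 1 g) = multiplicity p g"
    using multiplicity_shift2[of 0 1 p g] pure_u_shift_s[OF p(2)] by simp
  then have "multiplicity p X = multiplicity p Y"
    using fval_f[OF p(1), of 0] fval_pure_u[OF p] by simp
  moreover have "\<not> (p dvd X \<and> p dvd Y)"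
    using not_dvd_X_Y[OF p(1) dp, of 0] by auto
  moreover have "p dvd F \<longleftrightarrow> multiplicity p F \<noteq> 0" if "F \<noteq> 0" for F
    using that p(1) by (simp add: prime_elem_multiplicity_eq_zero_iff)
  ultimately show "\<not> p dvd X" "\<not> p dvd Y" using nz by auto
qed

text \<open>Let a prime \<open>p\<close> involving \<open>u\<close> divide \<open>Y\<close>. In the
  partial sum up to and including the translate by 0, minimality removes the contributions of
  \<open>g\<close> and \<open>X\<close>, so the sum is negative, which
  \<open>order_along_column\<close> forbids.\<close>

lemma Y_pure: "degree Y = 0"
proof (rule ccontr)
  assume "degree Y \<noteq> 0"
  then obtain p where p: "prime_elem p" "p dvd Y" "degree p > 0"
    using prime_divisor_degree_pos[of Y] by auto
  have nps: "\<not> pure_s p" using p pure_s_iff by auto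
  have npu: "\<not> pure_u p" using p pure_u_not_dvd by auto
  let ?x = "\<lambda>k::int. int (multiplicity p (shift2 0 (of_int k) X))"
  let ?y = "\<lambda>k::int. int (multiplicity p (shift2 0 (of_int k) Y))"
  have "multiplicity p (shift2 0 1 g) = 0"
  proof (rule not_dvd_imp_multiplicity_0, rule notI)
    assume "p dvd shift2 0 1 g"
    then show False using not_dvd_Y_g[of "shift2 0 (-1) p"] p by (simp add: shift2_dvd_left)
  qed
  moreover have "psum ?x 1 = 0"
  proof (rule psum_eq_0)
    fix k :: int assume k: "k < 1"
    have "\<not> p dvd shift2 0 (of_int k) X"
    proof
      assume "p dvd shift2 0 (of_int k) X"
      then have "shift2 0 (of_nat (nat (-k))) p dvd X" using k by (simp add: shift2_dvd_left)
      then show False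
        using not_dvd_X_Y[of "shift2 0 (of_nat (nat (-k))) p" "nat (- k)"] p by simp
    qed
    then show "int (multiplicity p (shift2 0 (of_int k) X)) = 0"
      by (simp add: not_dvd_imp_multiplicity_0)
  qed
  moreover have "psum ?y 1 > 0"
  proof -
    have "psum ?y 1 = psum ?y 0 + ?y 0"
      using psum_Suc[OF finite_mult_col[OF p(1) npu nz(3)], of 0] by simp
    moreover have "psum ?y 0 \<ge> 0" unfolding psum_def by (rule sum_nonneg) simp
    moreover have "multiplicity p Y \<noteq> 0" using p nz by (simp add: prime_elem_multiplicity_eq_zero_iff)
    ultimately show ?thesis by simp
  qed
  ultimately have "psum (\<lambda>k. fval p (fshift 0 (of_int k) f)) 1 < 0"
    using psum_f[OF p(1) npu, of 1] by simp
  then show False using order_along_column(1)[OF p(1) npu nps, of 1] by simp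
qed

text \<open>As \<open>Y\<close> contains no prime involving \<open>u\<close>, such a prime of
  \<open>X\<close> has positive total order along its column. This is exactly the situation in which
  \<open>order_along_column\<close> supplies a diagonal period.\<close>

lemma X_primes:
  assumes p: "prime_elem p" "p dvd X" "degree p > 0"
  shows "\<exists>r. diag_minus r dvd p \<or> diag_plus r dvd p"
proof -
  have nps: "\<not> pure_s p" using p pure_s_iff by auto
  have npu: "\<not> pure_u p" using p pure_u_not_dvd by auto
  let ?f = "\<lambda>k::int. fval p (fshift 0 (of_int k) f)"
  let ?x = "\<lambda>k::int. int (multiplicity p (shift2 0 (of_int k) X))"
  let ?y = "\<lambda>k::int. int (multiplicity p (shift2 0 (of_int k) Y))"
  have "?y k = 0" for k
  proof -
    have "\<not> p dvd shift2 0 (of_int k) Y"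
    proof
      assume "p dvd shift2 0 (of_int k) Y"
      then have "degree p \<le> degree Y" using nz by (metis degree_shift2 dvd_imp_degree_le shift2_eq_0_iff)
      then show False using Y_pure p by simp
    qed
    then show ?thesis by (simp add: not_dvd_imp_multiplicity_0)
  qed
  then have y0: "psum ?y j = 0" for j by (intro psum_eq_0) auto
  obtain J where J: "\<And>j. j \<ge> J \<Longrightarrow> psum ?f j = sum ?f {k. ?f k \<noteq> 0}"
    using psum_high[OF finite_fval_col[OF p(1) f_nz npu]] by metis
  have x0: "multiplicity p X \<noteq> 0" using p nz by (simp add: prime_elem_multiplicity_eq_zero_iff)
  have "psum ?f (max J 1) > 0"
  proof -
    have "psum ?x (max J 1) > 0" unfolding psum_def
    proof (rule sum_pos2[of _ 0])
      show "finite {k. k < max J 1 \<and> ?x k \<noteq> 0}"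
        by (rule finite_subset[OF _ finite_mult_col[OF p(1) npu nz(2)]]) auto
    qed (use x0 in auto)
    then show ?thesis using psum_f[OF p(1) npu, of "max J 1"] y0 by simp
  qed
  then have "sum ?f {k. ?f k \<noteq> 0} > 0" using J[of "max J 1"] by simp
  from order_along_column(2)[OF p(1) npu nps this]
  obtain m e where "m \<noteq> 0" "e = 1 \<or> e = -1" "shift2 m (e * m) p = p" by blast
  then show ?thesis using diag_invariant_dvd[OF p(1)] by metis
qed

end

section \<open>From orthogonality to rational ratios\<close>

lemma monic_basis_expansion:
  fixes B :: "nat \<Rightarrow> complex poly"
  assumes B: "\<And>n. degree (B n) = n \<and> lead_coeff (B n) = 1" and "degree Q \<le> m"
  obtains t where "Q = (\<Sum>j\<le>m. smult (t j) (B j))"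
  using assms(2)
proof (induction m arbitrary: Q thesis)
  case 0
  have "B 0 = 1" using B[of 0] by (metis degree_0_id monom_eq_1 monom_0 coeff_monom lead_coeff_pCons(2) one_pCons degree_eq_zeroE)
  moreover obtain a where "Q = [:a:]" using 0(2) by (metis degree_eq_zeroE le_zero_eq)
  ultimately show ?case using 0(1)[of "\<lambda>_. a"] by simp
next
  case (Suc m)
  let ?Q = "Q - smult (coeff Q (Suc m)) (B (Suc m))"
  have "degree ?Q \<le> m"
  proof (rule degree_le, intro allI impI)
    fix i assume i: "m < i"
    show "coeff ?Q i = 0"
    proof (cases "i = Suc m")
      case True
      have "coeff (B (Suc m)) (Suc m) = 1" using B[of "Suc m"] by metis
      then show ?thesis using True by simp
    next
      case False
      then have "coeff Q i = 0" "coeff (B (Suc m)) i = 0"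
        using i Suc.prems(2) B[of "Suc m"] by (auto intro!: coeff_eq_0)
      then show ?thesis by simp
    qed
  qed
  then obtain t where t: "?Q = (\<Sum>j\<le>m. smult (t j) (B j))" using Suc.IH by blast
  let ?t = "t(Suc m := coeff Q (Suc m))"
  have "(\<Sum>j\<le>Suc m. smult (?t j) (B j)) = (\<Sum>j\<le>m. smult (t j) (B j)) + smult (coeff Q (Suc m)) (B (Suc m))"
    by simp
  then show ?case using t Suc.prems(1)[of ?t] by (simp add: algebra_simps)
qed

text \<open>Expand \<open>z * P n - P (n + 1)\<close> in the family. Orthogonality kills the
  coefficients below \<open>n - 1\<close>, and the one at \<open>n - 1\<close> is
  \<open>M (P n ^ 2) / M (P (n - 1) ^ 2)\<close>, hence nonzero.\<close>

lemma three_term_recurrence: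
  assumes fam: "poly_family P" and "quasi_orthogonal P"
  obtains \<alpha> \<beta> where
    "\<And>n. n \<ge> 1 \<Longrightarrow> \<beta> n \<noteq> 0 \<and> [:0, 1:] * P n = P (Suc n) + smult (\<alpha> n) (P n) + smult (\<beta> n) (P (n - 1))"
proof -
  obtain M where lin: "Vector_Spaces.linear smult (*) M"
    and orth: "\<And>i j. i \<noteq> j \<Longrightarrow> M (P i * P j) = 0" and nd: "\<And>i. M (P i ^ 2) \<noteq> 0"
    using assms(2) unfolding quasi_orthogonal_def by blast
  interpret Vector_Spaces.linear smult "(*)" M by (rule lin)
  have B: "\<And>n. degree (P n) = n \<and> lead_coeff (P n) = 1" using fam unfolding poly_family_def by blast
  have Bc: "coeff (P n) n = 1" for n using B[of n] by metis
  have low: "M (P n * Q) = 0" if lt: "degree Q < n" for n Q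
  proof -
    obtain m where m: "n = Suc m" "degree Q \<le> m" using lt by (cases n) auto
    obtain t where "Q = (\<Sum>j\<le>m. smult (t j) (P j))"
      using monic_basis_expansion[OF B m(2)] by blast
    then have "M (P n * Q) = (\<Sum>j\<le>m. t j * M (P n * P j))"
      by (simp add: sum_distrib_left sum scale)
    also have "\<dots> = 0" using orth m by (intro sum.neutral) auto
    finally show ?thesis .
  qed
  have monic_sub: "degree ([:0, 1:] * P n - P (Suc n)) \<le> n" for n
  proof (rule degree_le, intro allI impI)
    fix i assume "n < i"
    then consider "i = Suc n" | "i > Suc n" by linarith
    then show "coeff ([:0, 1:] * P n - P (Suc n)) i = 0"
    proof cases
      case 1
      then show ?thesis using Bc[of n] Bc[of "Suc n"] by simp
    next
      case 2
      then obtain i' where "i = Suc i'" "i' > n" by (metis Suc_lessE)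
      then show ?thesis using 2 B[of n] B[of "Suc n"] by (simp add: coeff_eq_0)
    qed
  qed
  have step: "\<exists>a b. b \<noteq> 0 \<and> [:0, 1:] * P n = P (Suc n) + smult a (P n) + smult b (P (n - 1))" if n: "n \<ge> 1" for n
  proof -
    let ?Q = "[:0, 1:] * P n - P (Suc n)"
    obtain t where t: "?Q = (\<Sum>j\<le>n. smult (t j) (P j))"
      using monic_basis_expansion[OF B monic_sub] by blast
    have tM: "t j * M (P j * P j) = M (P n * ([:0, 1:] * P j)) - M (P (Suc n) * P j)" if "j \<le> n" for j
    proof -
      have "M (?Q * P j) = (\<Sum>i\<le>n. t i * M (P i * P j))"
        unfolding t by (simp add: sum_distrib_right sum scale)
      also have "\<dots> = t j * M (P j * P j)"
        using that orth by (subst sum.remove[of _ j]) (auto intro!: sum.neutral)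
      also have "M (?Q * P j) = M (P n * ([:0, 1:] * P j) - P (Suc n) * P j)"
        by (simp only: algebra_simps)
      finally show ?thesis by (simp only: diff)
    qed
    have z: "t j = 0" if "Suc j < n" for j
    proof -
      have "degree ([:0, 1:] * P j) < n"
        using that B[of j] degree_mult_le[of "[:0, 1:]" "P j"] by simp
      then have "M (P n * ([:0, 1:] * P j)) = 0" by (rule low)
      moreover have "M (P (Suc n) * P j) = 0" using that by (intro orth) simp
      ultimately have "t j * M (P j * P j) = 0" using tM[of j] that by simp
      then show ?thesis using nd[of j] by (simp add: power2_eq_square)
    qed
    obtain m where m: "n = Suc m" using n by (cases n) auto
    have "(\<Sum>j\<le>n. smult (t j) (P j)) = smult (t n) (P n) + smult (t m) (P m) + (\<Sum>j<m. smult (t j) (P j))"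
      unfolding m by (simp add: lessThan_Suc_atMost[symmetric])
    also have "(\<Sum>j<m. smult (t j) (P j)) = 0" using z m by (intro sum.neutral) auto
    finally have "[:0, 1:] * P n = P (Suc n) + smult (t n) (P n) + smult (t (n - 1)) (P (n - 1))"
      using t m by (simp add: algebra_simps)
    moreover have "t m \<noteq> 0"
    proof -
      have "M (P n * ([:0, 1:] * P m)) = M (P n * P n) + M (P n * ([:0, 1:] * P m - P (Suc m)))"
        using m by (simp add: algebra_simps flip: add)
      also have "M (P n * ([:0, 1:] * P m - P (Suc m))) = 0"
        using monic_sub[of m] m by (intro low) simp
      finally have "M (P n * ([:0, 1:] * P m)) \<noteq> 0" using nd[of n] by (simp add: power2_eq_square)
      moreover have "M (P (Suc n) * P m) = 0" using m by (intro orth) simp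
      ultimately show ?thesis using tM[of m] m by auto
    qed
    ultimately show ?thesis using m by auto
  qed
  then show thesis using that by metis
qed

lemma newton_basis_independent:
  assumes "(\<Sum>k\<le>n. smult (a k) (newton_basis R k)) = 0" "k \<le> n"
  shows "a k = 0"
  using assms
proof (induction n arbitrary: k)
  case 0 then show ?case by simp
next
  case (Suc n)
  have "coeff (\<Sum>k\<le>n. smult (a k) (newton_basis R k)) (Suc n) = 0"
    by (auto simp: coeff_sum newton_basis_monic coeff_eq_0 intro!: sum.neutral)
  moreover have "coeff (newton_basis R (Suc n)) (Suc n) = 1"
    using newton_basis_monic[of R "Suc n"] by metis
  moreover have "coeff (\<Sum>k\<le>Suc n. smult (a k) (newton_basis R k)) (Suc n) = 0"
    unfolding Suc.prems(1) by simp
  ultimately have z: "a (Suc n) = 0" by (simp del: newton_basis.simps)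
  then have "(\<Sum>k\<le>n. smult (a k) (newton_basis R k)) = 0"
    using Suc.prems(1) by (simp del: newton_basis.simps)
  then show ?case using Suc.IH Suc.prems(2) z le_Suc_eq by auto
qed

lemma newton_coeffs_diag:
  assumes "poly_family P" "newton_coeffs R P c"
  shows "c (int n) (int n) = 1"
proof -
  have "coeff (P n) n = coeff (\<Sum>k\<le>n. smult (c (int n) (int k)) (newton_basis R k)) n"
    using assms(2) by (simp add: newton_coeffs_def)
  also have "\<dots> = (\<Sum>k\<le>n. c (int n) (int k) * coeff (newton_basis R k) n)"
    by (simp add: coeff_sum)
  also have "\<dots> = c (int n) (int n) * coeff (newton_basis R n) n"
    by (subst sum.remove[of _ n]) (auto intro!: sum.neutral simp: coeff_eq_0 newton_basis_monic)
  also have "coeff (newton_basis R n) n = 1" using newton_basis_monic[of R n] by metis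
  finally show ?thesis using assms(1) unfolding poly_family_def by (metis mult.right_neutral)
qed

lemma smult_sum_right: "smult a (sum h A) = (\<Sum>i\<in>A. smult a (h i))"
  by (induction A rule: infinite_finite_induct) (simp_all add: smult_add_right)

text \<open>The basis satisfies \<open>z * B k = B (k + 1) - R(k) * B k\<close>, and the
  coefficients of its elements are compared. The index \<open>k\<close> ranges over all integers,
  because the boundary cases \<open>k = 0\<close> and \<open>k = n + 1\<close> carry
  information.\<close>

lemma newton_coeffs_recurrence:
  assumes c: "newton_coeffs R P c" and n: "n \<ge> 1"
    and rec: "[:0, 1:] * P n = P (Suc n) + smult a (P n) + smult b (P (n - 1))"
  shows "c (int n) (k - 1) - (poly R (of_int k) + a) * c (int n) k = c (int n + 1) k + b * c (int n - 1) k"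
proof (cases "0 \<le> k \<and> k \<le> int n + 1")
  case False
  then have "c (int n) (k - 1) = 0" "c (int n) k = 0" "c (int n + 1) k = 0" "c (int n - 1) k = 0"
    using c unfolding newton_coeffs_def by auto
  then show ?thesis by simp
next
  case True
  then obtain j where j: "k = int j" "j \<le> Suc n" by (metis int_ops(4) nonneg_int_cases of_nat_le_iff)
  have supp: "c m i = 0" if "\<not> (0 \<le> i \<and> i \<le> m)" for m i using c that by (simp add: newton_coeffs_def)
  let ?B = "newton_basis R"
  have ext: "P m = (\<Sum>i\<le>Suc n. smult (c (int m) (int i)) (?B i))" if "m \<le> Suc n" for m
  proof -
    have "P m = (\<Sum>i\<le>m. smult (c (int m) (int i)) (?B i))" using c by (simp add: newton_coeffs_def)
    also have "\<dots> = (\<Sum>i\<le>Suc n. smult (c (int m) (int i)) (?B i))"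
      by (rule sum.mono_neutral_left) (use that supp in auto)
    finally show ?thesis .
  qed
  have zB: "[:0, 1:] * ?B i = ?B (Suc i) - smult (poly R (of_nat i)) (?B i)" for i by simp
  have "[:0, 1:] * P n = (\<Sum>i\<le>n. smult (c (int n) (int i)) ([:0, 1:] * ?B i))"
    using c unfolding newton_coeffs_def by (simp only: sum_distrib_left mult_smult_right)
  also have "\<dots> = (\<Sum>i\<le>n. smult (c (int n) (int i)) (?B (Suc i))) - (\<Sum>i\<le>n. smult (c (int n) (int i) * poly R (of_nat i)) (?B i))"
    unfolding zB by (simp only: smult_diff_right smult_smult sum_subtractf)
  also have "(\<Sum>i\<le>n. smult (c (int n) (int i)) (?B (Suc i))) = (\<Sum>i\<le>Suc n. smult (c (int n) (int i - 1)) (?B i))"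
    by (subst sum.atMost_Suc_shift) (simp add: supp del: newton_basis.simps)
  also have "(\<Sum>i\<le>n. smult (c (int n) (int i) * poly R (of_nat i)) (?B i)) =
      (\<Sum>i\<le>Suc n. smult (c (int n) (int i) * poly R (of_nat i)) (?B i))"
    by (simp add: supp del: newton_basis.simps)
  finally have zP: "[:0, 1:] * P n = (\<Sum>i\<le>Suc n. smult (c (int n) (int i - 1) - c (int n) (int i) * poly R (of_nat i)) (?B i))"
    by (simp only: smult_diff_left sum_subtractf)
  have "(\<Sum>i\<le>Suc n. smult (c (int n) (int i - 1) - c (int n) (int i) * poly R (of_nat i)
      - c (int (Suc n)) (int i) - a * c (int n) (int i) - b * c (int (n - 1)) (int i)) (?B i))
    = [:0, 1:] * P n - P (Suc n) - smult a (P n) - smult b (P (n - 1))"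
    unfolding zP unfolding ext[of "Suc n", OF order_refl] ext[of n, OF le_SucI[OF order_refl]] ext[of "n - 1", OF le_SucI[OF diff_le_self]]
    by (simp only: smult_diff_left sum_subtractf smult_sum_right smult_smult)
  also have "\<dots> = 0" using rec by simp
  finally have "c (int n) (int j - 1) - c (int n) (int j) * poly R (of_nat j)
      - c (int (Suc n)) (int j) - a * c (int n) (int j) - b * c (int (n - 1)) (int j) = 0"
    by (rule newton_basis_independent) (rule j(2))
  then show ?thesis using n j by (simp add: algebra_simps of_nat_diff)
qed

section \<open>The coefficient array and its ratio function\<close>

lemma eval2_at_s_zero:
  fixes F :: bipoly
  assumes "map_poly (\<lambda>c. poly c b) F = 0"
  shows "[:[:- b, 1:]:] dvd F"
proof -
  have "poly (coeff F i) b = 0" for i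
    using arg_cong[OF assms, of "\<lambda>p. coeff p i"] by (simp add: coeff_map_poly)
  then show ?thesis unfolding const_poly_dvd_iff by (simp add: poly_eq_0_iff_dvd)
qed

lemma eval2_on_diag: "eval2 F (x - y) x = poly (poly F [:- y, 1:]) x"
  by (induction F) (simp_all add: algebra_simps)

lemma diag_minus_dvd_iff: "diag_minus y dvd F \<longleftrightarrow> poly F [:- y, 1:] = 0"
proof -
  have "diag_minus y = - [:- [:- y, 1:], 1:]" by simp
  then have "diag_minus y dvd F \<longleftrightarrow> [:- [:- y, 1:], 1:] dvd F" by (metis minus_dvd_iff)
  then show ?thesis by (simp add: poly_eq_0_iff_dvd)
qed

lemma frequently_zero_poly:
  fixes p :: "complex poly"
  assumes "\<And>n0. \<exists>n\<ge>n0. poly p (of_nat n) = 0"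
  shows "p = 0"
proof (rule ccontr)
  assume "p \<noteq> 0"
  then obtain n0 where "\<And>n. n \<ge> n0 \<Longrightarrow> poly p (of_nat n) \<noteq> 0"
    using eventually_poly_nonzero[of p] by (auto simp: eventually_sequentially)
  then show False using assms by blast
qed

lemma generic_Suc_n_iff: "generic (\<lambda>n k. P (Suc n) k) \<longleftrightarrow> generic P"
proof
  assume "generic (\<lambda>n k. P (Suc n) k)"
  then show "generic P" unfolding generic_def
  proof (rule eventually_mono)
    fix k assume "\<forall>\<^sub>F n in sequentially. P (Suc n) k"
    then show "\<forall>\<^sub>F n in sequentially. P n k" by (rule eventually_sequentially_Suc[THEN iffD1])
  qed
qed (rule generic_Suc_n)

lemma generic_Suc_k_iff: "generic (\<lambda>n k. P n (Suc k)) \<longleftrightarrow> generic P"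
  using generic_Suc_k[of P] unfolding generic_def
  by (metis (no_types) eventually_sequentially_Suc[where P = "\<lambda>k. \<forall>\<^sub>F n in sequentially. P n k"])

lemma generic_const_k: "generic (\<lambda>n k. P n) \<longleftrightarrow> (\<forall>\<^sub>F n in sequentially. P n)"
  unfolding generic_def by simp

lemma generic_shift_u: "generic (\<lambda>n k. gev (fshift (-1) 0 x) (Suc n) k = gev x n k)"
  using generic_gev_shift_u[of "fshift (-1) 0 x"] by (simp add: eq_commute)

lemma generic_shift_s: "generic (\<lambda>n k. gev (fshift 0 (-1) x) n (Suc k) = gev x n k)"
  using generic_gev_shift_s[of "fshift 0 (-1) x"] by (simp add: eq_commute)

lemma generic_poly_at_s: "generic (\<lambda>n k. gev (poly_at p var_s) n k = poly p (of_nat k))"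
proof (rule generic_mono[OF generic_gev_div[of 1 "lift2 p Ss"]])
  fix n k assume "gev (to_fract (lift2 p Ss) / to_fract 1) n k =
    eval2 (lift2 p Ss) (of_nat n) (of_nat k) / eval2 1 (of_nat n) (of_nat k) \<and> eval2 1 (of_nat n) (of_nat k) \<noteq> 0"
  then show "gev (poly_at p var_s) n k = poly p (of_nat k)"
    by (simp add: to_fract_lift2 var_s_def)
qed simp

lemma generic_poly_at_u:
  assumes "q \<noteq> 0"
  shows "generic (\<lambda>n k. gev (poly_at p var_u / poly_at q var_u) n k = poly p (of_nat n) / poly q (of_nat n)
    \<and> poly q (of_nat n) \<noteq> 0)"
proof (rule generic_mono[OF generic_gev_div[of "lift2 q Us" "lift2 p Us"]])
  fix n k assume "gev (to_fract (lift2 p Us) / to_fract (lift2 q Us)) n k =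
    eval2 (lift2 p Us) (of_nat n) (of_nat k) / eval2 (lift2 q Us) (of_nat n) (of_nat k) \<and> 
    eval2 (lift2 q Us) (of_nat n) (of_nat k) \<noteq> 0"
  then show "gev (poly_at p var_u / poly_at q var_u) n k = poly p (of_nat n) / poly q (of_nat n)
    \<and> poly q (of_nat n) \<noteq> 0"
    by (simp add: to_fract_lift2 var_u_def)
qed (use assms in simp)

locale hg_orth =
  fixes R :: "complex poly" and N D :: bipoly and c :: "int \<Rightarrow> int \<Rightarrow> complex" and \<alpha> \<beta> :: "nat \<Rightarrow> complex"
  assumes cop: "coprime N D" and D_nz: "D \<noteq> 0"
    and supp: "\<not> (0 \<le> k \<and> k \<le> m) \<Longrightarrow> c m k = 0"
    and diag: "c (int n) (int n) = 1"
    and hg: "eval2 D (of_int m) (of_int k) * c m (k + 1) = eval2 N (of_int m) (of_int k) * c m k"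
    and \<beta>_nz: "n \<ge> 1 \<Longrightarrow> \<beta> n \<noteq> 0"
    and three: "n \<ge> 1 \<Longrightarrow> c (int n) (k - 1) - (poly R (of_int k) + \<alpha> n) * c (int n) k
        = c (int n + 1) k + \<beta> n * c (int n - 1) k"
begin

text \<open>Because \<open>\<beta> n \<noteq> 0\<close>, the recurrence can be run downwards, and
  two consecutive zeros in column 0 would reach \<open>c 0 0 = 1\<close>. If column
  \<open>k + 1\<close> vanished from some row on, the recurrence there would make column
  \<open>k\<close> vanish too.\<close>

lemma column_nonzero: "\<exists>n\<ge>n0. c (int n) (int k) \<noteq> 0"
proof (induction k arbitrary: n0)
  case 0
  show ?case
  proof (rule ccontr)
    assume "\<not> ?case"
    then have z: "c (int n) 0 = 0" if "n \<ge> n0" for n using that by auto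
    have "c (int n) 0 = 0 \<and> c (int (Suc n)) 0 = 0" if "n \<le> n0" for n
      using that
    proof (induction n rule: inc_induct)
      case base then show ?case using z[of n0] z[of "Suc n0"] by simp
    next
      case (step n)
      have "c (int (Suc n)) (-1) = 0" by (rule supp) simp
      then show ?case using three[of "Suc n" 0] step.IH \<beta>_nz[of "Suc n"] by (simp add: algebra_simps)
    qed
    from this[of 0] have "c (int 0) (int 0) = 0" by simp
    then show False using diag[of 0] by simp
  qed
next
  case (Suc k)
  show ?case
  proof (rule ccontr)
    assume "\<not> ?case"
    then have z: "c (int n) (int (Suc k)) = 0" if "n \<ge> n0" for n using that by auto
    obtain n where n: "n \<ge> Suc n0" "c (int n) (int k) \<noteq> 0" using Suc.IH by blast
    have "c (int n) (int (Suc k)) = 0" "c (int n + 1) (int (Suc k)) = 0" "c (int n - 1) (int (Suc k)) = 0"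
      using z[of n] z[of "Suc n"] z[of "n - 1"] n by (simp_all add: of_nat_diff add.commute)
    then show False using three[of n "int (Suc k)"] n by simp
  qed
qed

text \<open>If one of \<open>N\<close>, \<open>D\<close> vanished on the line \<open>s = k\<close>,
  the other would vanish there at infinitely many \<open>n\<close>, since neither column
  \<open>k\<close> nor column \<open>k + 1\<close> is eventually 0. Then \<open>s - k\<close> would
  be a common factor.\<close>

lemma col_nonzero:
  "map_poly (\<lambda>c. poly c (of_nat k)) N \<noteq> 0" "map_poly (\<lambda>c. poly c (of_nat k)) D \<noteq> 0"
proof -
  let ?N = "map_poly (\<lambda>c. poly c (of_nat k)) N" and ?D = "map_poly (\<lambda>c. poly c (of_nat k)) D"
  have hgk: "poly ?D (of_nat n) * c (int n) (int (Suc k)) = poly ?N (of_nat n) * c (int n) (int k)" for n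
    using hg[of "int n" "int k"] by (simp add: eval2_conv_map_poly add.commute)
  have ND: "?N = 0 \<longleftrightarrow> ?D = 0"
  proof
    assume "?N = 0"
    show "?D = 0"
    proof (rule frequently_zero_poly)
      fix n0 show "\<exists>n\<ge>n0. poly ?D (of_nat n) = 0"
        using column_nonzero[of n0 "Suc k"] hgk \<open>?N = 0\<close> by (metis mult_eq_0_iff mult_zero_left poly_0)
    qed
  next
    assume "?D = 0"
    show "?N = 0"
    proof (rule frequently_zero_poly)
      fix n0 show "\<exists>n\<ge>n0. poly ?N (of_nat n) = 0"
        using column_nonzero[of n0 "k"] hgk \<open>?D = 0\<close> by (metis mult_eq_0_iff mult_zero_left poly_0)
    qed
  qed
  have "\<not> (?N = 0 \<and> ?D = 0)"
  proof
    assume "?N = 0 \<and> ?D = 0"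
    then have "[:[:- of_nat k, 1:]:] dvd N" "[:[:- of_nat k, 1:]:] dvd D" by (simp_all add: eval2_at_s_zero)
    then have "[:[:- of_nat k, 1:]:] dvd (1 :: bipoly)" using cop by (meson coprime_common_divisor)
    then have "[:- of_nat k, 1:] dvd (1 :: complex poly)" by (simp add: is_unit_const_poly_iff)
    then show False by (auto dest: dvd_imp_degree_le)
  qed
  then show "?N \<noteq> 0" "?D \<noteq> 0" using ND by auto
qed

lemma N_nz: "N \<noteq> 0" using col_nonzero(1)[of 0] by auto

text \<open>The ratio relation at \<open>k = -1\<close> connects \<open>c n (-1) = 0\<close> with
  \<open>c n 0\<close>, which is nonzero for infinitely many \<open>n\<close>. This is the origin of
  the factor \<open>s + 1\<close> in the denominator.\<close>

lemma D_at_minus_1: "[:[:1, 1:]:] dvd D"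
proof -
  have "map_poly (\<lambda>c. poly c (-1)) D = 0"
  proof (rule frequently_zero_poly)
    fix n0
    obtain n where n: "n \<ge> n0" "c (int n) 0 \<noteq> 0" using column_nonzero[of n0 0] by auto
    moreover have "c (int n) (-1) = 0" by (rule supp) simp
    ultimately show "\<exists>n\<ge>n0. poly (map_poly (\<lambda>c. poly c (-1)) D) (of_nat n) = 0"
      using hg[of "int n" "-1"] by (auto simp: eval2_conv_map_poly intro!: exI[of _ n])
  qed
  then show ?thesis using eval2_at_s_zero[of "-1" D] by simp
qed

lemma eventually_ratio:
  "\<forall>\<^sub>F n in sequentially. eval2 N (of_nat n) (of_nat k) \<noteq> 0 \<and> eval2 D (of_nat n) (of_nat k) \<noteq> 0"
  using eventually_eval2_nonzero[OF col_nonzero(1)] eventually_eval2_nonzero[OF col_nonzero(2)]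
  by (rule eventually_conj)

text \<open>At \<open>k = n\<close> the recurrence reads
  \<open>\<alpha> n = c n (n - 1) - c (n + 1) n - R(n)\<close>, and the ratio relation at
  \<open>k = n - 1\<close> makes \<open>c n (n - 1)\<close> a rational function of
  \<open>n\<close>.\<close>

lemma \<alpha>_rational:
  obtains a1 a2 where "a2 \<noteq> 0"
    "\<forall>\<^sub>F n in sequentially. poly a2 (of_nat n) \<noteq> 0 \<and> \<alpha> n = poly a1 (of_nat n) / poly a2 (of_nat n)"
proof -
  define d e where "d = pcompose (poly D [:1, 1:]) [:-1, 1:]" and "e = pcompose (poly N [:1, 1:]) [:-1, 1:]"
  have de: "poly d x = eval2 D x (x - 1)" "poly e x = eval2 N x (x - 1)" for x
    using eval2_on_diag[of D "x - 1" "-1"] eval2_on_diag[of N "x - 1" "-1"]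
    by (simp_all add: d_def e_def poly_pcompose algebra_simps)
  have ce: "poly d (of_nat n) = poly e (of_nat n) * c (int n) (int n - 1)" if "n \<ge> 1" for n
    using hg[of "int n" "int n - 1"] diag[of n] by (simp add: de)
  \<comment> \<open>Otherwise \<open>N\<close> and then also \<open>D\<close> would vanish on the
    line \<open>s = u - 1\<close>, a common factor.\<close>
  have "e \<noteq> 0"
  proof
    assume "e = 0"
    then have "d = 0" using ce by (intro frequently_zero_poly) (metis mult_zero_left poly_0 nat_le_linear)
    have "poly N [:1, 1:] = 0" "poly D [:1, 1:] = 0"
      using \<open>e = 0\<close> \<open>d = 0\<close> by (auto simp: d_def e_def pcompose_eq_0_iff)
    then have "diag_minus (-1) dvd N" "diag_minus (-1) dvd D"
      using diag_minus_dvd_iff[of "-1" N] diag_minus_dvd_iff[of "-1" D] by simp_all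
    then have "diag_minus (-1) dvd 1" using cop by (meson coprime_common_divisor)
    then show False using prime_elem_diag(1)[of "-1"] by (auto simp: prime_elem_def)
  qed
  define a2 where "a2 = e * pcompose e [:1, 1:]"
  define a1 where "a1 = d * pcompose e [:1, 1:] - pcompose d [:1, 1:] * e - R * a2"
  have "a2 \<noteq> 0" using \<open>e \<noteq> 0\<close> by (simp add: a2_def pcompose_eq_0_iff)
  moreover have "\<forall>\<^sub>F n in sequentially. poly a2 (of_nat n) \<noteq> 0 \<and> \<alpha> n = poly a1 (of_nat n) / poly a2 (of_nat n)"
    using eventually_poly_nonzero[OF \<open>a2 \<noteq> 0\<close>] eventually_ge_at_top[of 1]
  proof eventually_elim
    case (elim n)
    have nz: "poly e (of_nat n) \<noteq> 0" "poly e (of_nat n + 1) \<noteq> 0"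
      using elim by (auto simp: a2_def poly_pcompose add.commute)
    have c1: "c (int n) (int n - 1) = poly d (of_nat n) / poly e (of_nat n)"
      using ce[of n] elim nz by (simp add: field_simps)
    have c2: "c (int n + 1) (int n) = poly d (of_nat n + 1) / poly e (of_nat n + 1)"
      using ce[of "Suc n"] nz by (simp add: field_simps)
    have "c (int n - 1) (int n) = 0" by (rule supp) simp
    then have "\<alpha> n = c (int n) (int n - 1) - c (int n + 1) (int n) - poly R (of_nat n)"
      using three[of n "int n"] elim diag[of n] by (simp add: algebra_simps)
    then show ?case
      using elim nz unfolding c1 c2 a1_def a2_def by (simp add: poly_pcompose field_simps add.commute)
  qed
  ultimately show thesis by (rule that)
qed

definition f :: bifract where "f = to_fract N / to_fract D"

lemma f_nz: "f \<noteq> 0" using N_nz D_nz by (simp add: f_def)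

text \<open>The difference of the two sides is the denominator of \<open>A\<close> below. If they
  were equal, \<open>f\<close> would have period 2 in \<open>u\<close>, so \<open>N\<close> would
  depend on \<open>s\<close> alone; but \<open>c m (m + 1) = 0\<close> makes it vanish at
  \<open>s = m\<close> for every \<open>m\<close>.\<close>

lemma f_depends_on_u: "fshift 1 0 f \<noteq> fshift (-1) 0 f"
proof
  assume "fshift 1 0 f = fshift (-1) 0 f"
  then have "fshift 1 0 (fshift 1 0 f) = fshift 1 0 (fshift (-1) 0 f)" by (simp only:)
  then have "fshift 2 0 f = f" by simp
  then have "to_fract (shift2 2 0 N * D) = to_fract (N * shift2 2 0 D)"
    using D_nz by (simp add: f_def field_simps)
  then have "shift2 2 0 N * D = N * shift2 2 0 D" by (simp only: to_fract_eq_iff)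
  then have "N dvd shift2 2 0 N * D" by simp
  then have "N dvd shift2 2 0 N" using cop by (simp add: coprime_dvd_mult_left_iff)
  then have "shift2 2 0 N = N" using N_nz by (rule shift2_dvd_self_eq)
  then obtain n where n: "N = [:n:]" using shift_u_invariant[of 2 N] by auto
  have "poly n (of_nat m) = 0" for m
  proof -
    have "c (int m) (int m + 1) = 0" by (rule supp) simp
    then show ?thesis using hg[of "int m" "int m"] diag[of m] by (simp add: n)
  qed
  then have "n = 0" by (intro frequently_zero_poly) blast
  then show False using N_nz n by simp
qed

definition c' :: "nat \<Rightarrow> nat \<Rightarrow> complex" where "c' n k = c (int n) (int k)"

lemma ratio_c': "generic (\<lambda>n k. c' n (Suc k) = gev f n k * c' n k \<and> gev f n k \<noteq> 0)"
proof (rule generic_mono[OF generic_conj[OF generic_gev_nonzero[OF f_nz] generic_gev_div[OF D_nz, of N]]])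
  fix n k assume "gev f n k \<noteq> 0 \<and> gev (to_fract N / to_fract D) n k =
    eval2 N (of_nat n) (of_nat k) / eval2 D (of_nat n) (of_nat k) \<and> eval2 D (of_nat n) (of_nat k) \<noteq> 0"
  then show "c' n (Suc k) = gev f n k * c' n k \<and> gev f n k \<noteq> 0"
    using hg[of "int n" "int k"] by (auto simp: f_def c'_def field_simps)
qed

lemma three_c': "c' (Suc n) k - (poly R (of_nat (Suc k)) + \<alpha> (Suc n)) * c' (Suc n) (Suc k)
    = c' (Suc (Suc n)) (Suc k) + \<beta> (Suc n) * c' n (Suc k)"
  using three[of "Suc n" "int (Suc k)"] by (simp add: c'_def add.commute)

end

locale hg_orth_rat = hg_orth +
  fixes a1 a2 :: "complex poly"
  assumes a2: "a2 \<noteq> 0"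
    and \<alpha>_eq: "\<forall>\<^sub>F n in sequentially. poly a2 (of_nat n) \<noteq> 0 \<and> \<alpha> n = poly a1 (of_nat n) / poly a2 (of_nat n)"
begin

definition al :: bifract where "al = poly_at a1 var_u / poly_at a2 var_u"

text \<open>By the recurrence this is the function
  \<open>(c (n + 1) k + \<beta> n * c (n - 1) k) / c n k\<close>.\<close>

definition w :: bifract where "w = 1 / fshift 0 (-1) f - poly_at R var_s - al"

text \<open>The recurrences at \<open>k\<close> and \<open>k + 1\<close>, with the entries of column
  \<open>k + 1\<close> expressed through \<open>f\<close>, are two linear equations for
  \<open>c (n + 1) k\<close> and \<open>\<beta> n * c (n - 1) k\<close>. \<open>A\<close> is their
  solution for the first unknown, divided by \<open>c n k\<close>.\<close>

definition A :: bifract where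
  "A = (fshift (-1) 0 f * w - f * fshift 0 1 w) / (fshift (-1) 0 f - fshift 1 0 f)"

lemma generic_w: "generic (\<lambda>n k. gev w n (Suc k) = 1 / gev f n k - poly R (of_nat (Suc k)) - \<alpha> n)"
proof -
  have S_nz: "fshift 0 (-1) f \<noteq> 0" using f_nz by simp
  have \<alpha>: "generic (\<lambda>n k. poly a2 (of_nat n) \<noteq> 0 \<and> \<alpha> n = poly a1 (of_nat n) / poly a2 (of_nat n))"
    using \<alpha>_eq by (simp add: generic_const_k)
  have 1: "generic (\<lambda>n k. gev w n k = gev 1 n k / gev (fshift 0 (-1) f) n k - poly R (of_nat k) - \<alpha> n)"
    by (rule generic_mono[OF generic_conj[OF generic_conj[OF generic_gev_diff[of "1 / fshift 0 (-1) f - poly_at R var_s" al]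
        generic_gev_diff[of "1 / fshift 0 (-1) f" "poly_at R var_s"]]
        generic_conj[OF generic_conj[OF generic_gev_divide[OF S_nz, of 1] generic_poly_at_s[of R]]
        generic_conj[OF \<alpha> generic_poly_at_u[OF a2, of a1]]]]])
      (simp add: w_def al_def)
  have 2: "generic (\<lambda>n k. gev 1 n k = 1)"
    using generic_gev_div[of 1 1] by (simp add: generic_def)
  show ?thesis
    by (rule generic_mono[OF generic_conj[OF generic_shift_s[of f] generic_Suc_k[OF generic_conj[OF 1 2]]]]) simp
qed

lemma ratio_up: "generic (\<lambda>n k. c' (Suc n) k = gev A n k * c' n k)"
proof -
  let ?fm = "fshift (-1) 0 f" and ?fp = "fshift 1 0 f"
  have nz: "?fm - ?fp \<noteq> 0" using f_depends_on_u by simp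
  have A1: "generic (\<lambda>n k. gev A n k = (gev ?fm n k * gev w n k - gev f n k * gev (fshift 0 1 w) n k) / (gev ?fm n k - gev ?fp n k)
     \<and> gev ?fm n k - gev ?fp n k \<noteq> 0)"
    by (rule generic_mono[OF generic_conj[OF generic_conj[OF generic_gev_divide[OF nz, of "?fm * w - f * fshift 0 1 w"]
      generic_gev_nonzero[OF nz]] generic_conj[OF generic_conj[OF generic_gev_diff[of "?fm * w" "f * fshift 0 1 w"] generic_gev_diff[of ?fm ?fp]]
       generic_conj[OF generic_gev_mult[of ?fm w] generic_gev_mult[of f "fshift 0 1 w"]]]]])
      (auto simp: A_def)
  have A2: "generic (\<lambda>n k. gev A (Suc n) (Suc k) =
      (gev f n (Suc k) * gev w (Suc n) (Suc k) - gev f (Suc n) (Suc k) * gev w (Suc n) (Suc (Suc k)))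
        / (gev f n (Suc k) - gev f (Suc (Suc n)) (Suc k)) \<and> gev f n (Suc k) - gev f (Suc (Suc n)) (Suc k) \<noteq> 0)"
    by (rule generic_mono[OF generic_conj[OF generic_conj[OF generic_Suc_n[OF generic_Suc_k[OF A1]] generic_Suc_k[OF generic_shift_u[of f]]]
      generic_conj[OF generic_Suc_n[OF generic_Suc_k[OF generic_gev_shift_s[of w]]] generic_Suc_n[OF generic_Suc_k[OF generic_gev_shift_u[of f]]]]]])
      auto
  \<comment> \<open>The recurrence looks back to \<open>n - 1\<close> and \<open>k - 1\<close>. It
    is therefore taken at \<open>Suc n\<close> and \<open>Suc k\<close>, which avoids truncated
    subtraction; the shift is removed at the end, as it does not affect genericity.\<close>
  have "generic (\<lambda>n k. c' (Suc (Suc n)) (Suc k) = gev A (Suc n) (Suc k) * c' (Suc n) (Suc k))"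
  proof (rule generic_mono[OF generic_conj[OF generic_conj[OF A2 generic_conj[OF generic_Suc_n[OF generic_w] generic_Suc_n[OF generic_Suc_k[OF generic_w]]]]
      generic_conj[OF generic_conj[OF generic_Suc_n[OF ratio_c'] generic_Suc_k[OF ratio_c']]
      generic_conj[OF generic_Suc_n[OF generic_Suc_k[OF ratio_c']] generic_Suc_n[OF generic_Suc_n[OF generic_Suc_k[OF ratio_c']]]]]]], elim conjE)
    fix n k
    let ?N = "Suc n" and ?K = "Suc k"
    define f0 f1 f2 f3 where "f0 = gev f ?N k" and "f1 = gev f ?N ?K" and "f2 = gev f (Suc ?N) ?K" and "f3 = gev f n ?K"
    define w1 w2 X Z C where "w1 = gev w ?N ?K" and "w2 = gev w ?N (Suc ?K)" and "X = c' (Suc ?N) ?K"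
      and "Z = \<beta> ?N * c' n ?K" and "C = c' ?N ?K"
    assume a: "gev A (Suc n) (Suc k) =
      (gev f n (Suc k) * gev w (Suc n) (Suc k) - gev f (Suc n) (Suc k) * gev w (Suc n) (Suc (Suc k)))
        / (gev f n (Suc k) - gev f (Suc (Suc n)) (Suc k))" "gev f n (Suc k) - gev f (Suc (Suc n)) (Suc k) \<noteq> 0"
      and w: "gev w (Suc n) (Suc k) = 1 / gev f (Suc n) k - poly R (of_nat (Suc k)) - \<alpha> (Suc n)"
      "gev w (Suc n) (Suc (Suc k)) = 1 / gev f (Suc n) (Suc k) - poly R (of_nat (Suc (Suc k))) - \<alpha> (Suc n)"
      and c: "c' (Suc n) (Suc k) = gev f (Suc n) k * c' (Suc n) k" "gev f (Suc n) k \<noteq> 0"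
       "c' n (Suc (Suc k)) = gev f n (Suc k) * c' n (Suc k)"
       "c' (Suc n) (Suc (Suc k)) = gev f (Suc n) (Suc k) * c' (Suc n) (Suc k)" "gev f (Suc n) (Suc k) \<noteq> 0"
       "c' (Suc (Suc n)) (Suc (Suc k)) = gev f (Suc (Suc n)) (Suc k) * c' (Suc (Suc n)) (Suc k)"
    have "w1 * C = c' ?N k - (poly R (of_nat (Suc k)) + \<alpha> ?N) * C"
      unfolding w1_def w C_def using c by (simp add: field_simps)
    then have e1: "w1 * C = X + Z" using three_c'[of n k] by (simp add: X_def Z_def C_def)
    have "w2 * f1 * C = C - (poly R (of_nat (Suc ?K)) + \<alpha> ?N) * (f1 * C)"
      unfolding w2_def w f1_def using c(5) by (simp add: field_simps)
    then have "w2 * f1 * C = f2 * X + f3 * Z"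
      using three_c'[of n ?K] c by (simp add: X_def Z_def C_def f1_def f2_def f3_def)
    then have "(f3 - f2) * X = f3 * (w1 * C) - w2 * f1 * C" using e1 by (simp add: algebra_simps)
    then have "X = (f3 * w1 - f1 * w2) / (f3 - f2) * C"
      using a(2) by (simp add: f2_def f3_def field_simps)
    then show "c' (Suc (Suc n)) (Suc k) = gev A (Suc n) (Suc k) * c' (Suc n) (Suc k)"
      unfolding a(1) by (simp add: X_def C_def f1_def f2_def f3_def w1_def w2_def)
  qed
  then show ?thesis
    by (simp only: generic_Suc_n_iff[of "\<lambda>n k. c' (Suc n) (Suc k) = gev A n (Suc k) * c' n (Suc k)"]
      generic_Suc_k_iff[of "\<lambda>n k. c' (Suc n) k = gev A n k * c' n k"])
qed

text \<open>By \<open>ratio_up\<close> a zero high up in a column would annihilate the rest of the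
  column, against \<open>column_nonzero\<close>.\<close>

lemma generic_c'_nonzero: "generic (\<lambda>n k. c' n k \<noteq> 0)"
  using ratio_up unfolding generic_def
proof (rule eventually_mono)
  fix k assume "\<forall>\<^sub>F n in sequentially. c' (Suc n) k = gev A n k * c' n k"
  then obtain n0 where n0: "\<And>n. n \<ge> n0 \<Longrightarrow> c' (Suc n) k = gev A n k * c' n k"
    by (auto simp: eventually_sequentially)
  have "c' n k \<noteq> 0" if n: "n \<ge> n0" for n
  proof
    assume z: "c' n k = 0"
    have "c' m k = 0" if "m \<ge> n" for m
      using that by (induction m rule: dec_induct) (use n n0 z in auto)
    then show False using column_nonzero[of n k] by (auto simp: c'_def)
  qed
  then show "\<forall>\<^sub>F n in sequentially. c' n k \<noteq> 0" by (auto simp: eventually_sequentially)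
qed

lemma A_nz: "A \<noteq> 0"
proof
  assume "A = 0"
  have g0: "gev 0 n k = 0" for n k
    using quot_of_fract_to_fract[of "0 :: bipoly"] by (simp add: gev_def ev_def)
  have "generic (\<lambda>n k. False)"
  proof (rule generic_mono[OF generic_conj[OF ratio_up generic_Suc_n[OF generic_c'_nonzero]]], elim conjE)
    fix n k assume "c' (Suc n) k = gev A n k * c' n k" "c' (Suc n) k \<noteq> 0"
    then show False unfolding \<open>A = 0\<close> g0 by simp
  qed
  then show False by simp
qed

text \<open>Both products describe \<open>c (n + 1) (k + 1) / c n k\<close>, reached through
  \<open>(n, k + 1)\<close> or through \<open>(n + 1, k)\<close>.\<close>

lemma shift_compatible: "fshift 0 1 A * f = A * fshift 1 0 f"
proof (rule generic_gev_eqD)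
  show "generic (\<lambda>n k. gev (fshift 0 1 A * f) n k = gev (A * fshift 1 0 f) n k)"
  proof (rule generic_mono[OF generic_conj[OF generic_conj[OF generic_conj[OF generic_gev_mult[of "fshift 0 1 A" f] generic_gev_mult[of A "fshift 1 0 f"]]
        generic_conj[OF generic_gev_shift_s[of A] generic_gev_shift_u[of f]]]
        generic_conj[OF generic_conj[OF ratio_c' generic_Suc_n[OF ratio_c']] generic_conj[OF generic_c'_nonzero generic_conj[OF ratio_up generic_Suc_k[OF ratio_up]]]]]], elim conjE)
    fix n k
    assume "gev (fshift 0 1 A * f) n k = gev (fshift 0 1 A) n k * gev f n k"
      "gev (A * fshift 1 0 f) n k = gev A n k * gev (fshift 1 0 f) n k"
      "gev (fshift 0 1 A) n k = gev A n (Suc k)" "gev (fshift 1 0 f) n k = gev f (Suc n) k"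
      and c: "c' n (Suc k) = gev f n k * c' n k" "c' (Suc n) (Suc k) = gev f (Suc n) k * c' (Suc n) k"
      "c' n k \<noteq> 0" "c' (Suc n) k = gev A n k * c' n k" "c' (Suc n) (Suc k) = gev A n (Suc k) * c' n (Suc k)"
    have "gev A n (Suc k) * gev f n k * c' n k = gev A n k * gev f (Suc n) k * c' n k"
      using c(5)[symmetric] unfolding c(1,2,4) by (simp only: mult_ac)
    then have "gev A n (Suc k) * gev f n k = gev A n k * gev f (Suc n) k"
      by (simp only: mult_right_cancel[OF c(3)])
    then show "gev (fshift 0 1 A * f) n k = gev (A * fshift 1 0 f) n k"
      by (simp only: \<open>gev (fshift 0 1 A * f) n k = _\<close> \<open>gev (A * fshift 1 0 f) n k = _\<close>
        \<open>gev (fshift 0 1 A) n k = _\<close> \<open>gev (fshift 1 0 f) n k = _\<close>)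
  qed
qed

text \<open>The recurrence solved for its coefficient \<open>\<beta>\<close>. That \<open>s\<close>
  drops out is seen from the values: they equal \<open>\<beta> n\<close>, whatever \<open>k\<close>
  is.\<close>

definition be :: bifract where "be = (w - A) * fshift (-1) 0 A"

lemma generic_be: "generic (\<lambda>n k. gev be n k = \<beta> n)"
proof -
  have 1: "generic (\<lambda>n k. gev be n k = (gev w n k - gev A n k) * gev (fshift (-1) 0 A) n k)"
    by (rule generic_mono[OF generic_conj[OF generic_gev_mult[of "w - A" "fshift (-1) 0 A"] generic_gev_diff[of w A]]])
      (simp add: be_def)
  have "generic (\<lambda>n k. gev be (Suc n) (Suc k) = \<beta> (Suc n))"
  proof (rule generic_mono[OF generic_conj[OF generic_conj[OF generic_Suc_n[OF generic_Suc_k[OF 1]] generic_Suc_k[OF generic_shift_u[of A]]]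
      generic_conj[OF generic_conj[OF generic_Suc_n[OF generic_w] generic_Suc_n[OF ratio_c']] 
       generic_conj[OF generic_conj[OF generic_Suc_n[OF generic_Suc_k[OF ratio_up]] generic_Suc_k[OF ratio_up]] generic_Suc_k[OF generic_c'_nonzero]]]]], elim conjE)
    fix n k
    assume a: "gev be (Suc n) (Suc k) = (gev w (Suc n) (Suc k) - gev A (Suc n) (Suc k)) * gev (fshift (-1) 0 A) (Suc n) (Suc k)"
      "gev (fshift (-1) 0 A) (Suc n) (Suc k) = gev A n (Suc k)"
      and w: "gev w (Suc n) (Suc k) = 1 / gev f (Suc n) k - poly R (of_nat (Suc k)) - \<alpha> (Suc n)"
      and c: "c' (Suc n) (Suc k) = gev f (Suc n) k * c' (Suc n) k" "gev f (Suc n) k \<noteq> 0"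
      "c' (Suc (Suc n)) (Suc k) = gev A (Suc n) (Suc k) * c' (Suc n) (Suc k)"
      "c' (Suc n) (Suc k) = gev A n (Suc k) * c' n (Suc k)" "c' n (Suc k) \<noteq> 0"
    have "gev w (Suc n) (Suc k) * c' (Suc n) (Suc k) = c' (Suc n) k - (poly R (of_nat (Suc k)) + \<alpha> (Suc n)) * c' (Suc n) (Suc k)"
      unfolding w c(1) using c(2) by (simp add: field_simps)
    also have "\<dots> = gev A (Suc n) (Suc k) * c' (Suc n) (Suc k) + \<beta> (Suc n) * c' n (Suc k)"
      unfolding three_c' c(3) ..
    finally have "(gev w (Suc n) (Suc k) - gev A (Suc n) (Suc k)) * c' (Suc n) (Suc k) = \<beta> (Suc n) * c' n (Suc k)"
      by (simp add: algebra_simps)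
    then have "((gev w (Suc n) (Suc k) - gev A (Suc n) (Suc k)) * gev A n (Suc k)) * c' n (Suc k) = \<beta> (Suc n) * c' n (Suc k)"
      unfolding c(4) by (simp add: mult_ac)
    then show "gev be (Suc n) (Suc k) = \<beta> (Suc n)" using c(5) a by simp
  qed
  then show ?thesis
    by (simp only: generic_Suc_n_iff[of "\<lambda>n k. gev be n (Suc k) = \<beta> n"]
      generic_Suc_k_iff[of "\<lambda>n k. gev be n k = \<beta> n"])
qed

lemma be_rational:
  obtains b1 b2 where "b1 \<noteq> 0" "b2 \<noteq> 0" "be = poly_at b1 var_u / poly_at b2 var_u"
    "\<forall>\<^sub>F n in sequentially. poly b2 (of_nat n) \<noteq> 0 \<and> \<beta> n = poly b1 (of_nat n) / poly b2 (of_nat n)"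
proof -
  have "fshift 0 1 be = be"
    by (rule generic_gev_eqD, rule generic_mono[OF generic_conj[OF generic_gev_shift_s[of be]
      generic_conj[OF generic_be generic_Suc_k[OF generic_be]]]]) simp
  then obtain b1 b2 where b: "b2 \<noteq> 0" "be = poly_at b1 var_u / poly_at b2 var_u"
    by (rule fshift_s_invariant)
  have "generic (\<lambda>n k. poly b2 (of_nat n) \<noteq> 0 \<and> \<beta> n = poly b1 (of_nat n) / poly b2 (of_nat n))"
    by (rule generic_mono[OF generic_conj[OF generic_poly_at_u[OF b(1), of b1] generic_be]]) (auto simp: b(2))
  then have ev: "\<forall>\<^sub>F n in sequentially. poly b2 (of_nat n) \<noteq> 0 \<and> \<beta> n = poly b1 (of_nat n) / poly b2 (of_nat n)"
    by (simp only: generic_const_k)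
  have "b1 \<noteq> 0"
  proof
    assume "b1 = 0"
    have "\<forall>\<^sub>F n in sequentially. False"
      using ev eventually_ge_at_top[of 1] by eventually_elim (use \<beta>_nz \<open>b1 = 0\<close> in auto)
    then show False by simp
  qed
  then show thesis using that b ev by blast
qed

lemma rec_eq: "1 / fshift 0 (-1) f - poly_at R var_s - al = A + be / fshift (-1) 0 A"
  using A_nz by (simp add: be_def w_def)

end

section \<open>The functional equation\<close>

text \<open>For the use in \<open>product_form_identity\<close>: \<open>G\<close>,
  \<open>Gs\<close>, \<open>Gu\<close>, \<open>Gd\<close> are \<open>g\<close> at
  \<open>(u, s)\<close>, \<open>(u, s - 1)\<close>, \<open>(u + 1, s)\<close>,
  \<open>(u - 1, s)\<close>; \<open>Cm\<close> and \<open>Ym\<close> are \<open>C\<close> and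
  \<open>Y\<close> at \<open>s - 1\<close>; \<open>p0\<close>, \<open>p1\<close> are
  \<open>P\<close> at \<open>s - u\<close>, \<open>s - u - 1\<close> and \<open>q0\<close>,
  \<open>q1\<close> are \<open>Q\<close> at \<open>s + u\<close>, \<open>s + u - 1\<close>.
  \<open>E1 / E2\<close> is the factor \<open>e(u)\<close> of \<open>A\<close>, and
  \<open>F1 / F2\<close> is \<open>e(u - 1)\<close>.\<close>

lemma clear_denominators:
  fixes Ym Gs G Cm p0 p1 q0 q1 Rr A1 A2 E1 E2 B1 B2 F1 F2 Gu Gd :: "'a :: field"
  assumes nz: "G \<noteq> 0" "Cm \<noteq> 0" "p0 \<noteq> 0" "p1 \<noteq> 0" "q1 \<noteq> 0" "A2 \<noteq> 0" "E2 \<noteq> 0" "B2 \<noteq> 0" "F1 \<noteq> 0" "F2 \<noteq> 0" "Gd \<noteq> 0"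
    and eq: "1 / (G / Gs * (Cm * p1 * q1 / Ym)) - Rr - A1 / A2 = E1 / E2 * Gu * q0 / (G * p1) + (B1 / B2) / (F1 / F2 * G * q1 / (Gd * p0))"
  shows "Cm * ((E1 * A2 * B2 * F1) * Gu * q0 * q1 + (B1 * F2 * A2 * E2) * Gd * p0 * p1
      + ((A2 * E2 * B2 * F1) * Rr + A1 * E2 * B2 * F1) * G * p1 * q1) = (A2 * E2 * B2 * F1) * Gs * Ym"
proof -
  define K where "K = Cm * A2 * E2 * B2 * F1 * G * p1 * q1"
  have 1: "1 / (G / Gs * (Cm * p1 * q1 / Ym)) * K = (A2 * E2 * B2 * F1) * Gs * Ym"
    using nz by (simp add: K_def field_simps)
  have 2: "A1 / A2 * K = Cm * (A1 * E2 * B2 * F1 * G * p1 * q1)"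
    using nz by (simp add: K_def field_simps)
  have 3: "E1 / E2 * Gu * q0 / (G * p1) * K = Cm * ((E1 * A2 * B2 * F1) * Gu * q0 * q1)"
    using nz by (simp add: K_def field_simps)
  have 4: "(B1 / B2) / (F1 / F2 * G * q1 / (Gd * p0)) * K = Cm * ((B1 * F2 * A2 * E2) * Gd * p0 * p1)"
    using nz by (simp add: K_def field_simps)
  have "(1 / (G / Gs * (Cm * p1 * q1 / Ym)) - Rr - A1 / A2) * K
    = (E1 / E2 * Gu * q0 / (G * p1) + (B1 / B2) / (F1 / F2 * G * q1 / (Gd * p0))) * K"
    by (simp only: eq)
  then have "(A2 * E2 * B2 * F1) * Gs * Ym - Rr * K - Cm * (A1 * E2 * B2 * F1 * G * p1 * q1)
     = Cm * ((E1 * A2 * B2 * F1) * Gu * q0 * q1) + Cm * ((B1 * F2 * A2 * E2) * Gd * p0 * p1)"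
    by (simp only: left_diff_distrib distrib_right 1 2 3 4)
  then show ?thesis unfolding K_def by (simp add: algebra_simps)
qed

lemma lift2_diag_nz [simp]:
  assumes "P \<noteq> 0" "c \<noteq> 0"
  shows "lift2 P [:[:a, b:], [:c:]:] \<noteq> 0"
proof
  assume "lift2 P [:[:a, b:], [:c:]:] = 0"
  then have "poly P (a + x * c) = 0" for x
    using eval2_lift2[of P "[:[:a, b:], [:c:]:]" x 0] by (simp add: mult.commute)
  then have "poly P y = 0" for y using assms(2) by (metis add.commute diff_add_cancel nonzero_eq_divide_eq)
  then show False using assms(1) by (metis poly_all_0_iff_0)
qed

lemma var_linear_combination:
  "var_s - var_u + const_rat a = to_fract [:[:a, 1:], [:-1:]:]"
  "var_s + var_u + const_rat a = to_fract [:[:a, 1:], [:1:]:]"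
proof -
  have "[:[:a, 1:], [:-1:]:] = Ss - Us + [:[:a:]:]" "[:[:a, 1:], [:1:]:] = Ss + Us + [:[:a:]:]"
    by (rule bipoly_eqI; simp)+
  then show "var_s - var_u + const_rat a = to_fract [:[:a, 1:], [:-1:]:]"
    "var_s + var_u + const_rat a = to_fract [:[:a, 1:], [:1:]:]"
    by (simp_all only: var_s_def var_u_def const_rat_def to_fract_add to_fract_diff)
qed

context ratio_pair
begin

text \<open>The two non-divisibility clauses record the minimality of \<open>g\<close>. The first
  keeps \<open>g(u, r)\<close> a nonzero polynomial in \<open>u\<close> for every \<open>r\<close>;
  the second will be violated unless \<open>P\<close> vanishes at 0.\<close>

lemma product_form:
  obtains g P Q C Y where "g \<noteq> 0" "lead_coeff P = 1" "lead_coeff Q = 1" "C \<noteq> 0" "Y \<noteq> 0" "coprime C Y"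
    "f = to_fract (shift2 0 1 g) / to_fract g *
       (poly_at C var_s * poly_at P (var_s - var_u) * poly_at Q (var_s + var_u) / poly_at Y var_s)"
    "\<And>r. \<not> [:[:- r, 1:]:] dvd g" "\<And>r. poly P r = 0 \<Longrightarrow> \<not> diag_minus r dvd g"
proof -
  obtain g X Y where "shift_rep f g X Y"
    "\<And>g' X' Y'. shift_rep f g' X' Y' \<Longrightarrow> degree X + degree Y \<le> degree X' + degree Y'"
    "\<And>g' X' Y'. shift_rep f g' X' Y' \<Longrightarrow> degree X' + degree Y' = degree X + degree Y \<Longrightarrow>
       size (prime_factorization g) \<le> size (prime_factorization g')"
    using minimal_shift_rep[OF f_nz] by blast
  then interpret ratio_pair_rep f A al be R a1 a2 b1 b2 g X Y
    by unfold_locales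
  obtain Y0 where Y0: "Y = [:Y0:]" using Y_pure by (metis degree_eq_zeroE)
  obtain P Q C where PQC: "lead_coeff P = 1" "lead_coeff Q = 1" "C \<noteq> 0"
    "X = [:C:] * lift2 P (Ss - Us) * lift2 Q (Ss + Us)"
    using diag_decomposition[OF nz(2) X_primes] by blast
  have Y0nz: "Y0 \<noteq> 0" using nz Y0 by auto
  define d where "d = gcd C Y0"
  have dnz: "d \<noteq> 0" using Y0nz by (simp add: d_def)
  obtain C1 Y1 where CY: "C = C1 * d" "Y0 = Y1 * d" "coprime C1 Y1"
    using gcd_coprime_exists[of C Y0, folded d_def, OF dnz] by blast
  have f_eq: "f = to_fract (shift2 0 1 g) / to_fract g * (to_fract X / to_fract Y)"
  proof -
    have "to_fract (g * Y) \<noteq> 0" using nz by simp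
    moreover have "f * to_fract (g * Y) = to_fract (shift2 0 1 g * X)" using rep by (simp add: shift_rep_def)
    ultimately have "f = to_fract (shift2 0 1 g * X) / to_fract (g * Y)" by (metis nonzero_eq_divide_eq)
    then show ?thesis by simp
  qed
  have "to_fract X / to_fract Y = poly_at C1 var_s * poly_at P (var_s - var_u) * poly_at Q (var_s + var_u) / poly_at Y1 var_s"
  proof -
    have X: "to_fract X = poly_at C1 var_s * poly_at d var_s * poly_at P (var_s - var_u) * poly_at Q (var_s + var_u)"
      unfolding PQC(4) by (simp only: to_fract_mult to_fract_lift2 to_fract_add to_fract_diff
        poly_at_var_s[symmetric] var_u_def[symmetric] CY(1) poly_at_mult) simp
    have Y: "to_fract Y = poly_at Y1 var_s * poly_at d var_s"
      unfolding Y0 by (simp only: poly_at_var_s[symmetric] CY(2) poly_at_mult)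
    have "poly_at d var_s \<noteq> 0" using dnz by (simp add: poly_at_var_s)
    then show ?thesis unfolding X Y by simp
  qed
  then have "f = to_fract (shift2 0 1 g) / to_fract g *
      (poly_at C1 var_s * poly_at P (var_s - var_u) * poly_at Q (var_s + var_u) / poly_at Y1 var_s)"
    using f_eq by simp
  moreover have "\<not> [:[:- r, 1:]:] dvd g" for r
  proof
    assume "[:[:- r, 1:]:] dvd g"
    moreover have "prime_elem [:[:- r, 1:] :: complex poly:]"
      by (simp add: prime_elem_const_poly_iff prime_elem_linear_field_poly)
    ultimately show False by (intro not_pure_s_dvd_g) auto
  qed
  moreover have "\<not> diag_minus r dvd g" if "poly P r = 0" for r
  proof
    assume "diag_minus r dvd g"
    moreover have "diag_minus r dvd X"
    proof -
      have "[:- r, 1:] dvd P" using that by (simp add: poly_eq_0_iff_dvd)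
      then obtain P' where "P = [:- r, 1:] * P'" by (rule dvdE)
      then have "lift2 P (Ss - Us) = lift2 [:- r, 1:] (Ss - Us) * lift2 P' (Ss - Us)" by (simp only: lift2_mult)
      moreover have "lift2 [:- r, 1:] (Ss - Us) = diag_minus r" by (intro bipoly_eqI) simp
      ultimately have "diag_minus r dvd lift2 P (Ss - Us)" by (simp only: dvd_triv_left)
      then show ?thesis unfolding PQC(4) by (simp only: dvd_mult dvd_mult2)
    qed
    ultimately show False using not_dvd_X_g[OF prime_elem_diag(1)] by blast
  qed
  moreover have "C1 \<noteq> 0" "Y1 \<noteq> 0" using CY PQC Y0nz by auto
  ultimately show thesis using PQC CY nz by (intro that[of g P Q C1 Y1])
qed

text \<open>Given \<open>f\<close>, the relation \<open>shift_compatible\<close> determines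
  \<open>A\<close> up to a factor invariant under translation in \<open>s\<close>, which is a
  rational function of \<open>u\<close>. With \<open>A\<close> explicit, clearing denominators in
  the recurrence leaves a polynomial identity, and this forces \<open>C\<close> to be
  constant.\<close>

lemma product_form_identity:
  obtains g P Q \<Delta> E1 E2 E3 B where "g \<noteq> 0" "lead_coeff P = 1" "lead_coeff Q = 1" "\<Delta> \<noteq> 0"
    "E1 \<noteq> 0" "E2 \<noteq> 0" "B \<noteq> 0"
    "f = to_fract (shift2 0 1 g) / to_fract g *
       (poly_at P (var_s - var_u) * poly_at Q (var_s + var_u) / poly_at \<Delta> var_s)"
    "\<And>r. \<not> [:[:- r, 1:]:] dvd g" "\<And>r. poly P r = 0 \<Longrightarrow> \<not> diag_minus r dvd g"
    "\<And>u s. poly E1 u * eval2 g (u + 1) s * poly Q (s + u) * poly Q (s + u - 1)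
       + poly E2 u * eval2 g (u - 1) s * poly P (s - u) * poly P (s - u - 1)
       + (poly B u * poly R s + poly E3 u) * eval2 g u s * poly P (s - u - 1) * poly Q (s + u - 1)
       = poly B u * eval2 g u (s - 1) * poly \<Delta> (s - 1)"
    "A = poly_at E1 var_u / poly_at B var_u * to_fract (shift2 1 0 g) * poly_at Q (var_s + var_u) /
      (to_fract g * poly_at P (var_s - var_u - 1))"
    "al = poly_at E3 var_u / poly_at B var_u"
    "be = poly_at E2 var_u / poly_at B var_u * (poly_at E1 (var_u - 1) / poly_at B (var_u - 1))"
proof -
  obtain g P Q C Y where g: "g \<noteq> 0" and P1: "lead_coeff P = 1" and Q1: "lead_coeff Q = 1" and C: "C \<noteq> 0"
    and Y: "Y \<noteq> 0" and cop: "coprime C Y" and f_eq: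
    "f = to_fract (shift2 0 1 g) / to_fract g *
       (poly_at C var_s * poly_at P (var_s - var_u) * poly_at Q (var_s + var_u) / poly_at Y var_s)"
    and g_s: "\<And>r. \<not> [:[:- r, 1:]:] dvd g" and g_P: "\<And>r. poly P r = 0 \<Longrightarrow> \<not> diag_minus r dvd g"
    by (rule product_form) blast
  have P: "P \<noteq> 0" and Q: "Q \<noteq> 0" using P1 Q1 by auto
  have cm1: "const_rat (-1) = - 1"
  proof -
    have "const_rat (-1) + const_rat 1 = 0" by (simp flip: const_rat_simps)
    then show ?thesis by (simp add: eq_neg_iff_add_eq_0)
  qed
  let ?p0 = "poly_at P (var_s - var_u)" and ?p1 = "poly_at P (var_s - var_u - 1)"
  let ?q0 = "poly_at Q (var_s + var_u)" and ?q1 = "poly_at Q (var_s + var_u - 1)"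
  have nzp: "poly_at P (var_s - var_u + const_rat a) \<noteq> 0" "poly_at Q (var_s + var_u + const_rat a) \<noteq> 0" for a
    unfolding var_linear_combination to_fract_lift2[symmetric] using P Q by simp_all
  have nz: "?p0 \<noteq> 0" "?p1 \<noteq> 0" "?q0 \<noteq> 0" "?q1 \<noteq> 0"
    using nzp[of 0] nzp[of "-1"] by (simp_all add: cm1)
  have nzC: "poly_at C (var_s + const_rat a) \<noteq> 0" "poly_at Y (var_s + const_rat a) \<noteq> 0" for a
  proof -
    have "var_s + const_rat a = to_fract [:[:a, 1:]:]" 
      by (simp add: var_s_def const_rat_def flip: to_fract_add)
    moreover have "pcompose C [:a, 1:] \<noteq> 0" "pcompose Y [:a, 1:] \<noteq> 0" using C Y by (simp_all add: pcompose_eq_0_iff)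
    ultimately show "poly_at C (var_s + const_rat a) \<noteq> 0" "poly_at Y (var_s + const_rat a) \<noteq> 0"
      by (simp_all add: poly_at_to_fract)
  qed
  \<comment> \<open>The quotient of \<open>A\<close> by the evident solution of
    \<open>shift_compatible\<close>.\<close>
  define e where "e = A * to_fract g * ?p1 / (to_fract (shift2 1 0 g) * ?q0)"
  have A_eq: "A = e * to_fract (shift2 1 0 g) * ?q0 / (to_fract g * ?p1)"
    using nz g by (simp add: e_def)
  have "fshift 0 1 e = e"
  proof -
    have "fshift 0 1 A = A * fshift 1 0 f / f" using shift_compatible f_nz by (simp add: field_simps)
    also have "fshift 1 0 f = to_fract (shift2 1 1 g) / to_fract (shift2 1 0 g) *
       (poly_at C var_s * ?p1 * poly_at Q (var_s + var_u + 1) / poly_at Y var_s)"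
      unfolding f_eq by (simp add: algebra_simps)
    finally have A1: "fshift 0 1 A = A * (to_fract (shift2 1 1 g) / to_fract (shift2 1 0 g) *
       (poly_at C var_s * ?p1 * poly_at Q (var_s + var_u + 1) / poly_at Y var_s)) / f" .
    have Q2: "poly_at Q (var_s + var_u + 1) \<noteq> 0" using nzp[of 1] by simp
    have "fshift 0 1 e = fshift 0 1 A * to_fract (shift2 0 1 g) * ?p0 / (to_fract (shift2 1 1 g) * poly_at Q (var_s + var_u + 1))"
      unfolding e_def by (simp add: algebra_simps)
    then show ?thesis
      unfolding A1 e_def f_eq using nz Q2 g nzC[of 0] by (simp add: field_simps)
  qed
  then obtain e1 e2 where e2: "e2 \<noteq> 0" and e: "e = poly_at e1 var_u / poly_at e2 var_u"
    by (rule fshift_s_invariant)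
  have e_nz: "e \<noteq> 0" using A_nz nz g by (simp add: e_def)
  then have e1: "e1 \<noteq> 0" using e by auto
  have unz: "poly_at p (var_u + const_rat a) \<noteq> 0" if "p \<noteq> 0" for p a
  proof -
    have "var_u + const_rat a = to_fract [:[:a:], [:1:]:]"
      by (simp add: var_u_def const_rat_def flip: to_fract_add one_pCons)
    then show ?thesis using lift2_diag_nz[of p 1 a 0] that by (simp add: to_fract_lift2[symmetric])
  qed
  let ?um = "var_u - 1"
  have unz0: "poly_at p var_u \<noteq> 0" "poly_at p ?um \<noteq> 0" if "p \<noteq> 0" for p
    using unz[OF that, of 0] unz[OF that, of "-1"] by (simp_all add: cm1)
  define f1 f2 where "f1 = pcompose e1 [:-1, 1:]" and "f2 = pcompose e2 [:-1, 1:]"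
  have f12: "f1 \<noteq> 0" "f2 \<noteq> 0" using e1 e2 by (simp_all add: f1_def f2_def pcompose_eq_0_iff)
  have um: "poly_at (pcompose p [:-1, 1:]) var_u = poly_at p ?um" for p
  proof (induction p)
    case (pCons a p)
    then show ?case
      by (simp only: pcompose_pCons poly_at_add poly_at_mult poly_at_pCons poly_at_0 cm1 const_rat_simps)
        (simp add: algebra_simps)
  qed simp
  \<comment> \<open>Over the common denominator \<open>B\<close> of the coefficients,
    \<open>E1 / B = e(u)\<close>, \<open>E3 / B = al\<close> and
    \<open>E2 / B = be / e(u - 1)\<close>.\<close>
  define E1 E2 E3 B where "E1 = e1 * a2 * b2 * f1" and "E2 = b1 * f2 * a2 * e2"
    and "E3 = a1 * e2 * b2 * f1" and "B = a2 * e2 * b2 * f1"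
  have E_nz: "E1 \<noteq> 0" "E2 \<noteq> 0" "B \<noteq> 0"
    using e1 e2 f12 al(2) be(2,3) by (simp_all add: E1_def E2_def B_def)
  have id0: "poly_at C (var_s - 1) * (poly_at E1 var_u * to_fract (shift2 1 0 g) * ?q0 * ?q1
      + poly_at E2 var_u * to_fract (shift2 (-1) 0 g) * ?p0 * ?p1
      + (poly_at B var_u * poly_at R var_s + poly_at E3 var_u) * to_fract g * ?p1 * ?q1)
    = poly_at B var_u * to_fract (shift2 0 (-1) g) * poly_at Y (var_s - 1)"
    unfolding E1_def E2_def E3_def B_def poly_at_mult
  proof (rule clear_denominators)
    show "poly_at C (var_s - 1) \<noteq> 0" using nzC[of "-1"] by (simp add: cm1)
    have 1: "fshift 0 (-1) f = to_fract g / to_fract (shift2 0 (-1) g) *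
       (poly_at C (var_s - 1) * ?p1 * ?q1 / poly_at Y (var_s - 1))"
      unfolding f_eq by (simp add: cm1 algebra_simps)
    have 2: "fshift (-1) 0 A = poly_at f1 var_u / poly_at f2 var_u * to_fract g * ?q1 / (to_fract (shift2 (-1) 0 g) * ?p0)"
      unfolding A_eq e f1_def f2_def um by (simp add: cm1 algebra_simps)
    show "1 / (to_fract g / to_fract (shift2 0 (-1) g) * (poly_at C (var_s - 1) * ?p1 * ?q1 / poly_at Y (var_s - 1))) -
        poly_at R var_s - poly_at a1 var_u / poly_at a2 var_u =
        poly_at e1 var_u / poly_at e2 var_u * to_fract (shift2 1 0 g) * ?q0 / (to_fract g * ?p1) +
        poly_at b1 var_u / poly_at b2 var_u / (poly_at f1 var_u / poly_at f2 var_u * to_fract g * ?q1 / (to_fract (shift2 (-1) 0 g) * ?p0))"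
      using rec unfolding 1 2 al(1) be(1) unfolding A_eq e .
  qed (use g nz al(2) be(3) e2 f12 unz0 in auto)
  have us: "var_s - var_u = to_fract (Ss - Us)" "var_s + var_u = to_fract (Ss + Us)"
    "var_s - var_u - 1 = to_fract (Ss - Us - 1)" "var_s + var_u - 1 = to_fract (Ss + Us - 1)"
    "var_s - 1 = to_fract (Ss - 1)"
    by (simp_all add: var_s_def var_u_def del: diff_pCons add_pCons)
  have id1: "lift2 C (Ss - 1) * (lift2 E1 Us * shift2 1 0 g * lift2 Q (Ss + Us) * lift2 Q (Ss + Us - 1)
      + lift2 E2 Us * shift2 (-1) 0 g * lift2 P (Ss - Us) * lift2 P (Ss - Us - 1)
      + (lift2 B Us * lift2 R Ss + lift2 E3 Us) * g * lift2 P (Ss - Us - 1) * lift2 Q (Ss + Us - 1))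
    = lift2 B Us * shift2 0 (-1) g * lift2 Y (Ss - 1)"
    using id0 unfolding us(3,4,5) unfolding us(1,2) unfolding var_u_def var_s_def to_fract_lift2[symmetric]
    by (simp only: to_fract_mult[symmetric] to_fract_add[symmetric] to_fract_eq_iff)
  have id2: "poly C (s - 1) * (poly E1 u * eval2 g (u + 1) s * poly Q (s + u) * poly Q (s + u - 1)
       + poly E2 u * eval2 g (u - 1) s * poly P (s - u) * poly P (s - u - 1)
       + (poly B u * poly R s + poly E3 u) * eval2 g u s * poly P (s - u - 1) * poly Q (s + u - 1))
       = poly B u * eval2 g u (s - 1) * poly Y (s - 1)" for u s
    using arg_cong[OF id1, of "\<lambda>F. eval2 F u s"] by (simp add: algebra_simps)
  \<comment> \<open>At \<open>s = r + 1\<close>, with \<open>r\<close> a root of \<open>C\<close>,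
    the left side of \<open>id2\<close> vanishes for all \<open>u\<close>, whereas
    \<open>B(u) * g(u, r)\<close> does not. So \<open>r\<close> would be a root of \<open>Y\<close>
    as well.\<close>
  have "degree C = 0"
  proof (rule ccontr)
    assume "degree C \<noteq> 0"
    then obtain r where r: "poly C r = 0"
      by (metis fundamental_theorem_of_algebra constant_degree)
    have "map_poly (\<lambda>c. poly c r) g \<noteq> 0" using g_s eval2_at_s_zero by blast
    then have "B * map_poly (\<lambda>c. poly c r) g \<noteq> 0" using E_nz by simp
    then obtain u where "poly (B * map_poly (\<lambda>c. poly c r) g) u \<noteq> 0" by (metis poly_all_0_iff_0)
    then have "poly Y r = 0" using id2[of "r + 1" u] r by (simp add: eval2_conv_map_poly)
    then have "[:- r, 1:] dvd C" "[:- r, 1:] dvd Y" using r by (simp_all add: poly_eq_0_iff_dvd)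
    then have "[:- r, 1:] dvd 1" using cop by (meson coprime_common_divisor)
    then show False by (auto dest: dvd_imp_degree_le)
  qed
  then obtain k where k: "C = [:k:]" by (metis degree_eq_zeroE)
  have knz: "k \<noteq> 0" using C k by auto
  define \<Delta> where "\<Delta> = smult (1 / k) Y"
  have "const_rat k * const_rat (1 / k) = 1" using knz by (simp flip: const_rat_simps)
  then have ck: "const_rat (1 / k) = 1 / const_rat k" by (metis nonzero_eq_divide_eq mult.commute mult_zero_left zero_neq_one)
  show thesis
  proof (rule that[of g P Q \<Delta> E1 E2 B E3])
    show "\<Delta> \<noteq> 0" using Y knz by (simp add: \<Delta>_def)
    show "f = to_fract (shift2 0 1 g) / to_fract g *
       (?p0 * ?q0 / poly_at \<Delta> var_s)"
      unfolding f_eq by (simp add: \<Delta>_def k ck)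
    show "poly E1 u * eval2 g (u + 1) s * poly Q (s + u) * poly Q (s + u - 1)
       + poly E2 u * eval2 g (u - 1) s * poly P (s - u) * poly P (s - u - 1)
       + (poly B u * poly R s + poly E3 u) * eval2 g u s * poly P (s - u - 1) * poly Q (s + u - 1)
       = poly B u * eval2 g u (s - 1) * poly \<Delta> (s - 1)" for u s
      using id2[of s u] knz by (simp add: k \<Delta>_def field_simps)
    have "poly_at E1 var_u / poly_at B var_u = e"
      using al(2) be(3) f12 unz0 by (simp add: E1_def B_def e)
    then show "A = poly_at E1 var_u / poly_at B var_u * to_fract (shift2 1 0 g) * ?q0 / (to_fract g * ?p1)"
      using A_eq by simp
    show "al = poly_at E3 var_u / poly_at B var_u"
      using al be(3) f12 e2 unz0 by (simp add: E3_def B_def)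
    have "poly_at E1 ?um / poly_at B ?um = poly_at e1 ?um / poly_at e2 ?um"
      using al(2) be(3) f12 unz0 by (simp add: E1_def B_def)
    also have "\<dots> = poly_at f1 var_u / poly_at f2 var_u" by (simp add: f1_def f2_def um)
    finally show "be = poly_at E2 var_u / poly_at B var_u * (poly_at E1 ?um / poly_at B ?um)"
      using al(2) be f12 e2 unz0 by (simp add: E2_def B_def)
  qed (use g P1 Q1 E_nz g_s g_P in auto)
qed

end

section \<open>An explicit solution of the recurrence\<close>

lemma eventually_all_ge:
  assumes "\<forall>\<^sub>F n in sequentially. P n"
  obtains n0 :: nat where "\<And>n. n \<ge> n0 \<Longrightarrow> P n"
  using assms by (auto simp: eventually_sequentially)

lemma prod_Suc_shift:
  fixes h :: "complex \<Rightarrow> complex"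
  shows "(\<Prod>j<Suc k. h (of_nat j + x)) = h x * (\<Prod>j<k. h (of_nat j + (x + 1)))"
  by (subst prod.lessThan_Suc_shift) (simp add: algebra_simps)

text \<open>The identity says that \<open>H\<close> below solves the three-term recurrence of \<open>c\<close>.  Both have the same ratios
  in each direction, so \<open>c\<close> is a multiple of \<open>H\<close>, and \<open>c n n = 1\<close>, \<open>c n (n + 1) = 0\<close> will force
  \<open>poly P 0 = 0\<close>.\<close>

locale explicit_solution =
  fixes g :: bipoly and P Q \<Delta> E1 E2 E3 B R :: "complex poly" and n0 :: nat
  assumes identity: "poly E1 u * eval2 g (u + 1) s * poly Q (s + u) * poly Q (s + u - 1)
       + poly E2 u * eval2 g (u - 1) s * poly P (s - u) * poly P (s - u - 1)
       + (poly B u * poly R s + poly E3 u) * eval2 g u s * poly P (s - u - 1) * poly Q (s + u - 1)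
       = poly B u * eval2 g u (s - 1) * poly \<Delta> (s - 1)"
    and large: "n \<ge> n0 \<Longrightarrow> poly E1 (of_nat n) \<noteq> 0 \<and> poly B (of_nat n) \<noteq> 0 \<and>
       poly Q (of_nat n) \<noteq> 0 \<and> poly P (- of_nat n) \<noteq> 0"
    and \<Delta>0: "poly \<Delta> (-1) = 0" and \<Delta>_nz: "poly \<Delta> (of_nat k) \<noteq> 0"
begin

definition e :: "nat \<Rightarrow> complex" where "e n = poly E1 (of_nat n) / poly B (of_nat n)"
text \<open>The factor independent of \<open>k\<close>, chosen so that the ratio of \<open>H\<close>
  in the direction of \<open>n\<close> is \<open>A\<close>. The product starts at \<open>n0\<close>,
  beyond which its denominators are nonzero.\<close>

definition \<kappa> :: "nat \<Rightarrow> complex" where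
  "\<kappa> n = (\<Prod>i\<in>{n0..<n}. e i * poly Q (of_nat i) / poly P (- of_nat (Suc i)))"
definition PP :: "nat \<Rightarrow> nat \<Rightarrow> complex" where "PP n k = (\<Prod>j<k. poly P (of_nat j + - of_nat n))"
definition QQ :: "nat \<Rightarrow> nat \<Rightarrow> complex" where "QQ n k = (\<Prod>j<k. poly Q (of_nat j + of_nat n))"
definition DD :: "nat \<Rightarrow> complex" where "DD k = (\<Prod>j<k. poly \<Delta> (of_nat j))"
definition H :: "nat \<Rightarrow> nat \<Rightarrow> complex" where
  "H n k = \<kappa> n * eval2 g (of_nat n) (of_nat k) * PP n k * QQ n k / DD k"

lemma e_nz: "n \<ge> n0 \<Longrightarrow> e n \<noteq> 0"
  using large[of n] by (simp add: e_def)

lemma \<kappa>_Suc: "n \<ge> n0 \<Longrightarrow> \<kappa> (Suc n) * poly P (- of_nat (Suc n)) = \<kappa> n * e n * poly Q (of_nat n)"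
  using large[of "Suc n"] by (simp add: \<kappa>_def field_simps)

lemma \<kappa>_nz: "\<kappa> n \<noteq> 0"
  unfolding \<kappa>_def using large e_nz by (auto simp: prod_zero_iff)
    (metis le_SucI of_nat_Suc minus_add_distrib diff_conv_add_uminus)

lemma DD_nz: "DD k \<noteq> 0"
  unfolding DD_def using \<Delta>_nz by simp

lemma PP_Suc: "PP n (Suc k) = PP n k * poly P (of_nat k - of_nat n)"
  "PP (Suc n) (Suc k) = poly P (- of_nat (Suc n)) * PP n k"
  using prod_Suc_shift[of "poly P" "- of_nat (Suc n)" k] by (simp_all add: PP_def algebra_simps)

lemma QQ_Suc: "QQ n (Suc k) = QQ n k * poly Q (of_nat k + of_nat n)"
  "QQ n (Suc k) = poly Q (of_nat n) * QQ (Suc n) k"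
  using prod_Suc_shift[of "poly Q" "of_nat n" k] by (simp_all add: QQ_def algebra_simps)

lemma DD_Suc: "DD (Suc k) = DD k * poly \<Delta> (of_nat k)"
  by (simp add: DD_def)

text \<open>Multiplied out, because \<open>g\<close> may vanish at some lattice points.\<close>

lemma H_Suc_k: "H n (Suc k) * (eval2 g (of_nat n) (of_nat k) * poly \<Delta> (of_nat k))
    = H n k * (eval2 g (of_nat n) (of_nat (Suc k)) * poly P (of_nat k - of_nat n) * poly Q (of_nat k + of_nat n))"
  using DD_nz[of k] \<Delta>_nz[of k] unfolding H_def PP_Suc(1) QQ_Suc(1) DD_Suc by (simp add: field_simps)

lemma H_Suc_n:
  assumes n: "n \<ge> n0"
  shows "H (Suc n) k * (eval2 g (of_nat n) (of_nat k) * poly P (of_nat k - of_nat (Suc n)))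
    = H n k * (e n * eval2 g (of_nat (Suc n)) (of_nat k) * poly Q (of_nat k + of_nat n))"
proof -
  have p: "PP (Suc n) k * poly P (of_nat k - of_nat (Suc n)) = poly P (- of_nat (Suc n)) * PP n k"
    using PP_Suc(1)[of "Suc n" k] PP_Suc(2)[of n k] by simp
  have q: "poly Q (of_nat n) * QQ (Suc n) k = QQ n k * poly Q (of_nat k + of_nat n)"
    using QQ_Suc[of n k] by simp
  have "H (Suc n) k * (eval2 g (of_nat n) (of_nat k) * poly P (of_nat k - of_nat (Suc n))) =
    \<kappa> (Suc n) * eval2 g (of_nat (Suc n)) (of_nat k) * (PP (Suc n) k * poly P (of_nat k - of_nat (Suc n)))
      * QQ (Suc n) k * eval2 g (of_nat n) (of_nat k) / DD k"
    by (simp add: H_def)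
  also have "\<dots> = (\<kappa> (Suc n) * poly P (- of_nat (Suc n))) * eval2 g (of_nat (Suc n)) (of_nat k) * PP n k
      * QQ (Suc n) k * eval2 g (of_nat n) (of_nat k) / DD k"
    unfolding p by simp
  also have "\<dots> = \<kappa> n * e n * eval2 g (of_nat (Suc n)) (of_nat k) * PP n k
      * (poly Q (of_nat n) * QQ (Suc n) k) * eval2 g (of_nat n) (of_nat k) / DD k"
    unfolding \<kappa>_Suc[OF n] by simp
  also have "\<dots> = H n k * (e n * eval2 g (of_nat (Suc n)) (of_nat k) * poly Q (of_nat k + of_nat n))"
    unfolding q by (simp add: H_def)
  finally show ?thesis .
qed

text \<open>All entries in the first equation are multiples of one quantity \<open>T\<close>, and
  what remains is \<open>identity\<close> at \<open>u = n + 1\<close>, \<open>s = k + 1\<close>. In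
  the second equation, at \<open>s = 0\<close>, the entry in column -1 is absent because
  \<open>poly \<Delta> (-1) = 0\<close>.\<close>

lemma H_recurrence:
  assumes n: "n \<ge> n0" and \<alpha>: "\<alpha> = poly E3 (of_nat (Suc n)) / poly B (of_nat (Suc n))"
    and \<beta>: "\<beta> = poly E2 (of_nat (Suc n)) / poly B (of_nat (Suc n)) * e n"
  shows "H (Suc n) k - (poly R (of_nat (Suc k)) + \<alpha>) * H (Suc n) (Suc k)
      = H (Suc (Suc n)) (Suc k) + \<beta> * H n (Suc k)"
    "- (poly R 0 + \<alpha>) * H (Suc n) 0 = H (Suc (Suc n)) 0 + \<beta> * H n 0"
proof -
  let ?N = "of_nat (Suc n) :: complex" and ?K = "of_nat (Suc k) :: complex"
  have nz: "poly B ?N \<noteq> 0" "poly E1 ?N \<noteq> 0" "poly Q ?N \<noteq> 0" "poly P (- ?N) \<noteq> 0"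
    "poly Q (of_nat n) \<noteq> 0" "poly P (- of_nat (Suc (Suc n))) \<noteq> 0" "e n \<noteq> 0"
    using large[of n] large[of "Suc n"] large[of "Suc (Suc n)"] n e_nz[OF n] by auto
  have k1: "\<kappa> (Suc (Suc n)) * poly P (- of_nat (Suc (Suc n))) = \<kappa> (Suc n) * e (Suc n) * poly Q ?N"
    using \<kappa>_Suc[of "Suc n"] n by simp
  have k0: "\<kappa> n * e n * poly Q (of_nat n) = \<kappa> (Suc n) * poly P (- ?N)"
    using \<kappa>_Suc[of n] n by simp
  have eB: "poly E1 ?N = e (Suc n) * poly B ?N" "poly E2 ?N * e n = \<beta> * poly B ?N" "poly E3 ?N = \<alpha> * poly B ?N"
    using nz by (simp_all add: e_def \<alpha> \<beta>)
  have arg: "?N + 1 = of_nat (Suc (Suc n))" "?N - 1 = of_nat n" "?K - 1 = of_nat k" 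
    "?K + ?N - 1 = of_nat k + ?N" "?K - ?N - 1 = of_nat k - ?N"
    by simp_all
  note id = identity[of ?N ?K, unfolded arg eB]
  define T where "T = \<kappa> (Suc n) * PP (Suc n) k * QQ (Suc n) k / DD (Suc k)"
  have DDS: "DD (Suc k) \<noteq> 0" by (rule DD_nz)
  have h1: "H (Suc n) k = T * (eval2 g ?N (of_nat k) * poly \<Delta> (of_nat k))"
    using \<Delta>_nz[of k] DD_nz[of k] by (simp add: H_def T_def DD_Suc)
  have h2: "H (Suc n) (Suc k) = T * (eval2 g ?N ?K * poly P (of_nat k - ?N) * poly Q (of_nat k + ?N))"
    by (simp add: H_def T_def PP_Suc(1) QQ_Suc(1) mult_ac)
  have h3: "H (Suc (Suc n)) (Suc k) = T * (e (Suc n) * eval2 g (of_nat (Suc (Suc n))) ?K * poly Q (?K + ?N) * poly Q (of_nat k + ?N))"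
  proof -
    have q: "QQ (Suc (Suc n)) (Suc k) * poly Q ?N = QQ (Suc n) k * poly Q (of_nat k + ?N) * poly Q (?K + ?N)"
      using QQ_Suc[of "Suc n" "Suc k"] QQ_Suc(1)[of "Suc n" k] by (simp add: mult_ac)
    have "H (Suc (Suc n)) (Suc k) = (\<kappa> (Suc (Suc n)) * poly P (- of_nat (Suc (Suc n)))) * eval2 g (of_nat (Suc (Suc n))) ?K
      * PP (Suc n) k * QQ (Suc (Suc n)) (Suc k) / DD (Suc k)"
      by (simp only: H_def PP_Suc(2) mult_ac)
    also have "\<dots> = \<kappa> (Suc n) * e (Suc n) * eval2 g (of_nat (Suc (Suc n))) ?K
      * PP (Suc n) k * (QQ (Suc (Suc n)) (Suc k) * poly Q ?N) / DD (Suc k)"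
      unfolding k1 by (simp only: mult_ac)
    also have "\<dots> = T * (e (Suc n) * eval2 g (of_nat (Suc (Suc n))) ?K * poly Q (?K + ?N) * poly Q (of_nat k + ?N))"
      unfolding q T_def by (simp add: mult_ac)
    finally show ?thesis .
  qed
  have h4: "e n * H n (Suc k) = T * (eval2 g (of_nat n) ?K * poly P (?K - ?N) * poly P (of_nat k - ?N))"
  proof -
    have p: "poly P (- ?N) * PP n (Suc k) = PP (Suc n) k * poly P (of_nat k - ?N) * poly P (?K - ?N)"
      using PP_Suc(2)[of n "Suc k"] PP_Suc(1)[of "Suc n" "Suc k"] PP_Suc(1)[of "Suc n" k] by simp
    have "e n * H n (Suc k) = (\<kappa> n * e n * poly Q (of_nat n)) * eval2 g (of_nat n) ?K * PP n (Suc k) * QQ (Suc n) k / DD (Suc k)"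
      unfolding H_def QQ_Suc(2)[of n k] by (simp only: mult_ac times_divide_eq_right)
    also have "\<dots> = \<kappa> (Suc n) * eval2 g (of_nat n) ?K * (poly P (- ?N) * PP n (Suc k)) * QQ (Suc n) k / DD (Suc k)"
      unfolding k0 by (simp only: mult_ac)
    also have "\<dots> = T * (eval2 g (of_nat n) ?K * poly P (?K - ?N) * poly P (of_nat k - ?N))"
      unfolding p T_def by (simp add: mult_ac)
    finally show ?thesis .
  qed
  \<comment> \<open>This nonzero factor turns the quotients \<open>\<alpha>\<close> and
    \<open>\<beta>\<close> into the polynomial coefficients of \<open>identity\<close>.\<close>
  have "poly B ?N * e n * (H (Suc (Suc n)) (Suc k) + \<beta> * H n (Suc k) + (poly R ?K + \<alpha>) * H (Suc n) (Suc k))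
    = poly B ?N * e n * H (Suc n) k"
  proof -
    have "poly B ?N * e n * (H (Suc (Suc n)) (Suc k) + \<beta> * H n (Suc k) + (poly R ?K + \<alpha>) * H (Suc n) (Suc k))
      = e n * (e (Suc n) * poly B ?N * (H (Suc (Suc n)) (Suc k) / e (Suc n))) + (\<beta> * poly B ?N) * (e n * H n (Suc k)) 
        + e n * (poly B ?N * poly R ?K + \<alpha> * poly B ?N) * H (Suc n) (Suc k)"
      using e_nz[of "Suc n"] n by (simp add: algebra_simps)
    also have "H (Suc (Suc n)) (Suc k) / e (Suc n) = T * (eval2 g (of_nat (Suc (Suc n))) ?K * poly Q (?K + ?N) * poly Q (of_nat k + ?N))"
      using e_nz[of "Suc n"] n unfolding h3 by simp
    also have "e n * (e (Suc n) * poly B ?N * (T * (eval2 g (of_nat (Suc (Suc n))) ?K * poly Q (?K + ?N) * poly Q (of_nat k + ?N))))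
        + (\<beta> * poly B ?N) * (e n * H n (Suc k)) + e n * (poly B ?N * poly R ?K + \<alpha> * poly B ?N) * H (Suc n) (Suc k)
      = T * (e n * (e (Suc n) * poly B ?N * eval2 g (of_nat (Suc (Suc n))) ?K * poly Q (?K + ?N) * poly Q (of_nat k + ?N)
          + (poly B ?N * poly R ?K + \<alpha> * poly B ?N) * eval2 g ?N ?K * poly P (of_nat k - ?N) * poly Q (of_nat k + ?N))
          + (poly E2 ?N * e n) * eval2 g (of_nat n) ?K * poly P (?K - ?N) * poly P (of_nat k - ?N))"
      unfolding h2 h4 eB(2) by (simp add: algebra_simps)
    also have "\<dots> = T * e n * (e (Suc n) * poly B ?N * eval2 g (of_nat (Suc (Suc n))) ?K * poly Q (?K + ?N) * poly Q (of_nat k + ?N)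
          + poly E2 ?N * eval2 g (of_nat n) ?K * poly P (?K - ?N) * poly P (of_nat k - ?N)
          + (poly B ?N * poly R ?K + \<alpha> * poly B ?N) * eval2 g ?N ?K * poly P (of_nat k - ?N) * poly Q (of_nat k + ?N))"
      by (simp only: algebra_simps)
    also have "\<dots> = T * e n * (poly B ?N * eval2 g ?N (of_nat k) * poly \<Delta> (of_nat k))"
      by (simp only: id)
    also have "\<dots> = poly B ?N * e n * H (Suc n) k" unfolding h1 by (simp only: mult_ac)
    finally show ?thesis .
  qed
  then have "H (Suc (Suc n)) (Suc k) + \<beta> * H n (Suc k) + (poly R ?K + \<alpha>) * H (Suc n) (Suc k) = H (Suc n) k"
    using nz by simp
  then show "H (Suc n) k - (poly R (of_nat (Suc k)) + \<alpha>) * H (Suc n) (Suc k)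
      = H (Suc (Suc n)) (Suc k) + \<beta> * H n (Suc k)" by (simp add: algebra_simps)
  have H0: "H m 0 = \<kappa> m * eval2 g (of_nat m) 0" for m by (simp add: H_def PP_def QQ_def DD_def)
  have arg0: "0 + ?N = ?N" "0 + ?N - 1 = of_nat n" "0 - ?N = - ?N" "0 - ?N - 1 = - of_nat (Suc (Suc n))" "0 - 1 = (-1::complex)"
    by simp_all
  have id0: "e (Suc n) * poly B ?N * eval2 g (of_nat (Suc (Suc n))) 0 * poly Q ?N * poly Q (of_nat n)
      + poly E2 ?N * eval2 g (of_nat n) 0 * poly P (- ?N) * poly P (- of_nat (Suc (Suc n)))
      + (poly B ?N * poly R 0 + \<alpha> * poly B ?N) * eval2 g ?N 0 * poly P (- of_nat (Suc (Suc n))) * poly Q (of_nat n) = 0"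
    using identity[of ?N 0, unfolded arg0 arg(1,2) eB(1,3) \<Delta>0] by simp
  have "poly B ?N * e n * poly Q (of_nat n) * poly P (- of_nat (Suc (Suc n))) *
      (H (Suc (Suc n)) 0 + \<beta> * H n 0 + (poly R 0 + \<alpha>) * H (Suc n) 0) =
    e n * poly B ?N * poly Q (of_nat n) * (\<kappa> (Suc (Suc n)) * poly P (- of_nat (Suc (Suc n)))) * eval2 g (of_nat (Suc (Suc n))) 0
    + (\<beta> * poly B ?N) * poly P (- of_nat (Suc (Suc n))) * (\<kappa> n * e n * poly Q (of_nat n)) * eval2 g (of_nat n) 0
    + e n * poly Q (of_nat n) * poly P (- of_nat (Suc (Suc n))) * (poly B ?N * poly R 0 + \<alpha> * poly B ?N) * \<kappa> (Suc n) * eval2 g ?N 0"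
    unfolding H0 by (simp only: algebra_simps)
  also have "\<dots> = e n * \<kappa> (Suc n) * (e (Suc n) * poly B ?N * eval2 g (of_nat (Suc (Suc n))) 0 * poly Q ?N * poly Q (of_nat n)
      + poly E2 ?N * eval2 g (of_nat n) 0 * poly P (- ?N) * poly P (- of_nat (Suc (Suc n)))
      + (poly B ?N * poly R 0 + \<alpha> * poly B ?N) * eval2 g ?N 0 * poly P (- of_nat (Suc (Suc n))) * poly Q (of_nat n))"
    unfolding k1 k0 eB(2)[symmetric] by (simp only: algebra_simps)
  also have "\<dots> = 0" unfolding id0 by simp
  finally have "H (Suc (Suc n)) 0 + \<beta> * H n 0 + (poly R 0 + \<alpha>) * H (Suc n) 0 = 0"
    using nz by simp
  then show "- (poly R 0 + \<alpha>) * H (Suc n) 0 = H (Suc (Suc n)) 0 + \<beta> * H n 0"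
    by (simp only: mult_minus_left flip: eq_neg_iff_add_eq_0)
qed

end

lemma lift_zero_on_line:
  fixes g :: bipoly
  assumes "\<And>n. n \<ge> n0 \<Longrightarrow> eval2 g (of_nat n) (of_nat n + y) = 0"
  shows "diag_minus y dvd g"
proof -
  define p where "p = pcompose (poly g [:- y, 1:]) [:y, 1:]"
  have "poly p x = eval2 g x (x + y)" for x
    using eval2_on_diag[of g "x + y" y] by (simp add: p_def poly_pcompose add.commute)
  then have "\<exists>n\<ge>m. poly p (of_nat n) = 0" for m
    using assms[of "max m n0"] by (intro exI[of _ "max m n0"]) simp
  then have "p = 0" by (rule frequently_zero_poly)
  then show ?thesis by (simp add: diag_minus_dvd_iff p_def pcompose_eq_0_iff)
qed

lemma shift_line_nonzero:
  fixes P :: "complex poly"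
  assumes "P \<noteq> 0" "c \<noteq> 0"
  shows "\<forall>\<^sub>F n in sequentially. poly P (a + c * of_nat n) \<noteq> 0"
  using eventually_poly_nonzero[of "pcompose P [:a, c:]"] assms
  by (simp add: pcompose_eq_0_iff poly_pcompose mult.commute)

context hg_orth_rat
begin

text \<open>Proportionality of \<open>c\<close> and \<open>H\<close> is first found in one column
  for large \<open>n\<close>, then carried to every column for large \<open>n\<close>, and finally
  down to a bound \<open>n0\<close> common to all columns. Only the last form reaches the
  diagonal.\<close>

lemma canonical_form:
  obtains g P Q \<Delta> E1 E2 E3 B where "g \<noteq> 0" "lead_coeff P = 1" "lead_coeff Q = 1" "\<Delta> \<noteq> 0"
    "E1 \<noteq> 0" "E2 \<noteq> 0" "B \<noteq> 0"
    "f = to_fract (shift2 0 1 g) / to_fract g *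
       (poly_at P (var_s - var_u) * poly_at Q (var_s + var_u) / poly_at \<Delta> var_s)"
    "\<And>u s. poly E1 u * eval2 g (u + 1) s * poly Q (s + u) * poly Q (s + u - 1)
       + poly E2 u * eval2 g (u - 1) s * poly P (s - u) * poly P (s - u - 1)
       + (poly B u * poly R s + poly E3 u) * eval2 g u s * poly P (s - u - 1) * poly Q (s + u - 1)
       = poly B u * eval2 g u (s - 1) * poly \<Delta> (s - 1)"
    "poly P 0 = 0" "poly \<Delta> (-1) = 0"
proof -
  obtain b1 b2 where b: "b1 \<noteq> 0" "b2 \<noteq> 0" "be = poly_at b1 var_u / poly_at b2 var_u" by (rule be_rational)
  interpret rp: ratio_pair f A al be R a1 a2 b1 b2
    by unfold_locales (use f_nz A_nz shift_compatible rec_eq al_def a2 b in auto)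
  obtain g P Q \<Delta> E1 E2 E3 B where g: "g \<noteq> 0" and P1: "lead_coeff P = 1" and Q1: "lead_coeff Q = 1" and \<Delta>: "\<Delta> \<noteq> 0"
    and E: "E1 \<noteq> 0" "E2 \<noteq> 0" "B \<noteq> 0" and
    f_eq: "f = to_fract (shift2 0 1 g) / to_fract g *
       (poly_at P (var_s - var_u) * poly_at Q (var_s + var_u) / poly_at \<Delta> var_s)" and
    g_s: "\<And>r. \<not> [:[:- r, 1:]:] dvd g" and g_P: "\<And>r. poly P r = 0 \<Longrightarrow> \<not> diag_minus r dvd g" and
    identity: "\<And>u s. poly E1 u * eval2 g (u + 1) s * poly Q (s + u) * poly Q (s + u - 1)
       + poly E2 u * eval2 g (u - 1) s * poly P (s - u) * poly P (s - u - 1)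
       + (poly B u * poly R s + poly E3 u) * eval2 g u s * poly P (s - u - 1) * poly Q (s + u - 1)
       = poly B u * eval2 g u (s - 1) * poly \<Delta> (s - 1)" and
    A_eq: "A = poly_at E1 var_u / poly_at B var_u * to_fract (shift2 1 0 g) * poly_at Q (var_s + var_u) /
      (to_fract g * poly_at P (var_s - var_u - 1))" and
    al_eq: "al = poly_at E3 var_u / poly_at B var_u" and
    be_eq: "be = poly_at E2 var_u / poly_at B var_u * (poly_at E1 (var_u - 1) / poly_at B (var_u - 1))"
    by (rule rp.product_form_identity) blast
  have P: "P \<noteq> 0" and Q: "Q \<noteq> 0" using P1 Q1 by auto

  have star: "eval2 N u s * eval2 g u s * poly \<Delta> s = eval2 D u s * eval2 g u (s + 1) * poly P (s - u) * poly Q (s + u)" for u s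
  proof -
    have d: "var_s - var_u = to_fract (Ss - Us)" "var_s + var_u = to_fract (Ss + Us)"
      by (simp_all only: var_s_def var_u_def to_fract_add to_fract_diff)
    have nz: "to_fract g \<noteq> 0" "to_fract D \<noteq> 0" "to_fract (lift2 \<Delta> Ss) \<noteq> 0"
      using g D_nz \<Delta> by (simp_all add: lift2_Ss)
    have "to_fract N / to_fract D = to_fract (shift2 0 1 g) / to_fract g *
       (to_fract (lift2 P (Ss - Us)) * to_fract (lift2 Q (Ss + Us)) / to_fract (lift2 \<Delta> Ss))"
      using f_eq unfolding f_def d unfolding var_s_def to_fract_lift2[symmetric] .
    then have "to_fract N * to_fract g * to_fract (lift2 \<Delta> Ss) =
      to_fract D * to_fract (shift2 0 1 g) * to_fract (lift2 P (Ss - Us)) * to_fract (lift2 Q (Ss + Us))"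
      using nz by (simp add: divide_simps mult_ac)
    then have "N * g * lift2 \<Delta> Ss = D * shift2 0 1 g * lift2 P (Ss - Us) * lift2 Q (Ss + Us)"
      by (simp only: to_fract_mult[symmetric] to_fract_eq_iff)
    from arg_cong[OF this, of "\<lambda>F. eval2 F u s"] show ?thesis by simp
  qed
  have g_col: "\<forall>\<^sub>F n in sequentially. eval2 g (of_nat n) b \<noteq> 0" for b
    using eventually_eval2_nonzero[of b g] eval2_at_s_zero[of b g] g_s[of b] by blast
  have P_col: "\<forall>\<^sub>F n in sequentially. poly P (a - of_nat n) \<noteq> 0" for a
    using shift_line_nonzero[OF P, of "-1" a] by simp
  have Q_col: "\<forall>\<^sub>F n in sequentially. poly Q (a + of_nat n) \<noteq> 0" for a
    using shift_line_nonzero[OF Q, of 1 a] by simp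
  \<comment> \<open>At \<open>s = k\<close> a zero of \<open>\<Delta>\<close> would annihilate the
    right side of \<open>star\<close>, none of whose factors vanishes for large
    \<open>n\<close>.\<close>
  have \<Delta>_nz: "poly \<Delta> (of_nat k) \<noteq> 0" for k
  proof
    assume z: "poly \<Delta> (of_nat k) = 0"
    have "\<forall>\<^sub>F n in sequentially. False"
      using eventually_ratio[of k] g_col[of "of_nat k + 1"] P_col[of "of_nat k"] Q_col[of "of_nat k"]
    proof eventually_elim
      case (elim n)
      then show False using star[of "of_nat n" "of_nat k"] z by simp
    qed
    then show False by simp
  qed
  \<comment> \<open>On the line \<open>s = -1\<close> the polynomial \<open>D\<close> vanishes while
    \<open>N\<close> and \<open>g\<close> do not, so \<open>star\<close> leaves only
    \<open>\<Delta>\<close>.\<close>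
  have \<Delta>0: "poly \<Delta> (-1) = 0"
  proof -
    have "map_poly (\<lambda>c. poly c (-1)) N \<noteq> 0"
    proof
      assume "map_poly (\<lambda>c. poly c (-1)) N = 0"
      then have "[:[:1, 1:]:] dvd N" using eval2_at_s_zero[of "-1" N] by simp
      then have "[:[:1, 1:]:] dvd (1 :: bipoly)" using cop D_at_minus_1 by (meson coprime_common_divisor)
      then have "[:1, 1:] dvd (1 :: complex poly)" by (simp add: is_unit_const_poly_iff)
      then show False by (auto dest: dvd_imp_degree_le)
    qed
    then have "\<forall>\<^sub>F n in sequentially. eval2 N (of_nat n) (-1) \<noteq> 0" by (rule eventually_eval2_nonzero)
    then have "\<forall>\<^sub>F n::nat in sequentially. poly \<Delta> (-1) = 0"
      using g_col[of "-1"]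
    proof eventually_elim
      case (elim n)
      have "eval2 D (of_nat n) (-1) = 0" using D_at_minus_1 by (auto simp: dvd_def)
      then show ?case using star[of "of_nat n" "-1"] elim by simp
    qed
    then show ?thesis by simp
  qed

  have \<alpha>_ev: "\<forall>\<^sub>F n in sequentially. \<alpha> n = poly E3 (of_nat n) / poly B (of_nat n)"
  proof -
    have "generic (\<lambda>n k. poly a1 (of_nat n) / poly a2 (of_nat n) = poly E3 (of_nat n) / poly B (of_nat n))"
      by (rule generic_mono[OF generic_conj[OF generic_poly_at_u[OF a2, of a1] generic_poly_at_u[OF E(3), of E3]]])
        (use al_eq al_def in auto)
    then show ?thesis unfolding generic_const_k using \<alpha>_eq by eventually_elim simp
  qed
  have Bm: "poly_at p (var_u - 1) = poly_at (pcompose p [:-1, 1:]) var_u" for p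
  proof (induction p)
    case (pCons a p)
    have cm1: "const_rat (-1) = - 1"
    proof -
      have "const_rat (-1) + const_rat 1 = 0" by (simp flip: const_rat_simps)
      then show ?thesis by (simp add: eq_neg_iff_add_eq_0)
    qed
    show ?case using pCons
      by (simp only: pcompose_pCons poly_at_add poly_at_mult poly_at_pCons poly_at_0 cm1 const_rat_simps)
        (simp add: algebra_simps)
  qed simp
  have \<beta>_ev: "\<forall>\<^sub>F n in sequentially. \<beta> n = poly E2 (of_nat n) / poly B (of_nat n) * (poly E1 (of_nat n - 1) / poly B (of_nat n - 1))"
  proof -
    let ?B1 = "pcompose B [:-1, 1:]" and ?E1 = "pcompose E1 [:-1, 1:]"
    have "?B1 \<noteq> 0" using E by (simp add: pcompose_eq_0_iff)
    have be2: "be = poly_at (E2 * ?E1) var_u / poly_at (B * ?B1) var_u"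
      unfolding be_eq Bm by simp
    have "B * ?B1 \<noteq> 0" using E \<open>?B1 \<noteq> 0\<close> by simp
    have "generic (\<lambda>n k. \<beta> n = poly E2 (of_nat n) / poly B (of_nat n) * (poly E1 (of_nat n - 1) / poly B (of_nat n - 1)))"
      by (rule generic_mono[OF generic_conj[OF generic_poly_at_u[OF \<open>B * ?B1 \<noteq> 0\<close>, of "E2 * ?E1", folded be2] generic_be]])
        (auto simp: poly_pcompose)
    then show ?thesis by (simp only: generic_const_k)
  qed
  have "\<forall>\<^sub>F n in sequentially. n \<ge> 1 \<and> poly E1 (of_nat n) \<noteq> 0 \<and> poly B (of_nat n) \<noteq> 0 \<and>
       poly Q (of_nat n) \<noteq> 0 \<and> poly P (- of_nat n) \<noteq> 0 \<and> \<alpha> n = poly E3 (of_nat n) / poly B (of_nat n) \<and>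
       \<beta> n = poly E2 (of_nat n) / poly B (of_nat n) * (poly E1 (of_nat n - 1) / poly B (of_nat n - 1))"
    using eventually_ge_at_top[of 1] eventually_poly_nonzero[OF E(1)] eventually_poly_nonzero[OF E(3)]
      Q_col[of 0] P_col[of 0] \<alpha>_ev \<beta>_ev by eventually_elim simp
  then obtain n0 where n0: "\<And>n. n \<ge> n0 \<Longrightarrow> n \<ge> 1 \<and> poly E1 (of_nat n) \<noteq> 0 \<and> poly B (of_nat n) \<noteq> 0 \<and>
       poly Q (of_nat n) \<noteq> 0 \<and> poly P (- of_nat n) \<noteq> 0 \<and> \<alpha> n = poly E3 (of_nat n) / poly B (of_nat n) \<and>
       \<beta> n = poly E2 (of_nat n) / poly B (of_nat n) * (poly E1 (of_nat n - 1) / poly B (of_nat n - 1))"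
    by (rule eventually_all_ge) blast
  interpret es: explicit_solution g P Q \<Delta> E1 E2 E3 B R n0
    by unfold_locales (use identity n0 \<Delta>0 \<Delta>_nz in auto)

  \<comment> \<open>For large \<open>n\<close> both arrays have the same nonzero ratio between
    columns \<open>k\<close> and \<open>k + 1\<close>, so proportionality passes between
    neighbouring columns in both directions.\<close>
  have step: "\<forall>\<^sub>F n in sequentially. \<exists>x. x \<noteq> 0 \<and> c' n (Suc k) = x * c' n k \<and> es.H n (Suc k) = x * es.H n k" for k
    using eventually_ratio[of k] g_col[of "of_nat k"] g_col[of "of_nat k + 1"]
  proof eventually_elim
    case (elim n)
    let ?n = "of_nat n :: complex" and ?k = "of_nat k :: complex"
    let ?x = "eval2 N ?n ?k / eval2 D ?n ?k"
    have "eval2 D ?n ?k * c' n (Suc k) = eval2 N ?n ?k * c' n k"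
      using hg[of "int n" "int k"] by (simp add: c'_def add.commute)
    then have 1: "c' n (Suc k) = ?x * c' n k" using elim by (simp add: field_simps)
    have gd: "eval2 g ?n ?k * poly \<Delta> ?k \<noteq> 0" using elim \<Delta>_nz by simp
    have "eval2 D ?n ?k * es.H n (Suc k) * (eval2 g ?n ?k * poly \<Delta> ?k)
      = es.H n k * (eval2 D ?n ?k * eval2 g ?n (?k + 1) * poly P (?k - ?n) * poly Q (?k + ?n))"
      using es.H_Suc_k[of n k] by (simp add: add.commute mult_ac)
    also have "\<dots> = (eval2 N ?n ?k * es.H n k) * (eval2 g ?n ?k * poly \<Delta> ?k)"
      unfolding star[symmetric] by (simp only: mult_ac)
    finally have "eval2 D ?n ?k * es.H n (Suc k) = eval2 N ?n ?k * es.H n k"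
      by (simp only: mult_right_cancel[OF gd])
    then have 2: "es.H n (Suc k) = ?x * es.H n k" using elim by (simp add: field_simps)
    have "?x \<noteq> 0" using elim by simp
    then show ?case using 1 2 by blast
  qed

  have gevA: "generic (\<lambda>n k. gev A n k * (eval2 g (of_nat n) (of_nat k) * poly P (of_nat k - of_nat (Suc n)))
     = poly E1 (of_nat n) / poly B (of_nat n) * eval2 g (of_nat (Suc n)) (of_nat k) * poly Q (of_nat k + of_nat n)
     \<and> eval2 g (of_nat n) (of_nat k) * poly P (of_nat k - of_nat (Suc n)) \<noteq> 0)"
  proof -
    have d: "var_s + var_u = to_fract (Ss + Us)" "var_s - var_u - 1 = to_fract (Ss - Us - 1)"
      by (simp_all only: var_s_def var_u_def to_fract_add to_fract_diff to_fract_1)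
    have Ae: "A = to_fract (lift2 E1 Us * shift2 1 0 g * lift2 Q (Ss + Us)) / to_fract (lift2 B Us * (g * lift2 P (Ss - Us - 1)))"
      unfolding A_eq d unfolding var_u_def to_fract_lift2[symmetric] by simp
    have "lift2 P (Ss - Us - 1) \<noteq> 0"
    proof
      assume "lift2 P (Ss - Us - 1) = 0"
      then have "eval2 (lift2 P (Ss - Us - 1)) 0 (y + 1) = 0" for y by simp
      then have "poly P y = 0" for y by simp
      then show False using P by (metis poly_all_0_iff_0)
    qed
    then have nz: "lift2 B Us * (g * lift2 P (Ss - Us - 1)) \<noteq> 0" using E g by simp
    show ?thesis
      by (rule generic_mono[OF generic_gev_div[OF nz, of "lift2 E1 Us * shift2 1 0 g * lift2 Q (Ss + Us)", folded Ae]])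
        (auto simp: field_simps)
  qed
  have H_gen: "generic (\<lambda>n k. es.H n k \<noteq> 0)"
    unfolding generic_def
  proof (rule always_eventually, rule allI)
    fix k :: nat
    show "\<forall>\<^sub>F n in sequentially. es.H n k \<noteq> 0"
      using g_col[of "of_nat k"] eventually_ge_at_top[of "n0 + k"]
    proof eventually_elim
      case (elim n)
      have "poly P (of_nat j + - of_nat n) \<noteq> 0" if "j < k" for j
        using n0[of "n - j"] elim that by (simp add: of_nat_diff)
      then have "es.PP n k \<noteq> 0" by (simp add: es.PP_def)
      moreover have "poly Q (of_nat j + of_nat n) \<noteq> 0" for j using n0[of "j + n"] elim by simp
      then have "es.QQ n k \<noteq> 0" by (simp add: es.QQ_def)
      ultimately show ?case using elim es.\<kappa>_nz es.DD_nz by (simp add: es.H_def)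
    qed
  qed
  have "generic (\<lambda>n k. c' (Suc n) k = gev A n k * c' n k \<and> c' n k \<noteq> 0 \<and> es.H n k \<noteq> 0 \<and>
      (n \<ge> n0 \<longrightarrow> es.H (Suc n) k = gev A n k * es.H n k))"
  proof (rule generic_mono[OF generic_conj[OF generic_conj[OF ratio_up generic_c'_nonzero] generic_conj[OF H_gen gevA]]], elim conjE, intro conjI impI)
    fix n k
    assume a: "gev A n k * (eval2 g (of_nat n) (of_nat k) * poly P (of_nat k - of_nat (Suc n)))
     = poly E1 (of_nat n) / poly B (of_nat n) * eval2 g (of_nat (Suc n)) (of_nat k) * poly Q (of_nat k + of_nat n)"
      "eval2 g (of_nat n) (of_nat k) * poly P (of_nat k - of_nat (Suc n)) \<noteq> 0" and "n0 \<le> n"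
    have "es.H (Suc n) k * (eval2 g (of_nat n) (of_nat k) * poly P (of_nat k - of_nat (Suc n)))
      = es.H n k * (gev A n k * (eval2 g (of_nat n) (of_nat k) * poly P (of_nat k - of_nat (Suc n))))"
      unfolding es.H_Suc_n[OF \<open>n0 \<le> n\<close>] a(1) by (simp add: es.e_def)
    also have "\<dots> = (gev A n k * es.H n k) * (eval2 g (of_nat n) (of_nat k) * poly P (of_nat k - of_nat (Suc n)))"
      by (simp only: mult_ac)
    finally show "es.H (Suc n) k = gev A n k * es.H n k"
      by (simp only: mult_right_cancel[OF a(2)])
  qed
  \<comment> \<open>In column \<open>k1\<close> both arrays have the ratio \<open>A\<close> in the
    direction of \<open>n\<close> from some row on, which makes them proportional there.\<close>
  then obtain k1 where "\<forall>\<^sub>F n in sequentially. c' (Suc n) k1 = gev A n k1 * c' n k1 \<and> c' n k1 \<noteq> 0 \<and> es.H n k1 \<noteq> 0 \<and>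
      (n \<ge> n0 \<longrightarrow> es.H (Suc n) k1 = gev A n k1 * es.H n k1)"
    unfolding generic_def by (rule eventually_all_ge) (use order_refl in blast)
  then obtain n1 where n1: "\<And>n. n \<ge> n1 \<Longrightarrow> c' (Suc n) k1 = gev A n k1 * c' n k1 \<and> c' n k1 \<noteq> 0 \<and> es.H n k1 \<noteq> 0 \<and>
      (n \<ge> n0 \<longrightarrow> es.H (Suc n) k1 = gev A n k1 * es.H n k1)"
    by (rule eventually_all_ge) blast
  define m where "m = max n0 n1"
  define \<mu> where "\<mu> = c' m k1 / es.H m k1"
  have \<mu>: "\<mu> \<noteq> 0" using n1[of m] by (simp add: \<mu>_def m_def)
  have base: "c' n k1 = \<mu> * es.H n k1" if "n \<ge> m" for n
    using that
  proof (induction n rule: dec_induct)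
    case base then show ?case using n1[of m] by (simp add: \<mu>_def m_def)
  next
    case (step n) then show ?case using n1[of n] by (simp add: m_def)
  qed
  have col: "\<forall>\<^sub>F n in sequentially. c' n k = \<mu> * es.H n k" for k
  proof -
    have iff: "(\<forall>\<^sub>F n in sequentially. c' n k = \<mu> * es.H n k) \<longleftrightarrow> (\<forall>\<^sub>F n in sequentially. c' n (Suc k) = \<mu> * es.H n (Suc k))" for k
    proof
      assume "\<forall>\<^sub>F n in sequentially. c' n k = \<mu> * es.H n k"
      then show "\<forall>\<^sub>F n in sequentially. c' n (Suc k) = \<mu> * es.H n (Suc k)"
        using step[of k] by eventually_elim auto
    next
      assume "\<forall>\<^sub>F n in sequentially. c' n (Suc k) = \<mu> * es.H n (Suc k)"
      then show "\<forall>\<^sub>F n in sequentially. c' n k = \<mu> * es.H n k"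
        using step[of k] by eventually_elim auto
    qed
    have "\<forall>\<^sub>F n in sequentially. c' n k1 = \<mu> * es.H n k1"
      using base by (auto simp: eventually_sequentially)
    then have "\<forall>\<^sub>F n in sequentially. c' n 0 = \<mu> * es.H n 0"
    proof (induction k1)
      case (Suc k1) then show ?case using iff[of k1] by blast
    qed simp
    then show ?thesis
    proof (induction k)
      case (Suc k) then show ?case using iff[of k] by blast
    qed simp
  qed
  \<comment> \<open>The threshold in \<open>col\<close> depends on \<open>k\<close>. Running both
    recurrences downwards, which \<open>\<beta> n \<noteq> 0\<close> permits, lowers it to
    \<open>n0\<close> in every column.\<close>
  have all: "c' n k = \<mu> * es.H n k" if "n \<ge> n0" for n k
    using that
  proof (induction k arbitrary: n)
    case 0
    obtain n2 where n2: "\<And>n. n \<ge> n2 \<Longrightarrow> c' n 0 = \<mu> * es.H n 0" using col[of 0] by (rule eventually_all_ge) blast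
    have "c' i 0 = \<mu> * es.H i 0 \<and> c' (Suc i) 0 = \<mu> * es.H (Suc i) 0" if "n0 \<le> i" "i \<le> max n n2" for i
      using that(2,1)
    proof (induction i rule: inc_induct)
      case base then show ?case using n2 by simp
    next
      case (step i)
      have IH: "c' (Suc i) 0 = \<mu> * es.H (Suc i) 0" "c' (Suc (Suc i)) 0 = \<mu> * es.H (Suc (Suc i)) 0" using step by auto
      have "c (int (Suc i)) (-1) = 0" by (rule supp) simp
      then have "- (poly R 0 + \<alpha> (Suc i)) * c' (Suc i) 0 = c' (Suc (Suc i)) 0 + \<beta> (Suc i) * c' i 0"
        using three[of "Suc i" 0] by (simp add: c'_def algebra_simps)
      moreover have "- (poly R 0 + \<alpha> (Suc i)) * es.H (Suc i) 0 = es.H (Suc (Suc i)) 0 + \<beta> (Suc i) * es.H i 0"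
        by (rule es.H_recurrence(2)) (use n0[of "Suc i"] step.prems in \<open>auto simp: es.e_def\<close>)
      then have "\<mu> * (- (poly R 0 + \<alpha> (Suc i)) * es.H (Suc i) 0) = \<mu> * (es.H (Suc (Suc i)) 0 + \<beta> (Suc i) * es.H i 0)"
        by (simp only:)
      ultimately have "\<beta> (Suc i) * c' i 0 = \<beta> (Suc i) * (\<mu> * es.H i 0)"
        unfolding IH by (simp add: algebra_simps)
      then show ?case using \<beta>_nz[of "Suc i"] IH by simp
    qed
    then show ?case using 0 by simp
  next
    case (Suc k)
    obtain n2 where n2: "\<And>n. n \<ge> n2 \<Longrightarrow> c' n (Suc k) = \<mu> * es.H n (Suc k)" using col[of "Suc k"] by (rule eventually_all_ge) blast
    have "c' i (Suc k) = \<mu> * es.H i (Suc k) \<and> c' (Suc i) (Suc k) = \<mu> * es.H (Suc i) (Suc k)" if "n0 \<le> i" "i \<le> max n n2" for i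
      using that(2,1)
    proof (induction i rule: inc_induct)
      case base then show ?case using n2 by simp
    next
      case (step i)
      have IH: "c' (Suc i) (Suc k) = \<mu> * es.H (Suc i) (Suc k)" "c' (Suc (Suc i)) (Suc k) = \<mu> * es.H (Suc (Suc i)) (Suc k)" using step by auto
      have IHk: "c' (Suc i) k = \<mu> * es.H (Suc i) k" using step.prems by (intro Suc.IH) simp
      note t = three_c'[of i k]
      have "es.H (Suc i) k - (poly R (of_nat (Suc k)) + \<alpha> (Suc i)) * es.H (Suc i) (Suc k)
         = es.H (Suc (Suc i)) (Suc k) + \<beta> (Suc i) * es.H i (Suc k)"
        by (rule es.H_recurrence(1)) (use n0[of "Suc i"] step.prems in \<open>auto simp: es.e_def\<close>)
      then have "\<mu> * (es.H (Suc i) k - (poly R (of_nat (Suc k)) + \<alpha> (Suc i)) * es.H (Suc i) (Suc k))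
         = \<mu> * (es.H (Suc (Suc i)) (Suc k) + \<beta> (Suc i) * es.H i (Suc k))"
        by (simp only:)
      then have "\<beta> (Suc i) * c' i (Suc k) = \<beta> (Suc i) * (\<mu> * es.H i (Suc k))"
        using t unfolding IH IHk by (auto simp: algebra_simps)
      then show ?case using \<beta>_nz[of "Suc i"] IH by simp
    qed
    then show ?case using Suc.prems by simp
  qed

  \<comment> \<open>As \<open>c n n = 1\<close>, no factor of the product \<open>PP n n\<close>
    vanishes.\<close>
  have neg: "poly P (of_nat j - of_nat n) \<noteq> 0" if "n \<ge> n0" "j < n" for n j
  proof -
    have "c' n n = 1" using diag by (simp add: c'_def)
    then have "es.H n n \<noteq> 0" using all[OF that(1), of n] by auto
    then have "es.PP n n \<noteq> 0" by (auto simp: es.H_def)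
    then show ?thesis using that by (auto simp: es.PP_def)
  qed
  \<comment> \<open>As \<open>c n (n + y) = 0\<close>, some factor of \<open>H\<close> vanishes, and
    under the assumption on \<open>P\<close> only \<open>g\<close> can.\<close>
  have zero: "eval2 g (of_nat n) (of_nat n + of_nat y) = 0" if "n \<ge> n0" "y \<ge> 1" "\<And>i. i < y \<Longrightarrow> poly P (of_nat i) \<noteq> 0" for n y
  proof -
    have "c' n (n + y) = 0" unfolding c'_def by (rule supp) (use that in simp)
    then have H0: "es.H n (n + y) = 0" using all[OF that(1), of "n + y"] \<mu> by simp
    have "poly P (of_nat j + - of_nat n) \<noteq> 0" if "j < n + y" for j
    proof (cases "j < n")
      case True then show ?thesis using neg[OF \<open>n \<ge> n0\<close> True] by simp
    next
      case False
      then have jn: "j - n < y" using that by simp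
      have "poly P (of_nat (j - n)) \<noteq> 0" by (rule \<open>\<And>i. i < y \<Longrightarrow> poly P (of_nat i) \<noteq> 0\<close>[OF jn])
      moreover have "of_nat (j - n) = of_nat j + - (of_nat n :: complex)" using False by (simp add: of_nat_diff)
      ultimately show ?thesis by metis
    qed
    then have "es.PP n (n + y) \<noteq> 0" by (simp add: es.PP_def)
    moreover have "poly Q (of_nat j + of_nat n) \<noteq> 0" for j using n0[of "j + n"] that(1) by simp
    then have "es.QQ n (n + y) \<noteq> 0" by (simp add: es.QQ_def)
    ultimately show ?thesis using H0 es.\<kappa>_nz es.DD_nz by (simp add: es.H_def)
  qed
  \<comment> \<open>Otherwise let \<open>r\<close> be the least natural root of \<open>P\<close>.
    Then \<open>g\<close> vanishes along the line \<open>s = u + r\<close>, so that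
    \<open>s - u - r\<close> divides it, against \<open>g_P\<close>. Without natural roots,
    \<open>g(n, s)\<close> has infinitely many zeros for each \<open>n \<ge> n0\<close>, against
    \<open>g_col\<close>.\<close>
  have P0: "poly P 0 = 0"
  proof (rule ccontr)
    assume nz: "poly P 0 \<noteq> 0"
    show False
    proof (cases "\<exists>r::nat. poly P (of_nat r) = 0")
      case True
      define r where "r = (LEAST r::nat. poly P (of_nat r) = 0)"
      have r: "poly P (of_nat r) = 0" unfolding r_def using True by (metis (mono_tags) LeastI)
      have "poly P (of_nat i) \<noteq> 0" if "i < r" for i using that not_less_Least unfolding r_def by blast
      moreover have "r \<ge> 1" using r nz by (cases r) auto
      ultimately have "diag_minus (of_nat r) dvd g"
        using zero by (intro lift_zero_on_line[of n0]) blast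
      then show False using g_P[OF r] by blast
    next
      case False
      have gz: "poly g [:of_nat n:] = 0" if "n \<ge> n0" for n
      proof (rule frequently_zero_poly)
        fix m
        have "eval2 g (of_nat n) (of_nat n + of_nat (Suc m)) = 0"
          using zero[OF that, of "Suc m"] False by auto
        then show "\<exists>l\<ge>m. poly (poly g [:of_nat n:]) (of_nat l) = 0"
          by (intro exI[of _ "n + Suc m"]) (simp add: eval2_def add_ac)
      qed
      have "\<forall>\<^sub>F n::nat in sequentially. False"
        using g_col[of 0] eventually_ge_at_top[of n0] 
        by eventually_elim (use gz in \<open>simp add: eval2_def\<close>)
      then show False by simp
    qed
  qed
  show thesis using that g P1 Q1 \<Delta> E f_eq identity P0 \<Delta>0 by blast
qed

end

section \<open>Leading homogeneous forms\<close>

lemma multiple_root_pderiv: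
  fixes p :: "complex poly"
  assumes p: "p = [:- c, 1:] ^ k * K"
  shows "k \<ge> 2 \<Longrightarrow> poly (pderiv p) c = 0" "k \<ge> 3 \<Longrightarrow> poly (pderiv (pderiv p)) c = 0"
proof -
  define q where "q = [:- c, 1:]"
  have q: "poly q c = 0" by (simp add: q_def)
  show "poly (pderiv p) c = 0" if "k \<ge> 2"
  proof -
    have "k = Suc (Suc (k - 2))" using that by simp
    then obtain m where "k = Suc (Suc m)" by blast
    then have "p = q * (q * (q ^ m * K))" using p unfolding q_def[symmetric] by (simp only: power_Suc mult.assoc)
    then show ?thesis using q by (simp add: pderiv_mult)
  qed
  show "poly (pderiv (pderiv p)) c = 0" if "k \<ge> 3"
  proof -
    have "k = Suc (Suc (Suc (k - 3)))" using that by simp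
    then obtain m where "k = Suc (Suc (Suc m))" by blast
    then have "p = q * (q * (q * (q ^ m * K)))" using p unfolding q_def[symmetric] by (simp only: power_Suc mult.assoc)
    then show ?thesis using q by (simp add: pderiv_mult pderiv_add)
  qed
qed

lemma pderiv_linear_power':
  "pderiv ([:c, 1:] ^ n) = smult (of_nat n) ([:c, 1:] ^ (n - 1))" for c :: complex
proof (cases n)
  case (Suc m)
  then show ?thesis by (simp only: pderiv_power_Suc) (simp add: pderiv_pCons)
qed simp

lemma pderiv_linear_power: "poly (pderiv ([:c, 1:] ^ n)) x = of_nat n * (c + x) ^ (n - 1)" for x :: complex
  by (simp only: pderiv_linear_power') (simp add: poly_power)

lemma pderiv2_linear_power:
  "poly (pderiv (pderiv ([:c, 1:] ^ n))) x = of_nat n * of_nat (n - 1) * (c + x) ^ (n - 2)" for x :: complex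
  by (simp only: pderiv_linear_power' pderiv_smult) (simp add: poly_power numeral_2_eq_2)

lemma monom_eq_linear_power: "monom e n = smult e ([:0, 1:] ^ n)" for e :: complex
  by (simp add: monom_altdef)

lemma zero_off_point:
  fixes p :: "complex poly"
  assumes "\<And>x. x \<noteq> c \<Longrightarrow> poly p x = 0"
  shows "p = 0"
proof -
  have "poly ([:- c, 1:] * p) x = 0" for x using assms[of x] by (cases "x = c") auto
  then have "[:- c, 1:] * p = 0" by (metis poly_all_0_iff_0)
  then have "[:- c, 1:] = 0 \<or> p = 0" by (simp only: mult_eq_0_iff)
  then show ?thesis by simp
qed

lemma power_2_inject:
  assumes "(2::complex) ^ m = 2 ^ n"
  shows "m = n"
proof -
  have "(2::complex) ^ m = of_nat (2 ^ m)" "(2::complex) ^ n = of_nat (2 ^ n)" by simp_all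
  then have "(2::nat) ^ m = 2 ^ n" using assms by (metis of_nat_eq_iff)
  then show ?thesis by simp
qed

text \<open>The values at 0, 2 and 3 eliminate \<open>y1\<close> and \<open>y2\<close> and leave
  \<open>3 ^ n + 3 = 3 * 2 ^ n\<close>, which is impossible for \<open>n \<ge> 3\<close>.\<close>

lemma quadratic_power:
  assumes "\<And>x::complex. y2 * (x - 1)\<^sup>2 + y1 * (x - 1) + 1 = x ^ n" "n \<ge> 1"
  shows "n \<le> 2"
proof (rule ccontr)
  assume "\<not> n \<le> 2"
  then have n: "n \<ge> 3" by simp
  have 1: "y2 - y1 + 1 = 0" "2 ^ n = y2 + y1 + 1" "3 ^ n = y2 * 4 + y1 * 2 + 1"
    using assms(1)[of 0] assms(1)[of 2] assms(1)[of 3] assms(2) by (simp_all add: power2_eq_square power_0_left)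
  have "(3::complex) ^ n + 3 - 3 * 2 ^ n = y2 - y1 + 1" unfolding 1(2,3) by (simp add: algebra_simps)
  then have "(3::complex) ^ n + 3 = 3 * 2 ^ n" using 1(1) by simp
  then have "of_nat (3 ^ n + 3) = (of_nat (3 * 2 ^ n) :: complex)" by simp
  then have e: "(3::nat) ^ n + 3 = 3 * 2 ^ n" by (simp only: of_nat_eq_iff)
  have "(3::nat) ^ n \<ge> 3 * 2 ^ n"
    using n by (induction n rule: dec_induct) auto
  then show False using e by simp
qed

lemma power_double: "y ^ (2 * m) = y ^ m * (y ^ m :: 'a :: monoid_mult)"
  by (simp add: mult_2 power_add)

text \<open>Here \<open>a\<close>, \<open>b\<close>, \<open>\<rho>\<close>, \<open>\<delta>\<close>
  are the degrees of \<open>Q\<close>, \<open>P\<close>, \<open>R\<close>, \<open>\<Delta>\<close>,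
  and \<open>x\<close> stands for \<open>s / u\<close>. Values and derivatives at 1 and -1 bound the
  degrees, since \<open>(x - 1) ^ b * (x + 1) ^ a\<close> annihilates the middle term there; the
  remaining cases are settled at special points.\<close>

lemma leading_form_cases:
  fixes \<epsilon>1 \<epsilon>2 \<epsilon>3 \<epsilon>4 \<epsilon>5 :: complex and a b \<rho> \<delta> :: nat
  assumes form: "\<And>x. \<epsilon>1 * (x + 1) ^ (2 * a) + \<epsilon>2 * (x - 1) ^ (2 * b)
      + (\<epsilon>3 * x ^ \<rho> + \<epsilon>4) * (x - 1) ^ b * (x + 1) ^ a = \<epsilon>5 * x ^ \<delta>"
    and nontriv: "\<not> (\<epsilon>1 = 0 \<and> \<epsilon>2 = 0 \<and> \<epsilon>3 = 0 \<and> \<epsilon>4 = 0 \<and> \<epsilon>5 = 0)"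
    and b: "b \<ge> 1" and \<delta>: "\<delta> \<ge> 1"
    and \<rho>0: "\<rho> = 0 \<Longrightarrow> \<epsilon>3 = 0"
    and d1: "\<rho> \<ge> 1 \<Longrightarrow> \<epsilon>5 \<noteq> 0 \<Longrightarrow> \<rho> + a + b \<le> \<delta>"
    and d2: "\<epsilon>3 \<noteq> 0 \<Longrightarrow> \<delta> \<le> \<rho> + a + b"
  shows "(a = 0 \<and> b = 1 \<and> (\<rho> \<le> 1 \<and> \<delta> \<le> 2 \<or> \<rho> = 2 \<and> \<delta> = 3 \<and> \<epsilon>3 = \<epsilon>5 \<and> \<epsilon>5 \<noteq> 0))
    \<or> (a = 1 \<and> b = 1 \<and> (\<rho> = 0 \<and> \<delta> \<le> 2 \<or> 1 \<le> \<rho> \<and> \<rho> \<le> 2 \<and> \<delta> = \<rho> + 2 \<and> \<epsilon>3 = \<epsilon>5 \<and> \<epsilon>5 \<noteq> 0))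
    \<or> (a = 2 \<and> b = 2 \<and> \<rho> = 0 \<and> \<delta> = 2)"
proof -
  have b0 [simp]: "0 < b" and d0 [simp]: "0 < \<delta>" using b \<delta> by auto
  have zb [simp]: "(0::complex) ^ b = 0" "(0::complex) ^ \<delta> = 0" using b0 d0 by (simp_all add: zero_power)
  have at1: "\<epsilon>1 * 4 ^ a = \<epsilon>5" using form[of 1] b by (simp add: power_mult)
  have atm1: "\<epsilon>2 * 4 ^ b = \<epsilon>5 * (-1) ^ \<delta>" if "a \<ge> 1" using form[of "-1"] that by (simp add: power_mult power_0_left)
  show ?thesis
  proof (cases "\<epsilon>5 = 0")
    \<comment> \<open>Here the term with \<open>\<Delta>\<close> is not of top order. The factor
      \<open>(x - 1) ^ b\<close> cancels, and only \<open>a = 0\<close>,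
      \<open>b = \<rho> = 1\<close> is left.\<close>
    case z5: True
    have z1: "\<epsilon>1 = 0" using at1 z5 by simp
    have a0: "a = 0"
    proof (rule ccontr)
      assume "a \<noteq> 0"
      then have z2: "\<epsilon>2 = 0" using atm1 z5 by simp
      have "\<epsilon>3 * x ^ \<rho> + \<epsilon>4 = 0" if "x \<noteq> 1" "x \<noteq> -1" for x
        using form[of x] z1 z2 z5 that by (auto simp: eq_neg_iff_add_eq_0)
      from this[of 0] this[of 2] have "\<epsilon>3 * 0 ^ \<rho> + \<epsilon>4 = 0" "\<epsilon>3 * 2 ^ \<rho> + \<epsilon>4 = 0" by auto
      then show False using nontriv z1 z2 z5 \<rho>0 by (cases "\<rho> = 0") (auto simp: power_0_left)
    qed
    define p where "p = smult \<epsilon>2 ([:-1, 1:] ^ b) + smult \<epsilon>3 ([:0, 1:] ^ \<rho>) + [:\<epsilon>4:]"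
    have "p = 0"
    proof (rule zero_off_point[of 1])
      fix x :: complex assume x: "x \<noteq> 1"
      have "(x - 1) ^ b * poly p x = 0"
        using form[of x, unfolded power_double] z1 z5 a0 by (simp add: p_def poly_power algebra_simps)
      then show "poly p x = 0" using x by simp
    qed
    then have p: "poly p x = 0" for x by simp
    have e0: "\<epsilon>3 + \<epsilon>4 = 0" using p[of 1] b by (simp add: p_def poly_power power_0_left)
    have \<rho>1: "\<rho> \<ge> 1"
    proof (rule ccontr)
      assume "\<not> \<rho> \<ge> 1"
      then have "\<epsilon>3 = 0" "\<epsilon>4 = 0" using \<rho>0 e0 by auto
      then show False using p[of 0] nontriv z1 z5 by (simp add: p_def poly_power power_0_left)
    qed
    have e2: "\<epsilon>2 * (-1) ^ b + \<epsilon>4 = 0" using p[of 0] \<rho>1 by (simp add: p_def poly_power power_0_left)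
    have n3: "\<epsilon>3 \<noteq> 0"
    proof
      assume "\<epsilon>3 = 0"
      then show False using e0 e2 nontriv z1 z5 by simp
    qed
    have b1: "b = 1"
    proof (rule ccontr)
      assume "b \<noteq> 1"
      then have "b - 1 > 0" using b by simp
      have "poly (pderiv p) 1 = 0" using \<open>p = 0\<close> by simp
      then have "\<epsilon>3 * of_nat \<rho> = 0"
        using \<open>b - 1 > 0\<close> by (simp add: p_def pderiv_add pderiv_smult pderiv_linear_power pderiv_pCons power_0_left)
      then show False using n3 \<rho>1 by simp
    qed
    have "\<epsilon>2 = \<epsilon>4" "\<epsilon>4 = - \<epsilon>3" using e2 e0 b1 by (simp_all add: eq_neg_iff_add_eq_0 add.commute)
    then have "\<epsilon>3 * 2 ^ \<rho> = \<epsilon>3 * 2 ^ 1" using p[of 2] b1 by (simp add: p_def poly_power algebra_simps)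
    then have "\<rho> = 1" using n3 power_2_inject[of \<rho> 1] by simp
    then show ?thesis using a0 b1 d2[OF n3] by simp
  next
    case n5: False
    define K where "K = smult \<epsilon>2 ([:-1, 1:] ^ b) + (monom \<epsilon>3 \<rho> + [:\<epsilon>4:]) * [:1, 1:] ^ a"
    define L where "L = smult \<epsilon>1 ([:1, 1:] ^ a) + (monom \<epsilon>3 \<rho> + [:\<epsilon>4:]) * [:-1, 1:] ^ b"
    \<comment> \<open>Modulo \<open>(x - 1) ^ b\<close>, and in \<open>L\<close> modulo
      \<open>(x + 1) ^ a\<close>, only two powers survive. If the modulus has a multiple root, the
      logarithmic derivatives of these powers agree at it, which relates the exponents.\<close>
    have K: "monom \<epsilon>5 \<delta> - smult \<epsilon>1 ([:1, 1:] ^ (2 * a)) = [:-1, 1:] ^ b * K"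
    proof (rule poly_eq_poly_eq_iff[THEN iffD1], rule ext)
      fix x
      show "poly (monom \<epsilon>5 \<delta> - smult \<epsilon>1 ([:1, 1:] ^ (2 * a))) x = poly ([:-1, 1:] ^ b * K) x"
        using form[of x, unfolded power_double] unfolding power_double
        by (simp add: K_def poly_power poly_monom algebra_simps)
    qed
    have L: "monom \<epsilon>5 \<delta> - smult \<epsilon>2 ([:-1, 1:] ^ (2 * b)) = [:-(-1), 1:] ^ a * L"
    proof (rule poly_eq_poly_eq_iff[THEN iffD1], rule ext)
      fix x
      show "poly (monom \<epsilon>5 \<delta> - smult \<epsilon>2 ([:-1, 1:] ^ (2 * b))) x = poly ([:-(-1), 1:] ^ a * L) x"
        using form[of x, unfolded power_double] unfolding power_double
        by (simp add: L_def poly_power poly_monom algebra_simps)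
    qed
    have half: "(2::complex) ^ (2 * m - 1) * 2 = 4 ^ m" if "m \<ge> 1" for m
      using that by (cases m) (simp_all add: power_mult[symmetric] power_mult)
    \<comment> \<open>At \<open>x = 1\<close> the logarithmic derivatives of
      \<open>x ^ \<delta>\<close> and \<open>(x + 1) ^ (2 * a)\<close> are \<open>\<delta>\<close>
      and \<open>a\<close>.\<close>
    have a_\<delta>: "a = \<delta>" if "b \<ge> 2"
    proof -
      have "poly (pderiv (monom \<epsilon>5 \<delta> - smult \<epsilon>1 ([:1, 1:] ^ (2 * a)))) 1 = 0"
        by (rule multiple_root_pderiv(1)[OF K that])
      then have "\<epsilon>5 * of_nat \<delta> = \<epsilon>1 * (2 * of_nat a * 2 ^ (2 * a - 1))"
        by (simp add: monom_eq_linear_power pderiv_diff pderiv_smult pderiv_linear_power)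
      also have "\<dots> = (\<epsilon>1 * 4 ^ a) * of_nat a" using half[of a] by (cases "a = 0") (simp_all add: mult_ac)
      finally have "(of_nat \<delta> :: complex) = of_nat a" using at1 n5 by simp
      then show ?thesis by simp
    qed
    have b_\<delta>: "b = \<delta>" if "a \<ge> 2"
    proof -
      have "poly (pderiv (monom \<epsilon>5 \<delta> - smult \<epsilon>2 ([:-1, 1:] ^ (2 * b)))) (-1) = 0"
        by (rule multiple_root_pderiv(1)[OF L that])
      then have "\<epsilon>5 * (of_nat \<delta> * (-1) ^ (\<delta> - 1)) = \<epsilon>2 * (2 * of_nat b * (-2) ^ (2 * b - 1))"
        by (simp add: monom_eq_linear_power pderiv_diff pderiv_smult pderiv_linear_power eq_neg_iff_add_eq_0)
      also have "(-2 :: complex) ^ (2 * b - 1) = - (2 ^ (2 * b - 1))" using b by (intro power_minus_odd) auto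
      also have "\<epsilon>2 * (2 * of_nat b * - (2 ^ (2 * b - 1))) = - (\<epsilon>2 * (2 ^ (2 * b - 1) * 2)) * of_nat b" by simp
      also have "\<dots> = - (\<epsilon>5 * (-1) ^ \<delta>) * of_nat b" using half[OF b] atm1 that by simp
      also have "(-1 :: complex) ^ \<delta> = - ((-1) ^ (\<delta> - 1))" using \<delta> by (cases \<delta>) auto
      finally have "(of_nat \<delta> :: complex) = of_nat b" using n5 by simp
      then show ?thesis by simp
    qed
    show ?thesis
    proof (cases "b \<ge> 2")
      case b2: True
      have ad: "a = \<delta>" by (rule a_\<delta>[OF b2])
      have r0: "\<rho> = 0" using d1 n5 ad b by (cases "\<rho> = 0") auto
      have a1: "a \<ge> 1" using ad \<delta> by simp
      \<comment> \<open>At a triple root the second derivatives agree as well: with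
        \<open>\<delta> = a\<close> this means \<open>a * (a - 1) = a * (2 * a - 1) / 2\<close>,
        which has no solution \<open>a \<ge> 1\<close>.\<close>
      have "\<not> b \<ge> 3"
      proof
        assume b3: "b \<ge> 3"
        have "poly (pderiv (pderiv (monom \<epsilon>5 \<delta> - smult \<epsilon>1 ([:1, 1:] ^ (2 * a))))) 1 = 0"
          by (rule multiple_root_pderiv(2)[OF K b3])
        then have eq: "\<epsilon>5 * (of_nat a * of_nat (a - 1)) = \<epsilon>1 * (2 * of_nat a * of_nat (2 * a - 1) * 2 ^ (2 * a - 2))"
          by (simp add: monom_eq_linear_power pderiv_diff pderiv_smult pderiv2_linear_power ad)
        have four: "(2::complex) ^ (2 * a - 2) * 4 = 4 ^ a"
          using a1 by (cases a) (simp_all add: power_mult)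
        have "\<epsilon>5 * (of_nat a * of_nat (a - 1)) * 4 = (\<epsilon>1 * (2 ^ (2 * a - 2) * 4)) * (2 * of_nat a * of_nat (2 * a - 1))"
          unfolding eq by (simp only: mult_ac)
        then have "\<epsilon>5 * (of_nat a * of_nat (a - 1)) * 4 = (\<epsilon>1 * 4 ^ a) * (2 * of_nat a * of_nat (2 * a - 1))"
          unfolding four .
        then have "of_nat a * of_nat (a - 1) * 4 = (2 * of_nat a * of_nat (2 * a - 1) :: complex)"
          using at1 n5 by simp
        then have "of_nat (a * (a - 1) * 4) = (of_nat (2 * a * (2 * a - 1)) :: complex)" by simp
        then have "a * (a - 1) * 4 = 2 * a * (2 * a - 1)" by (simp only: of_nat_eq_iff)
        then have "(a - 1) * 2 = 2 * a - 1" using a1 by simp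
        then show False using a1 by simp
      qed
      then have b2': "b = 2" using b2 by simp
      show ?thesis
      proof (cases "a \<ge> 2")
        case True
        then show ?thesis using b_\<delta> ad b2' r0 by simp
      next
        case False
        \<comment> \<open>The candidate \<open>a = 1\<close>, \<open>b = 2\<close>,
          \<open>\<delta> = 1\<close> is excluded by the values at 0 and 3, which give two different
          values of \<open>\<epsilon>4\<close>.\<close>
        then have a1': "a = 1" using a1 by simp
        have d1': "\<delta> = 1" using ad a1' by simp
        have "\<epsilon>1 * 4 = \<epsilon>5" using at1 a1' by simp
        then have e1: "\<epsilon>1 = \<epsilon>5 / 4" by (simp add: eq_divide_eq)
        have "\<epsilon>2 * 16 = - \<epsilon>5" using atm1 a1' b2' d1' by simp
        then have e2: "\<epsilon>2 = - \<epsilon>5 / 16" by (simp only: eq_divide_eq) simp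
        have e3: "\<epsilon>3 = 0" by (rule \<rho>0[OF r0])
        have "\<epsilon>5 / 4 - \<epsilon>5 / 16 + \<epsilon>4 = 0" using form[of 0] unfolding e1 e2 e3 a1' b2' d1' by simp
        then have "\<epsilon>4 = - 3 * \<epsilon>5 / 16" by (simp add: add_eq_0_iff)
        moreover have "\<epsilon>5 / 4 * 16 - \<epsilon>5 / 16 * 16 + \<epsilon>4 * 16 = \<epsilon>5 * 3"
          using form[of 3] unfolding e1 e2 e3 a1' b2' d1' by (simp add: mult_ac)
        then have "\<epsilon>4 = 0" by simp
        ultimately show ?thesis using n5 by simp
      qed
    next
      case False
      then have b1: "b = 1" using b by simp
      consider "a \<ge> 2" | "a = 1" | "a = 0" by linarith
      then show ?thesis
      proof cases
        case 1
        then have d: "\<delta> = 1" using b_\<delta> b1 by simp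
        have "\<rho> = 0" using d1 n5 d b1 1 by (cases "\<rho> = 0") auto
        then have z3: "\<epsilon>3 = 0" by (rule \<rho>0)
        have "\<epsilon>2 * 4 = - \<epsilon>5" using atm1 1 b1 d by simp
        then have e2: "\<epsilon>2 = - \<epsilon>5 / 4" by (simp only: eq_divide_eq) simp
        \<comment> \<open>The substitution \<open>x = 2 * t - 1\<close> makes \<open>x + 1\<close> a
          monomial; then \<open>t = -1\<close> yields \<open>\<epsilon>4 = 0\<close>, and
          \<open>t = 2\<close> compares exponents.\<close>
        have f: "\<epsilon>1 * (2 * t) ^ (2 * a) + \<epsilon>2 * (2 * t - 2)\<^sup>2 + \<epsilon>4 * (2 * t - 2) * (2 * t) ^ a = \<epsilon>5 * (2 * t - 1)" for t
          using form[of "2 * t - 1"] b1 d z3 by simp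
        have p4: "(2 * t) ^ (2 * a) = 4 ^ a * t ^ (2 * a)" for t :: complex by (simp add: power_mult_distrib power_mult)
        have f': "\<epsilon>5 * t ^ (2 * a) + \<epsilon>4 * (2 * t - 2) * (2 * t) ^ a = \<epsilon>5 * t\<^sup>2" for t
        proof -
          have "\<epsilon>1 * (2 * t) ^ (2 * a) = \<epsilon>5 * t ^ (2 * a)" unfolding p4 at1[symmetric] by (simp only: mult.assoc)
          moreover have "\<epsilon>2 * (2 * t - 2)\<^sup>2 = - \<epsilon>5 * (t - 1)\<^sup>2"
            unfolding e2 by (simp add: power2_eq_square algebra_simps)
          moreover define W where "W = \<epsilon>4 * (2 * t - 2) * (2 * t) ^ a"
          ultimately have "\<epsilon>5 * t ^ (2 * a) + - \<epsilon>5 * (t - 1)\<^sup>2 + W = \<epsilon>5 * (2 * t - 1)"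
            using f[of t] by (simp only:)
          then have "\<epsilon>5 * t ^ (2 * a) + W = \<epsilon>5 * (2 * t - 1) + \<epsilon>5 * (t - 1)\<^sup>2"
            by (simp add: algebra_simps)
          also have "\<dots> = \<epsilon>5 * t\<^sup>2" by (simp add: power2_eq_square algebra_simps)
          finally show ?thesis by (simp only: W_def)
        qed
        have "\<epsilon>4 = 0" using f'[of "-1"] by (simp add: power_mult)
        then have "(2::complex) ^ (2 * a) = 2 ^ 2" using f'[of 2] n5 by simp
        then have "2 * a = 2" by (rule power_2_inject)
        then show ?thesis using 1 by simp
      next
        case a1: 2
        have e1: "\<epsilon>1 = \<epsilon>5 / 4" using at1 a1 by (simp add: field_simps)
        have e2: "\<epsilon>2 = (-1) ^ \<delta> * \<epsilon>5 / 4" using atm1 a1 b1 by (simp add: field_simps)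
        define y where "y = \<epsilon>4 / \<epsilon>5"
        define z where "z = \<epsilon>3 / \<epsilon>5"
        have e34: "\<epsilon>3 = z * \<epsilon>5" "\<epsilon>4 = y * \<epsilon>5" using n5 by (simp_all add: y_def z_def)
        have f: "(x + 1)\<^sup>2 / 4 + (-1) ^ \<delta> * (x - 1)\<^sup>2 / 4 + (z * x ^ \<rho> + y) * (x\<^sup>2 - 1) = x ^ \<delta>" for x
        proof -
          have "\<epsilon>5 * ((x + 1)\<^sup>2 / 4 + (-1) ^ \<delta> * (x - 1)\<^sup>2 / 4 + (z * x ^ \<rho> + y) * (x\<^sup>2 - 1)) = \<epsilon>5 * x ^ \<delta>"
            using form[of x] unfolding a1 b1 e1 e2 e34
            by (simp add: algebra_simps power2_eq_square add_divide_distrib diff_divide_distrib)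
          then show ?thesis using n5 by simp
        qed
        have z0: "z = 0 \<Longrightarrow> \<delta> \<le> 2"
        proof -
          assume z: "z = 0"
          show "\<delta> \<le> 2"
          proof (cases "even \<delta>")
            case True
            have y: "y = 1 / 2" using f[of 0] True \<delta> z by (simp add: power_0_left field_simps)
            have "(2::complex) ^ 2 = 2 ^ \<delta>" using f[of 2] True unfolding y z by simp
            then show ?thesis using power_2_inject by fastforce
          next
            case False
            have y: "y = 0" using f[of 0] False \<delta> z by (simp add: power_0_left)
            have "(2::complex) ^ 1 = 2 ^ \<delta>" using f[of 2] False unfolding y z by simp
            then show ?thesis using power_2_inject by fastforce
          qed
        qed
        show ?thesis
        proof (cases "\<rho> = 0")
          case True
          then have "\<delta> \<le> 2" using \<rho>0 z0 by (simp add: z_def)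
          then show ?thesis using a1 b1 True by simp
        next
          case False
          then have "\<rho> + 2 \<le> \<delta>" using d1 n5 a1 b1 by simp
          then have zn: "z \<noteq> 0" using z0 False by auto
          then have "\<epsilon>3 \<noteq> 0" by (simp add: z_def)
          then have d: "\<delta> = \<rho> + 2" using d2 \<open>\<rho> + 2 \<le> \<delta>\<close> a1 b1 by simp
          \<comment> \<open>At the imaginary unit \<open>x\<^sup>2 - 1\<close> is -2 and both
            squares are multiples of \<open>x\<close>, so the equation leaves only 0 and 1 for
            \<open>z\<close>.\<close>
          have sq: "(\<i> + 1)\<^sup>2 = 2 * \<i>" "(\<i> - 1)\<^sup>2 = - 2 * \<i>" "\<i>\<^sup>2 = - 1"
            by (simp_all add: power2_eq_square algebra_simps)
          have i\<delta>: "\<i> ^ \<delta> = - (\<i> ^ \<rho>)" by (simp add: d power_add)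
          have par: "(-1::complex) ^ \<delta> = (-1) ^ \<rho>" by (simp add: d power_add)
          note fi = f[of \<i>, unfolded sq i\<delta> par]
          have "z = 1 \<and> \<rho> \<le> 2"
          proof (cases "even \<rho>")
            case True
            then obtain m where m: "\<rho> = 2 * m" by (auto elim: evenE)
            have y: "y = 1 / 2" using f[of 0] True False d by (simp add: power_0_left field_simps)
            have w: "\<i> ^ \<rho> = (-1) ^ m" by (simp add: m power_mult)
            have "- 1 - 2 * z * (-1) ^ m = - ((-1) ^ m)"
              using fi True unfolding w y by (simp add: algebra_simps)
            then have z: "z = 1" using zn by (cases "even m") (auto simp: algebra_simps)
            have "(2::complex) ^ 2 = 2 ^ \<rho>" using f[of 2] True unfolding y z d by (simp add: algebra_simps power_add)
            then show ?thesis using z power_2_inject[of 2 \<rho>] by simp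
          next
            case odd: False
            then obtain m where m: "\<rho> = 2 * m + 1" by (auto elim: oddE)
            have y: "y = 0" using f[of 0] odd False d by (simp add: power_0_left)
            have w: "\<i> ^ \<rho> = \<i> * (-1) ^ m" by (simp add: m power_mult)
            have "\<i> - 2 * z * (\<i> * (-1) ^ m) = - (\<i> * (-1) ^ m)"
              using fi odd unfolding w y by (simp add: algebra_simps)
            then have "\<i> * (1 - 2 * z * (-1) ^ m) = \<i> * (- ((-1) ^ m))" by (simp add: algebra_simps)
            then have "1 - 2 * z * (-1) ^ m = - ((-1) ^ m)"
              by (simp only: mult_left_cancel[OF complex_i_not_zero])
            then have z: "z = 1" using zn by (cases "even m") (auto simp: algebra_simps)
            have "(2::complex) ^ 1 = 2 ^ \<rho>" using f[of 2] odd unfolding y z d by (simp add: algebra_simps power_add)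
            then show ?thesis using z power_2_inject[of 1 \<rho>] by simp
          qed
          then show ?thesis using a1 b1 d e34 n5 False by simp
        qed
      next
        case a0: 3
        have e1: "\<epsilon>1 = \<epsilon>5" using at1 a0 by simp
        define w y z where "w = \<epsilon>2 / \<epsilon>5" and "y = \<epsilon>4 / \<epsilon>5" and "z = \<epsilon>3 / \<epsilon>5"
        have e: "\<epsilon>2 = w * \<epsilon>5" "\<epsilon>3 = z * \<epsilon>5" "\<epsilon>4 = y * \<epsilon>5" using n5 by (simp_all add: w_def y_def z_def)
        have f: "w * (x - 1)\<^sup>2 + (z * x ^ \<rho> + y) * (x - 1) + 1 = x ^ \<delta>" for x
        proof -
          have "\<epsilon>5 * (w * (x - 1)\<^sup>2 + (z * x ^ \<rho> + y) * (x - 1) + 1) = \<epsilon>5 * x ^ \<delta>"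
            using form[of x] unfolding a0 b1 e1 e by (simp add: algebra_simps power2_eq_square)
          then show ?thesis using n5 by simp
        qed
        have z0: "z = 0 \<Longrightarrow> \<delta> \<le> 2"
          using quadratic_power[of w y \<delta>] f \<delta> by simp
        show ?thesis
        proof (cases "\<rho> \<le> 1")
          case True
          have "\<delta> \<le> 2"
          proof (cases "z = 0")
            case False
            then have "\<epsilon>3 \<noteq> 0" by (simp add: z_def)
            then show ?thesis using d2 a0 b1 True by simp
          qed (rule z0)
          then show ?thesis using a0 b1 True by simp
        next
          case False
          then have "\<rho> + 1 \<le> \<delta>" using d1 n5 a0 b1 by simp
          then have zn: "z \<noteq> 0" using z0 False by auto
          then have "\<epsilon>3 \<noteq> 0" by (simp add: z_def)
          then have d: "\<delta> = \<rho> + 1" using d2 \<open>\<rho> + 1 \<le> \<delta>\<close> a0 b1 by simp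
          obtain l where l: "\<rho> = l + 2" using False by (metis add.commute le_Suc_ex not_less_eq_eq numeral_2_eq_2 One_nat_def)
          have y: "y = w + 1" using f[of 0] d l by (simp add: algebra_simps)
          \<comment> \<open>What remains of \<open>f\<close> after using \<open>y = w + 1\<close>
            and dividing by \<open>x\<close>; \<open>q2\<close> comes from one further division by
            \<open>x\<close>.\<close>
          define q where "q = [:y - 2 * w, w:] - [:0, 1:] ^ (l + 1) * [:z, 1 - z:]"
          have "q = 0"
          proof (rule zero_off_point[of 0])
            fix x :: complex assume x: "x \<noteq> 0"
            have "x * poly q x = 0"
              using f[of x] y d l by (simp add: q_def poly_power algebra_simps power2_eq_square power_add)
            then show "poly q x = 0" using x by simp
          qed
          then have q: "poly q x = 0" for x by simp
          have yw: "y = 2 * w" using q[of 0] by (simp add: q_def poly_power power_0_left)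
          then have w: "w = 1" using y by simp
          define q2 where "q2 = [:1:] - [:0, 1:] ^ l * [:z, 1 - z:]"
          have "q2 = 0"
          proof (rule zero_off_point[of 0])
            fix x :: complex assume x: "x \<noteq> 0"
            have "x * poly q2 x = 0"
              using q[of x] yw w by (simp add: q_def q2_def poly_power algebra_simps)
            then show "poly q2 x = 0" using x by simp
          qed
          then have q2: "poly q2 x = 0" for x by simp
          have "l = 0" using q2[of 0] by (cases "l = 0") (simp_all add: q2_def poly_power power_0_left)
          moreover have "z = 1" using q2[of 0] \<open>l = 0\<close> by (simp add: q2_def)
          ultimately show ?thesis using a0 b1 d l e n5 by simp
        qed
      qed
    qed
  qed
qed

section \<open>Limits along rays\<close>

lemma inverse_power_ray:
  "(\<lambda>n. 1 / (of_nat n :: complex) ^ e) \<longlonglongrightarrow> (if e = 0 then 1 else 0)"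
proof (cases "e = 0")
  case False
  have "(\<lambda>n. (1 / (of_nat n :: complex)) ^ e) \<longlonglongrightarrow> 0 ^ e"
    by (intro tendsto_power lim_1_over_n)
  then show ?thesis using False by (simp add: power_one_over power_0_left)
qed simp

lemma power_ray: "(\<lambda>n. (c * of_nat n + y) ^ i / (of_nat n :: complex) ^ i) \<longlonglongrightarrow> c ^ i"
proof -
  have "(\<lambda>n. c + y * (1 / of_nat n)) \<longlonglongrightarrow> c + y * 0"
    by (rule tendsto_add[OF tendsto_const tendsto_mult[OF tendsto_const lim_1_over_n]])
  then have "(\<lambda>n. c + y * (1 / of_nat n)) \<longlonglongrightarrow> c" by (simp only: mult_zero_right add_0_right)
  moreover have "\<forall>\<^sub>F n in sequentially. c + y * (1 / of_nat n) = (c * of_nat n + y) / of_nat n"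
    using eventually_gt_at_top[of 0] by eventually_elim (simp add: add_divide_distrib)
  ultimately have "(\<lambda>n. (c * of_nat n + y) / of_nat n) \<longlonglongrightarrow> c"
    by (rule Lim_transform_eventually)
  then have "(\<lambda>n. ((c * of_nat n + y) / of_nat n) ^ i) \<longlonglongrightarrow> c ^ i" by (rule tendsto_power)
  then show ?thesis by (simp add: power_divide)
qed

lemma scale_ray:
  assumes "(\<lambda>n. F n / (of_nat n :: complex) ^ x) \<longlonglongrightarrow> L" "x \<le> t"
  shows "(\<lambda>n. F n / of_nat n ^ t) \<longlonglongrightarrow> (if x = t then L else 0)"
proof -
  have "(\<lambda>n. F n / of_nat n ^ x * (1 / of_nat n ^ (t - x))) \<longlonglongrightarrow> L * (if t - x = 0 then 1 else 0)"
    by (intro tendsto_mult assms(1) inverse_power_ray)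
  moreover have "(\<lambda>n. F n / of_nat n ^ x * (1 / of_nat n ^ (t - x))) = (\<lambda>n. F n / of_nat n ^ t)"
    using assms(2) by (simp add: power_add[symmetric])
  moreover have "L * (if t - x = 0 then 1 else 0) = (if x = t then L else 0)" using assms(2) by simp
  ultimately show ?thesis by (simp only:)
qed

lemma mult_ray:
  assumes "(\<lambda>n. F n / (of_nat n :: complex) ^ x) \<longlonglongrightarrow> L" "(\<lambda>n. F' n / of_nat n ^ x') \<longlonglongrightarrow> L'"
  shows "(\<lambda>n. F n * F' n / of_nat n ^ (x + x')) \<longlonglongrightarrow> L * L'"
  using tendsto_mult[OF assms] by (simp add: power_add)

lemma poly_ray:
  "(\<lambda>n. poly p (c * of_nat n + y) / (of_nat n :: complex) ^ degree p) \<longlonglongrightarrow> lead_coeff p * c ^ degree p"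
proof -
  have "(\<lambda>n. \<Sum>i\<le>degree p. coeff p i * ((c * of_nat n + y) ^ i / of_nat n ^ degree p))
    \<longlonglongrightarrow> (\<Sum>i\<le>degree p. coeff p i * (if i = degree p then c ^ i else 0))"
    by (intro tendsto_sum tendsto_mult tendsto_const scale_ray power_ray) simp
  also have "(\<Sum>i\<le>degree p. coeff p i * (if i = degree p then c ^ i else 0)) = lead_coeff p * c ^ degree p"
    by (subst sum.remove[of _ "degree p"]) (auto intro!: sum.neutral)
  finally show ?thesis by (simp add: poly_altdef sum_divide_distrib)
qed

text \<open>\<open>G\<close> is the top homogeneous form of \<open>g\<close> at
  \<open>(1, x)\<close>; bounded translations of the arguments do not affect it.\<close>

lemma bipoly_ray:
  assumes "(g :: bipoly) \<noteq> 0"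
  obtains d G where "G \<noteq> 0"
    "\<And>y x z. (\<lambda>n. eval2 g (of_nat n + y) (x * of_nat n + z) / (of_nat n :: complex) ^ d) \<longlonglongrightarrow> poly G x"
proof -
  define K where "K = (\<Sum>i\<le>degree g. degree (coeff g i))"
  have K: "degree (coeff g i) \<le> K" if "i \<le> degree g" for i
    unfolding K_def using that by (intro member_le_sum) auto
  define S where "S = {..degree g} \<times> {..K}"
  define cf where "cf = (\<lambda>x. coeff (coeff g (fst x)) (snd x))"
  have fin: "finite S" by (simp add: S_def)
  have ev: "eval2 g a b = (\<Sum>x\<in>S. cf x * (a ^ fst x * b ^ snd x))" for a b
  proof -
    have "eval2 g a b = (\<Sum>i\<le>degree g. poly (coeff g i) b * a ^ i)"
      unfolding eval2_def poly_altdef[of g "[:a:]"] by (simp add: poly_sum poly_power)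
    also have "\<dots> = (\<Sum>i\<le>degree g. \<Sum>j\<le>K. coeff (coeff g i) j * (a ^ i * b ^ j))"
    proof (rule sum.cong[OF refl])
      fix i assume "i \<in> {..degree g}"
      then have "poly (coeff g i) b = (\<Sum>j\<le>K. coeff (coeff g i) j * b ^ j)"
        unfolding poly_altdef using K[of i]
        by (intro sum.mono_neutral_left) (auto simp: coeff_eq_0)
      then show "poly (coeff g i) b * a ^ i = (\<Sum>j\<le>K. coeff (coeff g i) j * (a ^ i * b ^ j))"
        by (simp add: sum_distrib_left mult_ac)
    qed
    also have "\<dots> = (\<Sum>x\<in>S. cf x * (a ^ fst x * b ^ snd x))"
      unfolding S_def cf_def by (simp add: sum.cartesian_product case_prod_unfold)
    finally show ?thesis .
  qed
  define S' where "S' = {x \<in> S. cf x \<noteq> 0}"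
  have fin': "finite S'" using fin by (simp add: S'_def)
  have "S' \<noteq> {}"
  proof
    assume "S' = {}"
    then have "eval2 g a b = 0" for a b unfolding ev by (intro sum.neutral) (auto simp: S'_def)
    then have "g = 0" by (intro bipoly_eqI) simp
    then show False using assms by simp
  qed
  define d where "d = Max ((\<lambda>x. fst x + snd x) ` S')"
  have dle: "fst x + snd x \<le> d" if "x \<in> S'" for x
    unfolding d_def using that fin' by (intro Max_ge) auto
  obtain x0 where x0: "x0 \<in> S'" "fst x0 + snd x0 = d"
  proof -
    have "d \<in> (\<lambda>x. fst x + snd x) ` S'"
      unfolding d_def using fin' \<open>S' \<noteq> {}\<close> by (intro Max_in) auto
    then show thesis using that by auto
  qed
  define G where "G = (\<Sum>x\<in>S'. if fst x + snd x = d then monom (cf x) (snd x) else 0)"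
  have "coeff G (snd x0) = (\<Sum>x\<in>S'. if x = x0 then cf x else 0)"
    unfolding G_def coeff_sum
    by (rule sum.cong[OF refl]) (use x0 in \<open>auto simp: prod_eq_iff\<close>)
  also have "\<dots> = cf x0" using fin' x0 by simp
  finally have "G \<noteq> 0" using x0 by (auto simp: S'_def)
  moreover have "(\<lambda>n. eval2 g (of_nat n + y) (x * of_nat n + z) / of_nat n ^ d) \<longlonglongrightarrow> poly G x" for x y z :: complex
  proof -
    have ev': "eval2 g a b = (\<Sum>x\<in>S'. cf x * (a ^ fst x * b ^ snd x))" for a b
      unfolding ev by (rule sum.mono_neutral_right) (use fin in \<open>auto simp: S'_def\<close>)
    have "(\<lambda>n. \<Sum>v\<in>S'. cf v * (((1 * of_nat n + y) ^ fst v * (x * of_nat n + z) ^ snd v) / of_nat n ^ d))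
      \<longlonglongrightarrow> (\<Sum>v\<in>S'. cf v * (if fst v + snd v = d then 1 ^ fst v * x ^ snd v else 0))"
      by (intro tendsto_sum tendsto_mult[OF tendsto_const] scale_ray mult_ray power_ray dle)
    also have "(\<Sum>v\<in>S'. cf v * (if fst v + snd v = d then 1 ^ fst v * x ^ snd v else 0)) = poly G x"
      unfolding G_def poly_sum by (rule sum.cong[OF refl]) (auto simp: poly_monom)
    finally show ?thesis unfolding ev' by (simp add: sum_divide_distrib)
  qed
  ultimately show thesis by (rule that)
qed

text \<open>Put \<open>u = n\<close> and \<open>s = x * n\<close>, divide by the top power of
  \<open>n\<close>, and let \<open>n\<close> grow. All terms share the factor \<open>G\<close>
  coming from \<open>g\<close>, which cancels because it is a nonzero polynomial in
  \<open>x\<close>. Each \<open>\<epsilon>\<close> is the leading coefficient of its term if that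
  term reaches the top degree, and 0 otherwise.\<close>

lemma leading_form:
  fixes g :: bipoly and P Q \<Delta> E1 E2 E3 B R :: "complex poly"
  assumes identity: "\<And>u s. poly E1 u * eval2 g (u + 1) s * poly Q (s + u) * poly Q (s + u - 1)
       + poly E2 u * eval2 g (u - 1) s * poly P (s - u) * poly P (s - u - 1)
       + (poly B u * poly R s + poly E3 u) * eval2 g u s * poly P (s - u - 1) * poly Q (s + u - 1)
       = poly B u * eval2 g u (s - 1) * poly \<Delta> (s - 1)"
    and nz: "g \<noteq> 0" "E1 \<noteq> 0" "B \<noteq> 0" "\<Delta> \<noteq> 0" and monic: "lead_coeff P = 1" "lead_coeff Q = 1"
    and R: "degree R = 0 \<Longrightarrow> R = 0"
  obtains \<epsilon>1 \<epsilon>2 \<epsilon>3 \<epsilon>4 \<epsilon>5 where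
    "\<And>x. \<epsilon>1 * (x + 1) ^ (2 * degree Q) + \<epsilon>2 * (x - 1) ^ (2 * degree P)
      + (\<epsilon>3 * x ^ degree R + \<epsilon>4) * (x - 1) ^ degree P * (x + 1) ^ degree Q = \<epsilon>5 * x ^ degree \<Delta>"
    "\<not> (\<epsilon>1 = 0 \<and> \<epsilon>2 = 0 \<and> \<epsilon>3 = 0 \<and> \<epsilon>4 = 0 \<and> \<epsilon>5 = 0)"
    "degree R = 0 \<Longrightarrow> \<epsilon>3 = 0"
    "degree R \<ge> 1 \<Longrightarrow> \<epsilon>5 \<noteq> 0 \<Longrightarrow> degree R + degree Q + degree P \<le> degree \<Delta>"
    "\<epsilon>3 \<noteq> 0 \<Longrightarrow> degree \<Delta> \<le> degree R + degree Q + degree P"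
    "\<epsilon>3 \<noteq> 0 \<Longrightarrow> \<epsilon>5 \<noteq> 0 \<Longrightarrow> \<epsilon>3 * lead_coeff \<Delta> = \<epsilon>5 * lead_coeff R"
proof -
  let ?a = "degree Q" and ?b = "degree P"
  obtain d G where G: "G \<noteq> 0" and
    g_ray: "\<And>y x z. (\<lambda>n. eval2 g (of_nat n + y) (x * of_nat n + z) / (of_nat n :: complex) ^ d) \<longlonglongrightarrow> poly G x"
    using bipoly_ray[OF nz(1)] by metis
  define x1 x2 x3 x4 x5 where "x1 = degree E1 + 2 * ?a" and "x2 = degree E2 + 2 * ?b"
    and "x3 = degree B + degree R + ?a + ?b" and "x4 = degree E3 + ?a + ?b" and "x5 = degree B + degree \<Delta>"
  \<comment> \<open>Terms with a vanishing polynomial are left out of the maximum, for otherwise all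
    the limits might be 0.\<close>
  define t where "t = Max ({x1, x5} \<union> (if E2 = 0 then {} else {x2}) \<union> (if R = 0 then {} else {x3}) \<union> (if E3 = 0 then {} else {x4}))"
  have le: "x1 \<le> t" "E2 \<noteq> 0 \<Longrightarrow> x2 \<le> t" "R \<noteq> 0 \<Longrightarrow> x3 \<le> t" "E3 \<noteq> 0 \<Longrightarrow> x4 \<le> t" "x5 \<le> t"
    unfolding t_def by (auto intro!: Max_ge)
  have "t \<in> {x1, x5} \<union> (if E2 = 0 then {} else {x2}) \<union> (if R = 0 then {} else {x3}) \<union> (if E3 = 0 then {} else {x4})"
    unfolding t_def by (intro Max_in) auto
  then have t: "t = x1 \<or> t = x5 \<or> (t = x2 \<and> E2 \<noteq> 0) \<or> (t = x3 \<and> R \<noteq> 0) \<or> (t = x4 \<and> E3 \<noteq> 0)"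
    by (auto split: if_splits)
  define \<epsilon>1 where "\<epsilon>1 = (if x1 = t then lead_coeff E1 else 0)"
  define \<epsilon>2 where "\<epsilon>2 = (if x2 = t then lead_coeff E2 else 0)"
  define \<epsilon>3 where "\<epsilon>3 = (if x3 = t then lead_coeff B * lead_coeff R else 0)"
  define \<epsilon>4 where "\<epsilon>4 = (if x4 = t then lead_coeff E3 else 0)"
  define \<epsilon>5 where "\<epsilon>5 = (if x5 = t then lead_coeff B * lead_coeff \<Delta> else 0)"
  have lim: "poly G x * (\<epsilon>1 * (x + 1) ^ (2 * ?a) + \<epsilon>2 * (x - 1) ^ (2 * ?b)
      + (\<epsilon>3 * x ^ degree R + \<epsilon>4) * (x - 1) ^ ?b * (x + 1) ^ ?a) = poly G x * (\<epsilon>5 * x ^ degree \<Delta>)" for x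
  proof -
    have Qr: "(\<lambda>n. poly Q ((x + 1) * of_nat n + y) / of_nat n ^ ?a) \<longlonglongrightarrow> (x + 1) ^ ?a" for y
      using poly_ray[of Q "x + 1" y] monic by simp
    have Pr: "(\<lambda>n. poly P ((x - 1) * of_nat n + y) / of_nat n ^ ?b) \<longlonglongrightarrow> (x - 1) ^ ?b" for y
      using poly_ray[of P "x - 1" y] monic by simp
    have ur: "(\<lambda>n. poly p (1 * of_nat n + 0) / (of_nat n :: complex) ^ degree p) \<longlonglongrightarrow> lead_coeff p * 1 ^ degree p" for p
      by (rule poly_ray)
    have sr: "(\<lambda>n. poly p (x * of_nat n + y) / of_nat n ^ degree p) \<longlonglongrightarrow> lead_coeff p * x ^ degree p" for p y
      by (rule poly_ray)
    define F1 F2 F3 F4 F5 where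
      "F1 = (\<lambda>n. poly E1 (1 * of_nat n + 0) * eval2 g (of_nat n + 1) (x * of_nat n + 0) * poly Q ((x + 1) * of_nat n + 0) * poly Q ((x + 1) * of_nat n + (-1)))"
      and "F2 = (\<lambda>n. poly E2 (1 * of_nat n + 0) * eval2 g (of_nat n + (-1)) (x * of_nat n + 0) * poly P ((x - 1) * of_nat n + 0) * poly P ((x - 1) * of_nat n + (-1)))"
      and "F3 = (\<lambda>n. poly B (1 * of_nat n + 0) * poly R (x * of_nat n + 0) * eval2 g (of_nat n + 0) (x * of_nat n + 0) * poly P ((x - 1) * of_nat n + (-1)) * poly Q ((x + 1) * of_nat n + (-1)))"
      and "F4 = (\<lambda>n. poly E3 (1 * of_nat n + 0) * eval2 g (of_nat n + 0) (x * of_nat n + 0) * poly P ((x - 1) * of_nat n + (-1)) * poly Q ((x + 1) * of_nat n + (-1)))"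
      and "F5 = (\<lambda>n. poly B (1 * of_nat n + 0) * eval2 g (of_nat n + 0) (x * of_nat n + (-1)) * poly \<Delta> (x * of_nat n + (-1)))"
    have eq: "F1 n / of_nat n ^ (d + t) + F2 n / of_nat n ^ (d + t) + F3 n / of_nat n ^ (d + t) + F4 n / of_nat n ^ (d + t) = F5 n / of_nat n ^ (d + t)" for n
    proof -
      have "F1 n + F2 n + F3 n + F4 n = F5 n"
        using identity[of "of_nat n" "x * of_nat n"] unfolding F1_def F2_def F3_def F4_def F5_def
        by (simp add: algebra_simps)
      then show ?thesis by (simp add: add_divide_distrib[symmetric])
    qed
    have 1: "(\<lambda>n. F1 n / of_nat n ^ (d + t)) \<longlonglongrightarrow> poly G x * (\<epsilon>1 * (x + 1) ^ (2 * ?a))"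
    proof -
      have "(\<lambda>n. F1 n / of_nat n ^ (degree E1 + d + ?a + ?a)) \<longlonglongrightarrow> lead_coeff E1 * 1 ^ degree E1 * poly G x * (x + 1) ^ ?a * (x + 1) ^ ?a"
        unfolding F1_def by (intro mult_ray ur Qr g_ray)
      from scale_ray[OF this, of "d + t"] le(1) show ?thesis unfolding power_double
        by (auto simp: x1_def \<epsilon>1_def power_add mult_ac split: if_splits)
    qed
    have 2: "(\<lambda>n. F2 n / of_nat n ^ (d + t)) \<longlonglongrightarrow> poly G x * (\<epsilon>2 * (x - 1) ^ (2 * ?b))"
    proof (cases "E2 = 0")
      case True then show ?thesis by (simp add: F2_def \<epsilon>2_def)
    next
      case False
      have "(\<lambda>n. F2 n / of_nat n ^ (degree E2 + d + ?b + ?b)) \<longlonglongrightarrow> lead_coeff E2 * 1 ^ degree E2 * poly G x * (x - 1) ^ ?b * (x - 1) ^ ?b"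
        unfolding F2_def by (intro mult_ray ur Pr g_ray)
      from scale_ray[OF this, of "d + t"] le(2)[OF False] show ?thesis unfolding power_double
        by (auto simp: x2_def \<epsilon>2_def power_add mult_ac split: if_splits)
    qed
    have 3: "(\<lambda>n. F3 n / of_nat n ^ (d + t)) \<longlonglongrightarrow> poly G x * (\<epsilon>3 * x ^ degree R * (x - 1) ^ ?b * (x + 1) ^ ?a)"
    proof (cases "R = 0")
      case True then show ?thesis by (simp add: F3_def \<epsilon>3_def)
    next
      case False
      have "(\<lambda>n. F3 n / of_nat n ^ (degree B + degree R + d + ?b + ?a)) \<longlonglongrightarrow> lead_coeff B * 1 ^ degree B * (lead_coeff R * x ^ degree R) * poly G x * (x - 1) ^ ?b * (x + 1) ^ ?a"
        unfolding F3_def by (intro mult_ray ur sr Pr Qr g_ray)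
      from scale_ray[OF this, of "d + t"] le(3)[OF False] show ?thesis
        by (auto simp: x3_def \<epsilon>3_def mult_ac split: if_splits)
    qed
    have 4: "(\<lambda>n. F4 n / of_nat n ^ (d + t)) \<longlonglongrightarrow> poly G x * (\<epsilon>4 * (x - 1) ^ ?b * (x + 1) ^ ?a)"
    proof (cases "E3 = 0")
      case True then show ?thesis by (simp add: F4_def \<epsilon>4_def)
    next
      case False
      have "(\<lambda>n. F4 n / of_nat n ^ (degree E3 + d + ?b + ?a)) \<longlonglongrightarrow> lead_coeff E3 * 1 ^ degree E3 * poly G x * (x - 1) ^ ?b * (x + 1) ^ ?a"
        unfolding F4_def by (intro mult_ray ur Pr Qr g_ray)
      from scale_ray[OF this, of "d + t"] le(4)[OF False] show ?thesis
        by (auto simp: x4_def \<epsilon>4_def mult_ac split: if_splits)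
    qed
    have 5: "(\<lambda>n. F5 n / of_nat n ^ (d + t)) \<longlonglongrightarrow> poly G x * (\<epsilon>5 * x ^ degree \<Delta>)"
    proof -
      have "(\<lambda>n. F5 n / of_nat n ^ (degree B + d + degree \<Delta>)) \<longlonglongrightarrow> lead_coeff B * 1 ^ degree B * poly G x * (lead_coeff \<Delta> * x ^ degree \<Delta>)"
        unfolding F5_def by (intro mult_ray ur sr g_ray)
      from scale_ray[OF this, of "d + t"] le(5) show ?thesis
        by (auto simp: x5_def \<epsilon>5_def mult_ac split: if_splits)
    qed
    have "(\<lambda>n. F5 n / of_nat n ^ (d + t)) \<longlonglongrightarrow> poly G x * (\<epsilon>1 * (x + 1) ^ (2 * ?a)) + poly G x * (\<epsilon>2 * (x - 1) ^ (2 * ?b))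
       + poly G x * (\<epsilon>3 * x ^ degree R * (x - 1) ^ ?b * (x + 1) ^ ?a) + poly G x * (\<epsilon>4 * (x - 1) ^ ?b * (x + 1) ^ ?a)"
      unfolding eq[symmetric] by (intro tendsto_add 1 2 3 4)
    from LIMSEQ_unique[OF this 5] show ?thesis by (simp add: algebra_simps)
  qed
  show thesis
  proof (rule that[of \<epsilon>1 \<epsilon>2 \<epsilon>3 \<epsilon>4 \<epsilon>5])
    fix x
    define L where "L = smult \<epsilon>1 ([:1, 1:] ^ (2 * ?a)) + smult \<epsilon>2 ([:-1, 1:] ^ (2 * ?b))
      + (monom \<epsilon>3 (degree R) + [:\<epsilon>4:]) * [:-1, 1:] ^ ?b * [:1, 1:] ^ ?a - monom \<epsilon>5 (degree \<Delta>)"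
    have L: "poly L x = \<epsilon>1 * (x + 1) ^ (2 * ?a) + \<epsilon>2 * (x - 1) ^ (2 * ?b)
      + (\<epsilon>3 * x ^ degree R + \<epsilon>4) * (x - 1) ^ ?b * (x + 1) ^ ?a - \<epsilon>5 * x ^ degree \<Delta>" for x
      by (simp add: L_def poly_power poly_monom add.commute)
    have "poly (G * L) x = 0" for x
      unfolding poly_mult L using lim[of x] by (simp only: right_diff_distrib diff_self)
    then have "G * L = 0" by (metis poly_all_0_iff_0)
    then have "L = 0" using G by simp
    then have "poly L x = 0" by simp
    then show "\<epsilon>1 * (x + 1) ^ (2 * ?a) + \<epsilon>2 * (x - 1) ^ (2 * ?b)
      + (\<epsilon>3 * x ^ degree R + \<epsilon>4) * (x - 1) ^ ?b * (x + 1) ^ ?a = \<epsilon>5 * x ^ degree \<Delta>" unfolding L by simp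
  next
    show "\<not> (\<epsilon>1 = 0 \<and> \<epsilon>2 = 0 \<and> \<epsilon>3 = 0 \<and> \<epsilon>4 = 0 \<and> \<epsilon>5 = 0)"
      using t nz by (auto simp: \<epsilon>1_def \<epsilon>2_def \<epsilon>3_def \<epsilon>4_def \<epsilon>5_def)
    show "\<epsilon>3 = 0" if "degree R = 0" using R[OF that] by (simp add: \<epsilon>3_def)
    show "degree R + ?a + ?b \<le> degree \<Delta>" if "degree R \<ge> 1" "\<epsilon>5 \<noteq> 0"
      using le(3) that by (cases "R = 0") (auto simp: \<epsilon>5_def x5_def x3_def split: if_splits)
    show "degree \<Delta> \<le> degree R + ?a + ?b" if "\<epsilon>3 \<noteq> 0"
      using le(5) that by (auto simp: \<epsilon>3_def x5_def x3_def split: if_splits)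
    show "\<epsilon>3 * lead_coeff \<Delta> = \<epsilon>5 * lead_coeff R" if "\<epsilon>3 \<noteq> 0" "\<epsilon>5 \<noteq> 0"
      using that by (auto simp: \<epsilon>3_def \<epsilon>5_def split: if_splits)
  qed
qed

section \<open>The shape of the denominator\<close>

text \<open>If \<open>D\<close> is the difference for \<open>p\<close>, then the one for
  \<open>a + s * p\<close> is \<open>s * D - D - p\<close>, which drives the induction. A bound
  \<open>m\<close> in place of the degree covers a vanishing top coefficient.\<close>

lemma coeff_backward_difference:
  fixes p :: "complex poly"
  assumes "degree p \<le> m"
  shows "(\<forall>k\<ge>m. coeff (pcompose p [:-1, 1:] - p) k = 0) \<and>
    (m \<ge> 1 \<longrightarrow> coeff (pcompose p [:-1, 1:] - p) (m - 1) = - of_nat m * coeff p m)"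
  using assms
proof (induction p arbitrary: m)
  case (pCons a p)
  show ?case
  proof (cases "p = 0")
    case False
    then obtain l where m: "m = Suc l" "degree p \<le> l" using pCons.prems by (cases m) auto
    define D where "D = pcompose p [:-1, 1:] - p"
    have IH: "\<And>k. k \<ge> l \<Longrightarrow> coeff D k = 0" "l \<ge> 1 \<Longrightarrow> coeff D (l - 1) = - of_nat l * coeff p l"
      using pCons.IH[OF m(2)] by (auto simp: D_def)
    have "pcompose (pCons a p) [:-1, 1:] - pCons a p = [:0, 1:] * D - D - p"
      by (simp add: pcompose_pCons D_def algebra_simps)
    then have c: "coeff (pcompose (pCons a p) [:-1, 1:] - pCons a p) k
      = (case k of 0 \<Rightarrow> 0 | Suc j \<Rightarrow> coeff D j) - coeff D k - coeff p k" for k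
      by (simp add: coeff_pCons split: nat.split)
    have "coeff p k = 0" if "k \<ge> m" for k using that m by (intro coeff_eq_0) simp
    then have "\<forall>k\<ge>m. coeff (pcompose (pCons a p) [:-1, 1:] - pCons a p) k = 0"
      unfolding c using IH(1) m by (auto split: nat.split)
    moreover have "coeff (pcompose (pCons a p) [:-1, 1:] - pCons a p) (m - 1) = - of_nat m * coeff (pCons a p) m"
    proof (cases l)
      case 0
      then show ?thesis unfolding c using IH m by simp
    next
      case (Suc j)
      have e: "coeff D j = - of_nat (Suc j) * coeff p (Suc j)" "coeff D (Suc j) = 0"
        using IH(2) IH(1)[of "Suc j"] Suc by simp_all
      show ?thesis unfolding c m(1) Suc diff_Suc_1 nat.case e by (simp add: algebra_simps)
    qed
    ultimately show ?thesis by blast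
  qed (auto simp: coeff_pCons split: nat.split)
qed simp

lemma coeff_mult_bound:
  fixes p q :: "complex poly"
  assumes "degree p \<le> m" "degree q \<le> n"
  shows "coeff (p * q) (m + n) = coeff p m * coeff q n"
proof (cases "degree p = m \<and> degree q = n")
  case True
  then show ?thesis using coeff_mult_degree_sum[of p q] by auto
next
  case False
  then have "degree p < m \<or> degree q < n" using assms by auto
  then have "coeff p m * coeff q n = 0" by (auto intro: coeff_eq_0)
  moreover have "degree (p * q) < m + n" using False assms degree_mult_le[of p q] by linarith
  ultimately show ?thesis by (simp add: coeff_eq_0)
qed

lemma coeff_mult_above:
  fixes p q :: "complex poly"
  assumes "degree p \<le> m" "degree q \<le> n" "m + n < k"
  shows "coeff (p * q) k = 0"
  using assms degree_mult_le[of p q] by (intro coeff_eq_0) linarith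

lemma degree_le_pred:
  assumes "degree p \<le> n" "coeff p n = 0"
  shows "degree p \<le> n - 1"
proof (cases "degree p = n")
  case True
  then have "p = 0" using assms(2) by (metis leading_coeff_0_iff)
  then show ?thesis by simp
qed (use assms(1) in linarith)

lemma monic_degree_1:
  fixes p :: "complex poly"
  assumes "degree p = 1" "lead_coeff p = 1"
  shows "p = [:coeff p 0, 1:]"
proof (rule poly_eqI)
  fix k
  show "coeff p k = coeff [:coeff p 0, 1:] k"
    using assms by (cases "k \<le> 1") (auto simp: le_Suc_eq coeff_eq_0 coeff_pCons split: nat.split)
qed

lemma quotient_by_root:
  fixes W :: "complex poly"
  assumes "degree W \<le> 2" "poly W (-1) = 0"
  obtains v where "degree v \<le> 1" "W = [:1, 1:] * v"
proof -
  have "[:1, 1:] dvd W" using assms(2) poly_eq_0_iff_dvd[of W "-1"] by simp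
  then obtain v where v: "W = [:1, 1:] * v" by (rule dvdE)
  have "degree v \<le> 1"
  proof (cases "v = 0")
    case False
    then have "degree ([:1, 1:] * v) = degree [:1, 1 :: complex:] + degree v" by (intro degree_mult_eq) auto
    then show ?thesis using assms(1) v by simp
  qed simp
  then show thesis using v by (rule that)
qed

text \<open>The witness \<open>m\<close> is the degree of \<open>g\<close> in \<open>s\<close>. For
  fixed \<open>u\<close> the terms with \<open>E1\<close>, \<open>E2\<close>, \<open>E3\<close> have
  degree at most \<open>m + 2\<close> in \<open>s\<close>. So the coefficient of
  \<open>s ^ (m + 3)\<close> compares only the terms with \<open>R\<close> and
  \<open>\<Delta>\<close>, and the excess \<open>m * lead_coeff \<Delta>\<close> comes from the top
  coefficient of \<open>g(u, s - 1) - g(u, s)\<close>.\<close>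

lemma second_coefficient:
  fixes E1 E2 E3 B R Q \<Delta> :: "complex poly" and g :: bipoly
  assumes identity: "\<And>u s. poly E1 u * eval2 g (u + 1) s * poly Q (s + u) * poly Q (s + u - 1)
       + poly E2 u * eval2 g (u - 1) s * poly [:0, 1:] (s - u) * poly [:0, 1:] (s - u - 1)
       + (poly B u * poly R s + poly E3 u) * eval2 g u s * poly [:0, 1:] (s - u - 1) * poly Q (s + u - 1)
       = poly B u * eval2 g u (s - 1) * poly \<Delta> (s - 1)"
    and g: "g \<noteq> 0" and B: "B \<noteq> 0" and Q: "Q = [:q0, 1:]" and R: "degree R = 2"
    and \<Delta>: "degree \<Delta> = 4" and lc: "lead_coeff \<Delta> = lead_coeff R"
  obtains m :: nat where
    "degree (\<Delta> - [:0, 1:] * Q * (pcompose R [:1, 1:] - [:poly R 0:])) \<le> 3"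
    "coeff (\<Delta> - [:0, 1:] * Q * (pcompose R [:1, 1:] - [:poly R 0:])) 3 = of_nat m * lead_coeff \<Delta>"
proof -
  define m where "m = Max ((\<lambda>i. degree (coeff g i)) ` {..degree g})"
  have dm: "degree (coeff g i) \<le> m" for i
  proof (cases "i \<le> degree g")
    case True then show ?thesis unfolding m_def by (intro Max_ge) auto
  next
    case False then show ?thesis by (simp add: coeff_eq_0)
  qed
  obtain i0 where i0: "i0 \<le> degree g" "degree (coeff g i0) = m"
  proof -
    have "m \<in> (\<lambda>i. degree (coeff g i)) ` {..degree g}" unfolding m_def by (intro Max_in) auto
    then show thesis using that by auto
  qed
  have dg: "degree (poly g [:u:]) \<le> m" for u
    unfolding poly_altdef[of g "[:u:]"]
  proof (rule degree_sum_le)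
    fix i assume "i \<in> {..degree g}"
    have "coeff g i * [:u:] ^ i = smult (u ^ i) (coeff g i)" by (simp add: poly_const_pow)
    then show "degree (coeff g i * [:u:] ^ i) \<le> m" using dm[of i] degree_smult_le[of "u ^ i" "coeff g i"] by simp
  qed simp
  \<comment> \<open>The coefficient of \<open>s ^ m\<close> in \<open>g\<close>, as a polynomial in
    \<open>u\<close>; the value of \<open>u\<close> is then fixed away from its roots and those of
    \<open>B\<close>.\<close>
  define T where "T = map_poly (\<lambda>c. coeff c m) g"
  have T: "coeff (poly g [:u:]) m = poly T u" for u
    unfolding T_def by (induction g) (simp_all add: map_poly_pCons)
  have "T \<noteq> 0"
  proof
    assume "T = 0"
    then have "coeff T i0 = 0" by simp
    then have "coeff (coeff g i0) m = 0" by (simp add: T_def coeff_map_poly)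
    then have z: "coeff g i0 = 0" using i0 by (metis leading_coeff_0_iff)
    then have "m = 0" using i0 by simp
    then have "degree (coeff g i) = 0" for i using dm[of i] by simp
    moreover have "coeff (coeff g i) 0 = 0" for i
    proof -
      have "coeff T i = 0" using \<open>T = 0\<close> by simp
      then show ?thesis using \<open>m = 0\<close> by (simp add: T_def coeff_map_poly)
    qed
    ultimately have "coeff g i = 0" for i by (metis leading_coeff_0_iff)
    then show False using g by (simp add: poly_eq_iff)
  qed
  then have "T * B \<noteq> 0" using B by simp
  then obtain u where u: "poly (T * B) u \<noteq> 0" by (metis poly_all_0_iff_0)
  define \<gamma> where "\<gamma> = poly g [:u:]"
  define \<gamma>m where "\<gamma>m = pcompose \<gamma> [:-1, 1:]"
  define \<Delta>m where "\<Delta>m = pcompose \<Delta> [:-1, 1:]"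
  define Qa Qb Pa Pb where "Qa = [:q0 + u, 1:]" and "Qb = [:q0 + u - 1, 1:]" and "Pa = [:- u, 1:]" and "Pb = [:- u - 1, 1:]"
  have e\<gamma>: "eval2 g u s = poly \<gamma> s" for s by (simp add: \<gamma>_def eval2_def)
  have cm: "coeff \<gamma> m \<noteq> 0" using T[of u] u by (simp add: \<gamma>_def)
  have d\<gamma>: "degree \<gamma> \<le> m" by (simp add: \<gamma>_def dg)
  have eq: "smult (poly E1 u) (poly g [:u + 1:] * (Qa * Qb)) + smult (poly E2 u) (poly g [:u - 1:] * (Pa * Pb))
      + smult (poly E3 u) (\<gamma> * (Pb * Qb)) + smult (poly B u) (\<gamma> * (R * (Pb * Qb))) = smult (poly B u) (\<gamma>m * \<Delta>m)"
  proof (rule poly_eqI_all)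
    fix s
    show "poly (smult (poly E1 u) (poly g [:u + 1:] * (Qa * Qb)) + smult (poly E2 u) (poly g [:u - 1:] * (Pa * Pb))
      + smult (poly E3 u) (\<gamma> * (Pb * Qb)) + smult (poly B u) (\<gamma> * (R * (Pb * Qb)))) s = poly (smult (poly B u) (\<gamma>m * \<Delta>m)) s"
      using identity[of u s] unfolding e\<gamma>
      by (simp add: eval2_def Q Qa_def Qb_def Pa_def Pb_def \<gamma>m_def \<Delta>m_def poly_pcompose algebra_simps)
  qed
  have d2: "degree (Qa * Qb) \<le> 2" "degree (Pa * Pb) \<le> 2" "degree (Pb * Qb) \<le> 2"
    using degree_mult_le[of Qa Qb] degree_mult_le[of Pa Pb] degree_mult_le[of Pb Qb]
    by (simp_all add: Qa_def Qb_def Pa_def Pb_def)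
  have "coeff (smult (poly B u) (\<gamma> * (R * (Pb * Qb)))) (m + 3) = coeff (smult (poly B u) (\<gamma>m * \<Delta>m)) (m + 3)"
    unfolding eq[symmetric] using coeff_mult_above[OF dg d2(1), of "m + 3"] coeff_mult_above[OF dg d2(2), of "m + 3"]
      coeff_mult_above[OF d\<gamma> d2(3), of "m + 3"] by simp
  then have main: "coeff (\<gamma>m * \<Delta>m - \<gamma> * (R * (Pb * Qb))) (m + 3) = 0" using u by simp
  define V where "V = \<Delta>m - R * (Pb * Qb)"
  have d\<Delta>m: "degree \<Delta>m = 4" "coeff \<Delta>m 4 = lead_coeff \<Delta>"
  proof -
    show "degree \<Delta>m = 4" by (simp add: \<Delta>m_def degree_pcompose \<Delta>)
    have "lead_coeff \<Delta>m = lead_coeff \<Delta>" unfolding \<Delta>m_def by (subst lead_coeff_comp) auto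
    then show "coeff \<Delta>m 4 = lead_coeff \<Delta>" using \<open>degree \<Delta>m = 4\<close> by simp
  qed
  have "coeff (Pb * Qb) 2 = 1" by (simp add: Pb_def Qb_def numeral_2_eq_2)
  then have "coeff (R * (Pb * Qb)) (2 + 2) = lead_coeff R"
    using coeff_mult_bound[of R 2 "Pb * Qb" 2] d2 R by simp
  then have V4: "coeff V 4 = 0" using d\<Delta>m lc by (simp add: V_def)
  have "degree (R * (Pb * Qb)) \<le> 4" using degree_mult_le[of R "Pb * Qb"] R d2 by linarith
  then have "degree V \<le> 4" unfolding V_def using d\<Delta>m by (intro degree_diff_le) auto
  then have dV: "degree V \<le> 3"
    using degree_le_pred[OF _ V4] by simp
  have "\<gamma>m * \<Delta>m - \<gamma> * (R * (Pb * Qb)) = \<gamma> * V + (\<gamma>m - \<gamma>) * \<Delta>m"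
    by (simp add: V_def algebra_simps)
  then have "coeff (\<gamma> * V) (m + 3) + coeff ((\<gamma>m - \<gamma>) * \<Delta>m) (m + 3) = 0" using main by simp
  moreover have "coeff (\<gamma> * V) (m + 3) = coeff \<gamma> m * coeff V 3" by (rule coeff_mult_bound[OF d\<gamma> dV])
  moreover have "coeff ((\<gamma>m - \<gamma>) * \<Delta>m) (m + 3) = - of_nat m * coeff \<gamma> m * lead_coeff \<Delta>"
  proof (cases "m = 0")
    case True
    then have "\<forall>k. coeff (\<gamma>m - \<gamma>) k = 0" using coeff_backward_difference[OF d\<gamma>] by (simp add: \<gamma>m_def)
    then have "\<gamma>m - \<gamma> = 0" by (simp add: poly_eq_iff)
    then show ?thesis using True by simp
  next
    case False
    have "degree (\<gamma>m - \<gamma>) \<le> m - 1"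
      using coeff_backward_difference[OF d\<gamma>] by (intro degree_le) (auto simp: \<gamma>m_def)
    then have "coeff ((\<gamma>m - \<gamma>) * \<Delta>m) (m - 1 + 4) = coeff (\<gamma>m - \<gamma>) (m - 1) * coeff \<Delta>m 4"
      using d\<Delta>m by (intro coeff_mult_bound) simp_all
    moreover have "m - 1 + 4 = m + 3" using False by simp
    moreover have "coeff (\<gamma>m - \<gamma>) (m - 1) = - of_nat m * coeff \<gamma> m"
      using coeff_backward_difference[OF d\<gamma>] False unfolding \<gamma>m_def by simp
    ultimately show ?thesis using d\<Delta>m(2) by (simp only:)
  qed
  ultimately have "coeff \<gamma> m * coeff V 3 + - of_nat m * coeff \<gamma> m * lead_coeff \<Delta> = 0" by (simp only:)
  then have "coeff \<gamma> m * (coeff V 3 - of_nat m * lead_coeff \<Delta>) = 0" by (simp add: algebra_simps)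
  then have V3: "coeff V 3 = of_nat m * lead_coeff \<Delta>" using cm by simp
  define W where "W = \<Delta> - [:0, 1:] * Q * (pcompose R [:1, 1:] - [:poly R 0:])"
  \<comment> \<open>The product \<open>(s - u - 1) * Q(s + u - 1)\<close> differs from
    \<open>(s - 1) * Q(s - 1)\<close> by the constant \<open>u * u + u * q0\<close>, so all
    dependence on \<open>u\<close> goes into a remainder of degree at most 2.\<close>
  define r where "r = smult (u * u + u * q0) R - smult (poly R 0) ([:-1, 1:] * [:q0 - 1, 1:])"
  have Wm: "pcompose W [:-1, 1:] = V - r"
  proof (rule poly_eqI_all)
    fix s show "poly (pcompose W [:-1, 1:]) s = poly (V - r) s"
      by (simp add: W_def V_def r_def \<Delta>m_def Pb_def Qb_def Q poly_pcompose algebra_simps)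
  qed
  have dr: "degree r \<le> 2"
  proof -
    have "degree (smult (u * u + u * q0) R) \<le> 2" using R degree_smult_le[of _ R] by metis
    moreover have "degree (smult (poly R 0) ([:-1, 1:] * [:q0 - 1, 1:])) \<le> 2"
      by (rule order_trans[OF degree_smult_le]) (simp add: degree_pCons_le)
    ultimately show ?thesis unfolding r_def by (intro degree_diff_le)
  qed
  have "degree (pcompose W [:-1, 1:]) \<le> 3" unfolding Wm using dV dr by (intro degree_diff_le) auto
  then have dW: "degree W \<le> 3" by (simp add: degree_pcompose)
  have "coeff (pcompose W [:-1, 1:] - W) 3 = 0" using coeff_backward_difference[OF dW] by simp
  then have "coeff W 3 = coeff V 3 - coeff r 3" unfolding Wm by simp
  also have "coeff r 3 = 0" using dr by (intro coeff_eq_0) simp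
  finally have "coeff W 3 = of_nat m * lead_coeff \<Delta>" using V3 by simp
  then show thesis using that[of m] dW unfolding W_def by blast
qed

text \<open>The aim is that \<open>\<Delta> - s * Q(s) * (R(s + 1) - R(0))\<close> has degree at
  most 2. It vanishes at -1 because both parts do, which yields \<open>v\<close>. The cubic
  coefficient can survive only for \<open>degree Q = 1\<close>, \<open>degree R = 2\<close>, and
  there \<open>\<Delta>\<close> is replaced by \<open>\<Delta>'\<close>.\<close>

lemma normalise_denominator:
  fixes E1 E2 E3 B R P Q \<Delta> :: "complex poly" and g :: bipoly
  assumes identity: "\<And>u s. poly E1 u * eval2 g (u + 1) s * poly Q (s + u) * poly Q (s + u - 1)
       + poly E2 u * eval2 g (u - 1) s * poly P (s - u) * poly P (s - u - 1)
       + (poly B u * poly R s + poly E3 u) * eval2 g u s * poly P (s - u - 1) * poly Q (s + u - 1)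
       = poly B u * eval2 g u (s - 1) * poly \<Delta> (s - 1)"
    and nz: "g \<noteq> 0" "E1 \<noteq> 0" "B \<noteq> 0" "\<Delta> \<noteq> 0" and monic: "lead_coeff P = 1" "lead_coeff Q = 1"
    and P0: "poly P 0 = 0" and \<Delta>0: "poly \<Delta> (-1) = 0"
  obtains (linear) \<Delta>' h v where "P = [:0, 1:]" "degree Q \<le> 1" "degree R \<le> 2" "degree v \<le> 1"
      "\<Delta>' = [:0, 1:] * Q * (pcompose R [:1, 1:] - [:poly R 0:]) + [:1, 1:] * v"
      "\<Delta>' \<noteq> 0" "h \<noteq> 0" "pcompose h [:1, 1:] * \<Delta>' = h * \<Delta>"
    | (quadratic) "degree P = 2" "degree Q = 2" "degree R = 0" "degree \<Delta> = 2"
proof -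
  \<comment> \<open>A constant \<open>R\<close> is absorbed into \<open>E3\<close>; otherwise the
    terms with \<open>\<epsilon>3\<close> and \<open>\<epsilon>4\<close> would have the same shape
    and might cancel.\<close>
  define R' where "R' = (if degree R = 0 then 0 else R)"
  define E3' where "E3' = (if degree R = 0 then E3 + smult (coeff R 0) B else E3)"
  have R0: "R = [:coeff R 0:]" if "degree R = 0" using that by (metis degree_0_id monom_0)
  have Rs: "poly R s = coeff R 0" if "degree R = 0" for s using R0[OF that] by (metis poly_const_conv)
  have dR': "degree R' = degree R" by (simp add: R'_def)
  have BR: "poly B u * poly R' s + poly E3' u = poly B u * poly R s + poly E3 u" for u s
    using Rs by (simp add: R'_def E3'_def algebra_simps)
  have id': "poly E1 u * eval2 g (u + 1) s * poly Q (s + u) * poly Q (s + u - 1)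
       + poly E2 u * eval2 g (u - 1) s * poly P (s - u) * poly P (s - u - 1)
       + (poly B u * poly R' s + poly E3' u) * eval2 g u s * poly P (s - u - 1) * poly Q (s + u - 1)
       = poly B u * eval2 g u (s - 1) * poly \<Delta> (s - 1)" for u s
    unfolding BR by (rule identity)
  have degP: "degree P \<ge> 1"
  proof (rule ccontr)
    assume "\<not> degree P \<ge> 1"
    then obtain c where "P = [:c:]" by (metis degree_eq_zeroE less_one not_le)
    then show False using P0 monic by simp
  qed
  have deg\<Delta>: "degree \<Delta> \<ge> 1"
  proof (rule ccontr)
    assume "\<not> degree \<Delta> \<ge> 1"
    then obtain c where "\<Delta> = [:c:]" by (metis degree_eq_zeroE less_one not_le)
    then show False using \<Delta>0 nz by simp
  qed
  have RR: "R' = 0" if "degree R' = 0" using that by (simp add: R'_def split: if_splits)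
  obtain \<epsilon>1 \<epsilon>2 \<epsilon>3 \<epsilon>4 \<epsilon>5 where form:
    "\<And>x. \<epsilon>1 * (x + 1) ^ (2 * degree Q) + \<epsilon>2 * (x - 1) ^ (2 * degree P)
      + (\<epsilon>3 * x ^ degree R' + \<epsilon>4) * (x - 1) ^ degree P * (x + 1) ^ degree Q = \<epsilon>5 * x ^ degree \<Delta>"
    "\<not> (\<epsilon>1 = 0 \<and> \<epsilon>2 = 0 \<and> \<epsilon>3 = 0 \<and> \<epsilon>4 = 0 \<and> \<epsilon>5 = 0)"
    "degree R' = 0 \<Longrightarrow> \<epsilon>3 = 0"
    "degree R' \<ge> 1 \<Longrightarrow> \<epsilon>5 \<noteq> 0 \<Longrightarrow> degree R' + degree Q + degree P \<le> degree \<Delta>"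
    "\<epsilon>3 \<noteq> 0 \<Longrightarrow> degree \<Delta> \<le> degree R' + degree Q + degree P"
    "\<epsilon>3 \<noteq> 0 \<Longrightarrow> \<epsilon>5 \<noteq> 0 \<Longrightarrow> \<epsilon>3 * lead_coeff \<Delta> = \<epsilon>5 * lead_coeff R'"
  proof (rule leading_form[OF id' nz monic RR], assumption, goal_cases)
    case (1 \<epsilon>1 \<epsilon>2 \<epsilon>3 \<epsilon>4 \<epsilon>5)
    show ?case by (rule 1(1)[OF 1(2-7)])
  qed
  have lc: "lead_coeff \<Delta> = lead_coeff R" if "\<epsilon>3 = \<epsilon>5" "\<epsilon>5 \<noteq> 0" "degree R \<ge> 1"
  proof -
    have "\<epsilon>5 * lead_coeff \<Delta> = \<epsilon>5 * lead_coeff R'" using form(6) that by simp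
    then show ?thesis using that by (simp add: R'_def)
  qed
  note cases = leading_form_cases[OF form(1,2) degP deg\<Delta> form(3,4,5), unfolded dR']
  show thesis
  proof (cases "degree P = 2 \<and> degree Q = 2 \<and> degree R = 0 \<and> degree \<Delta> = 2")
    case True then show ?thesis using quadratic by blast
  next
    case False
    have dP: "degree P = 1" and dQ: "degree Q \<le> 1" and dR: "degree R \<le> 2" using cases False by auto
    have P: "P = [:0, 1:]"
      using monic_degree_1[OF dP monic(1)] P0 by (simp add: poly_0_coeff_0)
    define T where "T = [:0, 1:] * Q * (pcompose R [:1, 1:] - [:poly R 0:])"
    define W where "W = \<Delta> - T"
    have Wm1: "poly W (-1) = 0" by (simp add: W_def T_def poly_pcompose \<Delta>0)
    have Qnz: "Q \<noteq> 0" using monic by auto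
    have T_deg: "degree T = 1 + degree Q + degree R \<and> lead_coeff T = lead_coeff R" if "degree R \<ge> 1"
    proof -
      let ?R1 = "pcompose R [:1, 1:]"
      have dR1: "degree ?R1 = degree R" by (simp add: degree_pcompose)
      have lR1: "lead_coeff ?R1 = lead_coeff R" by (subst lead_coeff_comp) auto
      have d: "degree (?R1 - [:poly R 0:]) = degree R" 
        using degree_add_eq_left[of "- [:poly R 0:]" ?R1] that dR1 unfolding diff_conv_add_uminus by simp
      have l: "lead_coeff (?R1 - [:poly R 0:]) = lead_coeff R"
        using lR1 that unfolding d dR1 by (cases "degree R") (auto simp: coeff_pCons)
      have nz': "?R1 - [:poly R 0:] \<noteq> 0" using d that by auto
      have "degree T = degree ([:0, 1:] * Q) + degree (?R1 - [:poly R 0:])"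
        unfolding T_def using Qnz nz' by (intro degree_mult_eq) auto
      moreover have "degree ([:0, 1:] * Q) = 1 + degree Q" using Qnz by simp
      moreover have "lead_coeff T = lead_coeff ([:0, 1:] * Q) * lead_coeff R"
        unfolding T_def lead_coeff_mult l ..
      moreover have "lead_coeff ([:0, 1:] * Q) = 1" unfolding lead_coeff_mult using monic by simp
      ultimately show ?thesis using d by simp
    qed
    have W_easy: "degree W \<le> 2" if "\<not> (degree Q = 1 \<and> degree R = 2)"
    proof (cases "degree R = 0")
      case True
      have "T = 0"
      proof (rule poly_eqI_all)
        fix x show "poly T x = poly 0 x" unfolding T_def by (simp add: poly_pcompose Rs[OF True])
      qed
      then have "W = \<Delta>" by (simp add: W_def)
      then show ?thesis using cases True dP by auto
    next
      case R1: False
      then have T': "degree T = 1 + degree Q + degree R" "lead_coeff T = lead_coeff R" using T_deg by auto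
      show ?thesis
      proof (cases "degree Q = 0 \<and> degree R = 1")
        case True
        then have "degree T \<le> 2" "degree \<Delta> \<le> 2" using T' cases dP by auto
        then show ?thesis unfolding W_def by (intro degree_diff_le)
      next
        case False
        then have c: "degree \<Delta> = 3 \<and> degree T = 3 \<and> \<epsilon>3 = \<epsilon>5 \<and> \<epsilon>5 \<noteq> 0"
          using cases R1 T' that dP dQ by auto
        then have "coeff W 3 = 0" using lc R1 T' by (auto simp: W_def)
        moreover have "degree W \<le> 3" unfolding W_def using c by (intro degree_diff_le) auto
        ultimately show ?thesis using degree_le_pred[of W 3] by simp
      qed
    qed
    show thesis
    proof (cases "degree Q = 1 \<and> degree R = 2")
      case False
      obtain v where v: "degree v \<le> 1" "W = [:1, 1:] * v"
        using quotient_by_root[OF W_easy[OF False] Wm1] .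
      show ?thesis
      proof (rule linear[of v \<Delta> 1])
        show "\<Delta> = [:0, 1:] * Q * (pcompose R [:1, 1:] - [:poly R 0:]) + [:1, 1:] * v"
          using v(2) unfolding W_def T_def by (simp only: diff_eq_eq add.commute)
        show "pcompose 1 [:1, 1:] * \<Delta> = 1 * \<Delta>" by (simp only: pcompose_1)
      qed (use P dQ dR v nz in auto)
    next
      case True
      then have c: "degree \<Delta> = 4" "lead_coeff \<Delta> = lead_coeff R" using cases dP lc by auto
      obtain q0 where q0: "Q = [:q0, 1:]"
        using that[OF monic_degree_1[OF _ monic(2)]] True by blast
      obtain m :: nat where m: "degree W \<le> 3" "coeff W 3 = of_nat m * lead_coeff \<Delta>"
        using second_coefficient[OF identity[unfolded P] nz(1,3) q0 _ c(1,2)] True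
        unfolding W_def T_def by metis
      have "[:1, 1:] dvd \<Delta>" using \<Delta>0 poly_eq_0_iff_dvd[of \<Delta> "-1"] by simp
      then obtain \<Delta>1 where \<Delta>1: "\<Delta> = [:1, 1:] * \<Delta>1" by (rule dvdE)
      have "\<Delta>1 \<noteq> 0" using \<Delta>1 nz by auto
      have d\<Delta>1: "degree \<Delta>1 = 3"
        using c(1) unfolding \<Delta>1 using \<open>\<Delta>1 \<noteq> 0\<close> by (subst (asm) degree_mult_eq) auto
      then obtain r where "poly \<Delta>1 r = 0" by (metis fundamental_theorem_of_algebra constant_degree zero_neq_numeral)
      then have "[:- r, 1:] dvd \<Delta>1" by (simp add: poly_eq_0_iff_dvd)
      then obtain \<Delta>2 where \<Delta>2: "\<Delta>1 = [:- r, 1:] * \<Delta>2" by (rule dvdE)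
      have "\<Delta>2 \<noteq> 0" using \<Delta>2 \<open>\<Delta>1 \<noteq> 0\<close> by auto
      have d\<Delta>2: "degree \<Delta>2 = 2"
        using d\<Delta>1 unfolding \<Delta>2 using \<open>\<Delta>2 \<noteq> 0\<close> by (subst (asm) degree_mult_eq) auto
      have l\<Delta>2: "coeff \<Delta>2 2 = lead_coeff \<Delta>"
        unfolding \<Delta>1 \<Delta>2 lead_coeff_mult using d\<Delta>2 by simp
      \<comment> \<open>Moving the root \<open>r\<close> to \<open>r + m\<close> lowers the
        coefficient of \<open>s ^ 3\<close> by \<open>m * lead_coeff \<Delta>\<close>, which is the
        excess from \<open>second_coefficient\<close>. The root -1 stays.\<close>
      define \<Delta>' where "\<Delta>' = [:1, 1:] * ([:- r - of_nat m, 1:] * \<Delta>2)"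
      \<comment> \<open>The roots are \<open>r + 1\<close>, ..., \<open>r + m\<close>, and those of
        \<open>h(s + 1)\<close> are \<open>r\<close>, ..., \<open>r + m - 1\<close>. Hence
        \<open>h(s) / h(s + 1) = (s - r - m) / (s - r)\<close>.\<close>
      define h where "h = (\<Prod>l<m. [:- r - of_nat (Suc l), 1:] :: complex poly)"
      have h_shift: "pcompose h [:1, 1:] = (\<Prod>l<m. [:- r - of_nat l, 1:])"
        unfolding h_def pcompose_prod by (rule prod.cong) (simp_all add: pcompose_pCons)
      have "[:- r, 1:] * h = (\<Prod>l<Suc m. [:- r - of_nat l, 1:])"
        unfolding h_def by (subst prod.lessThan_Suc_shift) simp
      then have tele: "[:- r, 1:] * h = pcompose h [:1, 1:] * [:- r - of_nat m, 1:]"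
        unfolding h_shift by simp
      have "\<Delta>' - T = W - smult (of_nat m) ([:1, 1:] * \<Delta>2)"
      proof -
        have e: "[:- r - of_nat m, 1:] = [:- r, 1:] - smult (of_nat m) 1" by (simp add: one_pCons)
        have "\<Delta>' = \<Delta> - smult (of_nat m) ([:1, 1:] * \<Delta>2)"
          unfolding \<Delta>'_def e \<Delta>1 \<Delta>2
          by (simp only: left_diff_distrib right_diff_distrib mult_smult_left mult_smult_right mult_1_left)
        then show ?thesis by (simp add: W_def)
      qed
      moreover define W' where "W' = \<Delta>' - T"
      ultimately have W': "W' = W - smult (of_nat m) ([:1, 1:] * \<Delta>2)" by simp
      have d3: "degree ([:1, 1:] * \<Delta>2) = 3" using \<open>\<Delta>2 \<noteq> 0\<close> d\<Delta>2 by (subst degree_mult_eq) auto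
      have "coeff ([:1, 1:] * \<Delta>2) (1 + 2) = coeff [:1, 1:] 1 * coeff \<Delta>2 2"
        by (rule coeff_mult_bound) (simp_all add: d\<Delta>2)
      moreover have "(1::nat) + 2 = 3" "coeff [:1, 1:] 1 = (1::complex)" by simp_all
      ultimately have "coeff ([:1, 1:] * \<Delta>2) 3 = lead_coeff \<Delta>"
        using l\<Delta>2 by (simp only: mult_1_left)
      then have "coeff W' 3 = 0" unfolding W' using m by simp
      moreover have "degree W' \<le> 3" unfolding W' using m(1) d3 degree_smult_le[of _ "[:1, 1:] * \<Delta>2"]
        by (intro degree_diff_le) (auto intro: order_trans)
      ultimately have "degree W' \<le> 2" using degree_le_pred[of W' 3] by simp
      moreover have "poly W' (-1) = 0" unfolding W' using Wm1 by simp
      ultimately obtain v where v: "degree v \<le> 1" "W' = [:1, 1:] * v" by (rule quotient_by_root)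
      show ?thesis
      proof (rule linear[of v \<Delta>' h])
        show "\<Delta>' = [:0, 1:] * Q * (pcompose R [:1, 1:] - [:poly R 0:]) + [:1, 1:] * v"
          using v(2) unfolding W'_def T_def by (simp only: diff_eq_eq add.commute)
        have "[:- r - of_nat m, 1:] * \<Delta>2 \<noteq> 0" using \<open>\<Delta>2 \<noteq> 0\<close> by (simp only: mult_eq_0_iff) simp
        then show "\<Delta>' \<noteq> 0" unfolding \<Delta>'_def by (simp only: mult_eq_0_iff) simp
        show "h \<noteq> 0" by (simp add: h_def)
        have "pcompose h [:1, 1:] * \<Delta>' = [:1, 1:] * \<Delta>2 * (pcompose h [:1, 1:] * [:- r - of_nat m, 1:])"
          unfolding \<Delta>'_def by (simp only: mult_ac)
        also have "\<dots> = h * \<Delta>" unfolding tele[symmetric] \<Delta>1 \<Delta>2 by (simp only: mult_ac)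
        finally show "pcompose h [:1, 1:] * \<Delta>' = h * \<Delta>" .
      qed (use P dQ dR v in auto)
    qed
  qed
qed

section \<open>Passage to the fields of the theorem\<close>

lemma poly_at_diff: "poly_at (p - q) x = poly_at p x - poly_at q x"
proof -
  have "poly_at ((p - q) + q) x = poly_at (p - q) x + poly_at q x" by (rule poly_at_add)
  then show ?thesis by simp
qed

lemma poly_at_pcompose_var_s: "poly_at (pcompose p [:1, 1:]) var_s = poly_at p (var_s + 1)"
  by (simp only: poly_at_var_s poly_at_var_s_plus_1)

lemma shift2_pCons: "shift2 0 b (pCons c F) = pCons (pcompose c [:b, 1:]) (shift2 0 b F)"
  by (simp add: shift2_def map_poly_pCons pcompose_pCons pcompose_idR)

text \<open>The polynomial with coefficients \<open>Fract c h\<close> is \<open>g / h\<close>. Such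
  denominators in \<open>s\<close> accommodate the product \<open>h\<close> that moves a root of
  \<open>\<Delta>\<close>.\<close>

lemma g_at_Fract:
  assumes "h \<noteq> 0" and x: "x = var_s \<or> x = var_s + 1"
  shows "g_at (map_poly (\<lambda>c. Fract c h) g) x = poly (map_poly (\<lambda>c. poly_at c x) g) var_u / poly_at h x"
proof -
  have "rat_at (Fract 0 1) x = 0" using rat_at_Fract[OF one_neq_zero x, of 0] by simp
  then have z: "Fract 0 h = 0" "rat_at 0 x = 0" using assms(1) by (simp_all add: eq_fract Zero_fract_def)
  show ?thesis
    unfolding g_at_def
    by (induction g) (simp_all add: map_poly_pCons z rat_at_Fract[OF assms] add_divide_distrib)
qed

lemma to_fract_pCons: "to_fract (pCons a F) = to_fract [:a:] + var_u * to_fract F"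
proof -
  have "pCons a F = [:a:] + [:0, 1:] * F" by simp
  then show ?thesis unfolding var_u_def by (simp only: to_fract_add to_fract_mult)
qed

lemma g_at_var_s:
  assumes "h \<noteq> 0"
  shows "g_at (map_poly (\<lambda>c. Fract c h) g) var_s = to_fract g / poly_at h var_s"
    and "g_at (map_poly (\<lambda>c. Fract c h) g) (var_s + 1) = to_fract (shift2 0 1 g) / poly_at h (var_s + 1)"
proof -
  have "poly (map_poly (\<lambda>c. poly_at c var_s) g) var_u = to_fract g"
    by (induction g) (simp_all add: map_poly_pCons poly_at_var_s to_fract_pCons[symmetric])
  then show "g_at (map_poly (\<lambda>c. Fract c h) g) var_s = to_fract g / poly_at h var_s"
    by (simp add: g_at_Fract[OF assms])
  have "poly (map_poly (\<lambda>c. poly_at c (var_s + 1)) g) var_u = to_fract (shift2 0 1 g)"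
    by (induction g)
      (simp_all add: map_poly_pCons poly_at_var_s_plus_1 to_fract_pCons[symmetric] shift2_pCons)
  then show "g_at (map_poly (\<lambda>c. Fract c h) g) (var_s + 1) = to_fract (shift2 0 1 g) / poly_at h (var_s + 1)"
    by (simp add: g_at_Fract[OF assms])
qed

lemma map_poly_Fract_nonzero:
  assumes "h \<noteq> 0" "g \<noteq> 0"
  shows "map_poly (\<lambda>c. Fract c h) g \<noteq> 0"
  using assms by (auto simp: map_poly_eq_0_iff Fract_conv_to_fract)

lemma monic_quadratic_root:
  fixes p :: "complex poly"
  assumes "degree p = 2" "lead_coeff p = 1" "poly p r = 0"
  obtains d where "p = [:- r, 1:] * [:d, 1:]"
proof -
  have "[:- r, 1:] dvd p" using assms(3) by (simp add: poly_eq_0_iff_dvd)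
  then obtain q where q: "p = [:- r, 1:] * q" by (rule dvdE)
  have "q \<noteq> 0" using q assms(1) by auto
  then have "degree p = degree [:- r, 1:] + degree q" unfolding q by (intro degree_mult_eq) auto
  then have "degree q = 1" using assms(1) by simp
  moreover have "lead_coeff q = 1" using assms(2) unfolding q lead_coeff_mult by simp
  ultimately show thesis using monic_degree_1[of q] q that by metis
qed

lemma quasi_orthogonal_form:
  assumes "rational_HG_family P" and "quasi_orthogonal P"
  obtains R g p q \<Delta> E1 E2 E3 B where
    "given_by P R (to_fract (shift2 0 1 g) / to_fract g *
       (poly_at p (var_s - var_u) * poly_at q (var_s + var_u) / poly_at \<Delta> var_s))"
    "g \<noteq> 0" "lead_coeff p = 1" "lead_coeff q = 1" "\<Delta> \<noteq> 0" "E1 \<noteq> 0" "E2 \<noteq> 0" "B \<noteq> 0"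
    "\<And>u s. poly E1 u * eval2 g (u + 1) s * poly q (s + u) * poly q (s + u - 1)
       + poly E2 u * eval2 g (u - 1) s * poly p (s - u) * poly p (s - u - 1)
       + (poly B u * poly R s + poly E3 u) * eval2 g u s * poly p (s - u - 1) * poly q (s + u - 1)
       = poly B u * eval2 g u (s - 1) * poly \<Delta> (s - 1)"
    "poly p 0 = 0" "poly \<Delta> (-1) = 0"
proof -
  obtain R r where fam: "poly_family P" and given: "given_by P R r"
    using assms(1) unfolding rational_HG_family_def by blast
  from given obtain N D c where cop: "coprime N D" "D \<noteq> 0" and r: "r = Fract N D" and c: "newton_coeffs R P c"
    and hg: "\<And>n k :: int. eval2 D (of_int n) (of_int k) * c n (k + 1) = eval2 N (of_int n) (of_int k) * c n k"
    unfolding given_by_def by blast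
  obtain \<alpha> \<beta> where rec:
    "\<And>n. n \<ge> 1 \<Longrightarrow> \<beta> n \<noteq> 0 \<and> [:0, 1:] * P n = P (Suc n) + smult (\<alpha> n) (P n) + smult (\<beta> n) (P (n - 1))"
    using three_term_recurrence[OF fam assms(2)] by blast
  interpret hg_orth R N D c \<alpha> \<beta>
  proof unfold_locales
    show "c m k = 0" if "\<not> (0 \<le> k \<and> k \<le> m)" for k m using c that unfolding newton_coeffs_def by blast
    show "c (int n) (k - 1) - (poly R (of_int k) + \<alpha> n) * c (int n) k = c (int n + 1) k + \<beta> n * c (int n - 1) k"
      if "n \<ge> 1" for n k
      by (rule newton_coeffs_recurrence[OF c that]) (use rec[OF that] in blast)
  qed (use cop hg newton_coeffs_diag[OF fam c] rec in blast)+
  obtain a1 a2 where a: "a2 \<noteq> 0"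
    "\<forall>\<^sub>F n in sequentially. poly a2 (of_nat n) \<noteq> 0 \<and> \<alpha> n = poly a1 (of_nat n) / poly a2 (of_nat n)"
    by (rule \<alpha>_rational)
  interpret hg_orth_rat R N D c \<alpha> \<beta> a1 a2
    by unfold_locales (rule a)+
  have gb: "given_by P R f"
    using given by (simp add: r f_def Fract_conv_to_fract)
  show thesis
  proof (rule canonical_form, goal_cases)
    case (1 g p q \<Delta> E1 E2 E3 B)
    show ?case
      by (rule that[OF gb[unfolded 1(8)] 1(1-7) 1(9-11)])
  qed
qed

theorem theorem4:
  fixes P :: "nat \<Rightarrow> complex poly"
  assumes "rational_HG_family P" and "quasi_orthogonal P"
  shows "\<exists>(g :: complex poly fract poly) (f :: bifract) (R :: complex poly).
    g \<noteq> 0 \<and>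
    given_by P R (f * (g_at g (var_s + 1) / g_at g var_s)) \<and>
    ((degree R \<le> 2 \<and>
      (\<exists>q v :: complex poly. degree q \<le> 1 \<and> degree v \<le> 1 \<and>
        var_s * poly_at q var_s * (poly_at R (var_s + 1) - const_rat (poly R 0))
          + (var_s + 1) * poly_at v var_s \<noteq> 0 \<and>
        f = ((var_s - var_u) * poly_at q (var_s + var_u)) /
            (var_s * poly_at q var_s * (poly_at R (var_s + 1) - const_rat (poly R 0))
              + (var_s + 1) * poly_at v var_s)))
     \<or>
     (degree R = 0 \<and>
      (\<exists>(q :: complex poly) (b :: complex) (d :: complex). degree q = 2 \<and>
        f = ((var_s - var_u) / (var_s + 1)) *
            (((var_s - var_u - const_rat b) * poly_at q (var_s + var_u)) /
             (var_s + const_rat d)))))"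
proof -
  obtain R g p q \<Delta> E1 E2 E3 B where
    gb: "given_by P R (to_fract (shift2 0 1 g) / to_fract g *
       (poly_at p (var_s - var_u) * poly_at q (var_s + var_u) / poly_at \<Delta> var_s))" and
    nz: "g \<noteq> 0" "E1 \<noteq> 0" "B \<noteq> 0" "\<Delta> \<noteq> 0" and monic: "lead_coeff p = 1" "lead_coeff q = 1" and
    identity: "\<And>u s. poly E1 u * eval2 g (u + 1) s * poly q (s + u) * poly q (s + u - 1)
       + poly E2 u * eval2 g (u - 1) s * poly p (s - u) * poly p (s - u - 1)
       + (poly B u * poly R s + poly E3 u) * eval2 g u s * poly p (s - u - 1) * poly q (s + u - 1)
       = poly B u * eval2 g u (s - 1) * poly \<Delta> (s - 1)" and
    roots: "poly p 0 = 0" "poly \<Delta> (-1) = 0"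
  proof (rule quasi_orthogonal_form[OF assms], goal_cases)
    case (1 R g p q \<Delta> E1 E2 E3 B)
    show ?case by (rule 1(1)[OF 1(2,3,7,9,6,4,5,10,11,12)])
  qed
  have at_nz: "poly_at h var_s \<noteq> 0" "poly_at h (var_s + 1) \<noteq> 0" if "h \<noteq> 0" for h
    using that by (simp_all add: poly_at_var_s poly_at_var_s_plus_1 pcompose_eq_0_iff)
  show ?thesis
  proof (rule normalise_denominator[OF identity nz monic roots])
    fix \<Delta>' h v
    assume p: "p = [:0, 1:]" and deg: "degree q \<le> 1" "degree R \<le> 2" "degree v \<le> 1"
      and \<Delta>': "\<Delta>' = [:0, 1:] * q * (pcompose R [:1, 1:] - [:poly R 0:]) + [:1, 1:] * v"
      and "\<Delta>' \<noteq> 0" and h: "h \<noteq> 0" and shift: "pcompose h [:1, 1:] * \<Delta>' = h * \<Delta>"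
    define den where "den = var_s * poly_at q var_s * (poly_at R (var_s + 1) - const_rat (poly R 0))
      + (var_s + 1) * poly_at v var_s"
    define f where "f = ((var_s - var_u) * poly_at q (var_s + var_u)) / den"
    define g' where "g' = map_poly (\<lambda>c. Fract c h) g"
    have den: "den = poly_at \<Delta>' var_s"
      unfolding den_def \<Delta>' by (simp add: poly_at_diff poly_at_pcompose_var_s algebra_simps)
    have den_nz: "den \<noteq> 0" unfolding den using \<open>\<Delta>' \<noteq> 0\<close> by (rule at_nz)
    \<comment> \<open>The factor \<open>h(s) / h(s + 1)\<close>, contributed by
      \<open>g / h\<close>, turns the normalised denominator \<open>\<Delta>'\<close> back into
      \<open>\<Delta>\<close>.\<close>
    have "poly_at h (var_s + 1) * den = poly_at h var_s * poly_at \<Delta> var_s"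
      unfolding den poly_at_pcompose_var_s[symmetric] poly_at_mult[symmetric] shift ..
    then have cancel: "poly_at h var_s / (den * poly_at h (var_s + 1)) = 1 / poly_at \<Delta> var_s"
      using at_nz[OF h] at_nz[OF nz(4)] den_nz by (simp add: frac_eq_eq mult.commute)
    have "f * (g_at g' (var_s + 1) / g_at g' var_s)
      = to_fract (shift2 0 1 g) / to_fract g * ((var_s - var_u) * poly_at q (var_s + var_u)
        * (poly_at h var_s / (den * poly_at h (var_s + 1))))"
      unfolding f_def g'_def g_at_var_s[OF h] by (simp add: mult_ac)
    also have "\<dots> = to_fract (shift2 0 1 g) / to_fract g *
       (poly_at p (var_s - var_u) * poly_at q (var_s + var_u) / poly_at \<Delta> var_s)"
      unfolding cancel p by simp
    finally have "given_by P R (f * (g_at g' (var_s + 1) / g_at g' var_s))" using gb by (simp only:)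
    moreover have "g' \<noteq> 0" unfolding g'_def by (rule map_poly_Fract_nonzero[OF h nz(1)])
    ultimately show ?thesis using deg den_nz unfolding f_def den_def by blast
  next
    assume deg: "degree p = 2" "degree q = 2" "degree R = 0" "degree \<Delta> = 2"
    obtain b' where p: "p = [:- 0, 1:] * [:b', 1:]"
      by (rule monic_quadratic_root[OF deg(1) monic(1) roots(1)])
    define k where "k = lead_coeff \<Delta>"
    have k: "k \<noteq> 0" using nz by (simp add: k_def)
    obtain d where "smult (1 / k) \<Delta> = [:- (-1), 1:] * [:d, 1:]"
      by (rule monic_quadratic_root[of "smult (1 / k) \<Delta>" "-1"]) (use k deg roots in \<open>auto simp: k_def\<close>)
    then have "smult k (smult (1 / k) \<Delta>) = smult k ([:1, 1:] * [:d, 1:])" by simp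
    then have \<Delta>: "\<Delta> = smult k ([:1, 1:] * [:d, 1:])" using k by simp
    \<comment> \<open>The denominator in (b) is monic, so the leading coefficient of
      \<open>\<Delta>\<close> goes into \<open>q\<close>. The scalar \<open>b\<close> of (b) will be
      \<open>- b'\<close>, minus the constant term of the second factor of \<open>p\<close>.\<close>
    define q' where "q' = smult (1 / k) q"
    have kk: "const_rat k * const_rat (1 / k) = 1" using k by (simp flip: const_rat_simps(4))
    have neg: "const_rat (- b') = - const_rat b'" by (simp add: const_rat_def flip: to_fract_uminus)
    define f where "f = ((var_s - var_u) / (var_s + 1)) *
      (((var_s - var_u - const_rat (- b')) * poly_at q' (var_s + var_u)) / (var_s + const_rat d))"
    define g' where "g' = map_poly (\<lambda>c. Fract c 1) g"
    have "const_rat k \<noteq> 0" using kk by auto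
    then have inv_k: "const_rat (1 / k) = 1 / const_rat k" using kk by (simp add: eq_divide_eq mult.commute)
    have "poly_at p x = x * (x + const_rat b')" for x unfolding p by (simp add: add.commute)
    moreover have "poly_at \<Delta> var_s = const_rat k * ((var_s + 1) * (var_s + const_rat d))"
      unfolding \<Delta> by (simp add: algebra_simps)
    moreover have "poly_at q' x = poly_at q x / const_rat k" for x by (simp add: q'_def inv_k)
    ultimately have "poly_at p (var_s - var_u) * poly_at q (var_s + var_u) / poly_at \<Delta> var_s = f"
      unfolding f_def neg by (simp add: mult_ac)
    moreover have "g_at g' (var_s + 1) / g_at g' var_s = to_fract (shift2 0 1 g) / to_fract g"
      unfolding g'_def g_at_var_s[OF one_neq_zero] by (simp add: one_pCons)
    ultimately have "given_by P R (f * (g_at g' (var_s + 1) / g_at g' var_s))"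
      using gb by (simp only: mult.commute)
    moreover have "g' \<noteq> 0" unfolding g'_def by (rule map_poly_Fract_nonzero[OF one_neq_zero nz(1)])
    moreover have "degree q' = 2" using deg k by (simp add: q'_def)
    ultimately show ?thesis using deg(3) unfolding f_def by blast
  qed
qed

end
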